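(* Let $d\ge3$ and suppose $\{\omega_{N,d}\}_{N\in\mathbb{N}}$ is a well-separated sequence of $N$-point configurations on $\mathbb{S}^d$. Then there exist positive constants $c_{G,d},b_{G,d}$ such that for all $N\in\mathbb{N}$ $$P_G(\omega_{N,d})\le c_{G,d}\big(D(N)-b_{G,d}\big)N^{1-\frac2d},$$ where $D(N)$ is defined by $E_G(\omega_{N,d})=-D(N)N^{2-2/d}$. In particular, this holds when $\omega_{N,d}$ consists of the first $N$ points of a greedy Green energy sequence on $\mathbb{S}^d$, and for such greedy sequences there are positive constants $C_1,C_2$ such that $C_1\le D(N)\le C_2$ for all $N\ge2$.
   Context: $\mathbb{S}^d$ is the unit sphere in $\mathbb{R}^{d+1}$ with its standard Riemannian metric, volume measure $\mathrm{vol}$, total volume $V$. The Green function $G(x,y)$ of $\mathbb{S}^d$ is symmetric, smooth off the diagonal (with value $+\infty$ on the diagonal), satisfies $\Delta G(x,\cdot)=\delta_x-V^{-1}\mathrm{vol}$ in the sense of distributions, where $\Delta=-\operatorname{div}\nabla$ is the Laplace–Beltrami operator, and is normalized by $\int_{\mathbb{S}^d}G(x,y)\,d\mathrm{vol}(y)=0$ for all $x$. For $\omega_{N,d}=\{x_1,\dots,x_N\}$: $E_G(\omega_{N,d})=\sum_{i\ne j}G(x_i,x_j)$ (ordered pairs) and $P_G(\omega_{N,d})=\min_{x\in\mathbb{S}^d}\sum_{j=1}^N G(x,x_j)$. A sequence of $N$-point configurations $\{\omega_{N,d}\}_{N\in\mathbb{N}}$ is well-separated if there is $c>0$ such that $\min_{i\neq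 j}\|x_i-x_j\|\ge cN^{-1/d}$ for the points of $\omega_{N,d}$, for all $N$ ($\|\cdot\|$ the Euclidean norm). A greedy Green energy sequence is obtained by taking an arbitrary $x_1\in\mathbb{S}^d$ and, for each $N\ge1$, choosing $x_{N+1}$ to be any minimizer of $x\mapsto\sum_{i=1}^N G(x,x_i)$ over $\mathbb{S}^d$. *)

theory Defs
  imports "HOL-Analysis.Analysis"
begin

section \<open>Smooth functions\<close>

text \<open>The \<open>k\<close>-fold continuous differentiability on an open set \<open>U\<close>: all directional derivatives
  exist in the Frechet sense and are again of class \<open>C\<close> of order \<open>k - 1\<close>.\<close>

primrec Ck_on :: "nat \<Rightarrow> ('a::euclidean_space \<Rightarrow> 'b::real_normed_vector) \<Rightarrow> 'a set \<Rightarrow> bool" where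
  "Ck_on 0 f U \<longleftrightarrow> continuous_on U f"
| "Ck_on (Suc k) f U \<longleftrightarrow>
     (\<forall>x\<in>U. f differentiable (at x)) \<and>
     (\<forall>v. Ck_on k (\<lambda>x. frechet_derivative f (at x) v) U)"

text \<open>Smoothness on an arbitrary subset \<open>A\<close> of a Euclidean space: near every point of \<open>A\<close> the
  function is the restriction of a smooth function of the ambient space. On embedded
  submanifolds this is smoothness in the sense of manifolds.\<close>

definition smooth_on :: "'a::euclidean_space set \<Rightarrow> ('a \<Rightarrow> 'b::real_normed_vector) \<Rightarrow> bool" where
  "smooth_on A f \<longleftrightarrow>
     (\<forall>x\<in>A. \<exists>U F. open U \<and> x \<in> U \<and> (\<forall>k. Ck_on k F U) \<and> (\<forall>y\<in>A \<inter> U. F y = f y))"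


section \<open>Volume and Laplacian on the unit sphere\<close>

text \<open>For \<open>A\<close> contained in the unit sphere of an \<open>n\<close>-dimensional space, the surface measure of
  \<open>A\<close> is \<open>n\<close> times the Lebesgue measure of the cone of all \<open>t x\<close> with \<open>0 < t < 1\<close> and
  \<open>x \<in> A\<close> (polar coordinates: the integral of \<open>t\<^sup>n\<^sup>-\<^sup>1\<close> over the unit interval is \<open>1/n\<close>).\<close>

definition sphere_vol :: "'a::euclidean_space measure" where
  "sphere_vol =
     scale_measure (of_nat DIM('a))
       (distr (restrict_space lborel (ball 0 1 - {0})) (restrict_space borel (sphere 0 1))
          (\<lambda>x. x /\<^sub>R norm x))"

lemma space_sphere_vol: "space (sphere_vol :: 'a::euclidean_space measure) = sphere 0 1"
  by (simp add: sphere_vol_def space_restrict_space space_scale_measure)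

lemma emeasure_sphere_vol:
  fixes A :: "'a::euclidean_space set"
  assumes "A \<in> sets borel" "A \<subseteq> sphere 0 1"
  shows "emeasure sphere_vol A =
    of_nat DIM('a) * emeasure lborel {x \<in> ball 0 1 - {0}. x /\<^sub>R norm x \<in> A}"
proof -
  let ?M = "restrict_space lborel (ball 0 1 - {0::'a})"
  let ?g = "\<lambda>x::'a. x /\<^sub>R norm x"
  have "?g \<in> borel_measurable borel" by measurable
  then have "?g \<in> borel_measurable ?M"
    by (metis measurable_lborel2 measurable_restrict_space1)
  then have m: "?g \<in> measurable ?M (restrict_space borel (sphere 0 1))"
    by (intro measurable_restrict_space2) (auto simp: space_restrict_space)
  have A: "A \<in> sets (restrict_space borel (sphere 0 1))"
    using assms by (auto simp: sets_restrict_space_iff)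
  have "?g -` A \<inter> space ?M = {x \<in> ball 0 1 - {0}. ?g x \<in> A}"
    by (auto simp: space_restrict_space)
  then show ?thesis
    unfolding sphere_vol_def
    by (subst emeasure_scale_measure, subst emeasure_distr[OF m A], subst emeasure_restrict_space) auto
qed

lemma emeasure_sphere_vol_sphere:
  "emeasure sphere_vol (sphere 0 1 :: 'a::euclidean_space set) =
     of_nat DIM('a) * emeasure lborel (ball (0::'a) 1)"
proof -
  have "{x \<in> ball 0 1 - {0}. x /\<^sub>R norm x \<in> sphere (0::'a) 1} = ball 0 1 - {0}"
    by auto
  moreover have "emeasure lborel (ball (0::'a) 1 - {0}) = emeasure lborel (ball (0::'a) 1)"
    by (intro emeasure_Diff_null_set) auto
  ultimately show ?thesis by (simp add: emeasure_sphere_vol)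
qed

text \<open>Functions and vector fields on the sphere are extended by homogeneity of degree \<open>0\<close>.
  The derivative of the extension in a tangential direction is that of the original map, and the
  derivative in the radial direction vanishes. So the Euclidean gradient of the extension is the
  Riemannian gradient. Likewise, for tangential \<open>X\<close>, the trace of the Euclidean derivative of the
  extension is the trace of the covariant derivative, since the latter is the tangential part of
  the Euclidean derivative.\<close>

definition radial_ext :: "('a::euclidean_space \<Rightarrow> 'b) \<Rightarrow> 'a \<Rightarrow> 'b" where
  "radial_ext f x = f (x /\<^sub>R norm x)"

definition sphere_grad :: "('a::euclidean_space \<Rightarrow> real) \<Rightarrow> 'a \<Rightarrow> 'a" where
  "sphere_grad f x = (\<Sum>b\<in>Basis. frechet_derivative (radial_ext f) (at x) b *\<^sub>R b)"

definition sphere_div :: "('a::euclidean_space \<Rightarrow> 'a) \<Rightarrow> 'a \<Rightarrow> real" where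
  "sphere_div X x = (\<Sum>b\<in>Basis. frechet_derivative (radial_ext X) (at x) b \<bullet> b)"

definition laplace_beltrami :: "('a::euclidean_space \<Rightarrow> real) \<Rightarrow> 'a \<Rightarrow> real" where
  "laplace_beltrami f x = - sphere_div (sphere_grad f) x"


section \<open>The Green function\<close>

text \<open>Only the values on pairs of points of the unit sphere matter. The integrals involve
  \<^const>\<open>real_of_ereal\<close>, which alters \<open>G x\<close> only at the point \<open>x\<close>.\<close>

definition is_green_function :: "('a::euclidean_space \<Rightarrow> 'a \<Rightarrow> ereal) \<Rightarrow> bool" where
  "is_green_function G \<longleftrightarrow>
     (\<forall>x\<in>sphere 0 1. \<forall>y\<in>sphere 0 1. G x y = G y x) \<and>
     (\<forall>x\<in>sphere 0 1. G x x = \<infinity>) \<and>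
     (\<forall>x\<in>sphere 0 1. \<forall>y\<in>sphere 0 1. x \<noteq> y \<longrightarrow> \<bar>G x y\<bar> \<noteq> \<infinity>) \<and>
     smooth_on {(x, y). x \<in> sphere 0 1 \<and> y \<in> sphere 0 1 \<and> x \<noteq> y}
       (\<lambda>(x, y). real_of_ereal (G x y)) \<and>
     (\<forall>x\<in>sphere 0 1. integrable sphere_vol (\<lambda>y. real_of_ereal (G x y))) \<and>
     (\<forall>x\<in>sphere 0 1. \<forall>\<phi>. smooth_on (sphere 0 1) \<phi> \<longrightarrow>
        (\<integral>y. real_of_ereal (G x y) * laplace_beltrami \<phi> y \<partial>sphere_vol) =
        \<phi> x - (\<integral>y. \<phi> y \<partial>sphere_vol) / measure sphere_vol (sphere (0::'a) 1)) \<and>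
     (\<forall>x\<in>sphere 0 1. (\<integral>y. real_of_ereal (G x y) \<partial>sphere_vol) = 0)"


section \<open>Configurations, energy and polarization\<close>

text \<open>An \<open>N\<close>-point configuration is given by an enumeration \<open>x 1, \<dots>, x N\<close> of its points.\<close>

definition configuration :: "nat \<Rightarrow> (nat \<Rightarrow> 'a::euclidean_space) \<Rightarrow> bool" where
  "configuration N x \<longleftrightarrow> (\<forall>i\<in>{1..N}. x i \<in> sphere 0 1) \<and> inj_on x {1..N}"

definition well_separated :: "nat \<Rightarrow> (nat \<Rightarrow> nat \<Rightarrow> 'a::euclidean_space) \<Rightarrow> bool" where
  "well_separated d \<omega> \<longleftrightarrow>
     (\<exists>c>0. \<forall>N\<ge>1. \<forall>i\<in>{1..N}. \<forall>j\<in>{1..N}. i \<noteq> j \<longrightarrow>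
        norm (\<omega> N i - \<omega> N j) \<ge> c * real N powr (- 1 / real d))"

definition green_energy :: "('a \<Rightarrow> 'a \<Rightarrow> ereal) \<Rightarrow> nat \<Rightarrow> (nat \<Rightarrow> 'a) \<Rightarrow> ereal" where
  "green_energy G N x = (\<Sum>i\<in>{1..N}. \<Sum>j\<in>{1..N} - {i}. G (x i) (x j))"

text \<open>The infimum is a minimum when \<open>G\<close> is the Green function: the sphere is compact and the
  potential is lower semicontinuous.\<close>

definition green_polarization ::
    "('a::euclidean_space \<Rightarrow> 'a \<Rightarrow> ereal) \<Rightarrow> nat \<Rightarrow> (nat \<Rightarrow> 'a) \<Rightarrow> ereal" where
  "green_polarization G N x = (INF z\<in>sphere 0 1. \<Sum>j\<in>{1..N}. G z (x j))"

text \<open>The number \<open>D(N)\<close> determined by \<open>E\<^sub>G = - D(N) N\<^sup>2\<^sup>-\<^sup>2\<^sup>/\<^sup>d\<close>. The energy is finite for distinct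
  points.\<close>

definition energy_coeff :: "nat \<Rightarrow> ('a \<Rightarrow> 'a \<Rightarrow> ereal) \<Rightarrow> nat \<Rightarrow> (nat \<Rightarrow> 'a) \<Rightarrow> real" where
  "energy_coeff d G N x = - real_of_ereal (green_energy G N x) / real N powr (2 - 2 / real d)"

definition greedy_sequence ::
    "('a::euclidean_space \<Rightarrow> 'a \<Rightarrow> ereal) \<Rightarrow> (nat \<Rightarrow> 'a) \<Rightarrow> bool" where
  "greedy_sequence G x \<longleftrightarrow>
     x 1 \<in> sphere 0 1 \<and>
     (\<forall>N\<ge>1. is_arg_min (\<lambda>z. \<Sum>i\<in>{1..N}. G z (x i)) (\<lambda>z. z \<in> sphere 0 1) (x (N + 1)))"

end

(* Let F be the profile of the Green function in the variable s = |x - y|^2, that is, the solution of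
   the equation Delta F = const away from s = 0. Multiplying F' by a smooth cutoff at scale r
   gives a smooth zonal function Phi r with Delta (Phi r x) = Psi r x - 1, where Psi r x is a
   nonnegative bump of mass V (the volume of the sphere) supported in the ball of radius r around x.
   Testing the distributional equation of G with Phi r x gives
     int G(y,w) Psi_r(x,w) dw = Phi_r(x,y) - mean(Phi_r(x,.)),
   and r -> 0 shows V G = F - m0 for a constant m0.

   For a separated configuration, integrate the potential against 1 - (th/N) sum_i Psi_r(x_i,.) with
   r ~ N^(-1/d): this weight is nonnegative, the pair terms reproduce the energy exactly because
   Phi_r = F beyond distance r, and the self terms give a gain of order N^(1-2/d). For a greedy
   sequence, comparing the minimal value of the potential with its mean against Psi_r around the
   minimizer forces separation. The lower bound on D(N) follows by induction from
   E(N+1) = E(N) + 2 P(N), the upper bound from positivity of the Dirichlet form at sum_i Phi_r(x_i,.). *)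

theory Submission
  imports Defs
begin

section \<open>Functions of one real variable\<close>

text \<open>The main information on \<open>G\<close> is its distributional equation, which sees only
  test functions that are smooth on the whole sphere. So F must be regular at the antipode too:
  among the solutions of the equation for F' the one smooth at \<open>s = 4\<close> is chosen, and
  only the singularity at \<open>s = 0\<close> is cut off. The identity V G = F - m0 then gives
  explicit bounds: near the diagonal F behaves like the power 2 - d of the distance.

  The scale r ~ N^(-1/d) is where two quantities balance. A self term has size r^(2-d). Replacing
  the mean of Phi_r by m0 costs at most r^2 / d for each of N points. At this radius both r^(2-d)
  and N r^2 are of order N^(1-2/d). It is also the scale at which Psi_r, of size r^(-d), can be
  subtracted with the factor th/N without making the weight negative.

  All integrations by parts concern zonal functions about at most two poles. They are carried out in
  the ambient space, where the integral of a derivative of a compactly supported function vanishes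
  by translation invariance.\<close>

primrec smooth_upto :: "nat \<Rightarrow> real set \<Rightarrow> (real \<Rightarrow> real) \<Rightarrow> bool" where
  "smooth_upto 0 I f \<longleftrightarrow> True"
| "smooth_upto (Suc k) I f \<longleftrightarrow>
     (\<exists>g. (\<forall>x\<in>I. (f has_real_derivative g x) (at x)) \<and> smooth_upto k I g)"

lemma smooth_upto_SucI:
  assumes "\<And>x. x \<in> I \<Longrightarrow> (f has_real_derivative g x) (at x)" "smooth_upto k I g"
  shows "smooth_upto (Suc k) I f"
  using assms by auto

lemma smooth_upto_SucD: "smooth_upto (Suc k) I f \<Longrightarrow> smooth_upto k I f"
  by (induction k arbitrary: f) auto

lemma smooth_upto_subset: "smooth_upto k I f \<Longrightarrow> J \<subseteq> I \<Longrightarrow> smooth_upto k J f"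
proof (induction k arbitrary: f)
  case (Suc k)
  then obtain g where "\<forall>x\<in>I. (f has_real_derivative g x) (at x)" "smooth_upto k I g" by auto
  with Suc show ?case by (intro smooth_upto_SucI[of J f g]) auto
qed auto

lemma smooth_upto_cong:
  assumes "smooth_upto k I f" "open I" "\<And>x. x \<in> I \<Longrightarrow> f x = g x"
  shows "smooth_upto k I g"
proof (cases k)
  case (Suc j)
  then obtain f' where f': "\<And>x. x \<in> I \<Longrightarrow> (f has_real_derivative f' x) (at x)" "smooth_upto j I f'"
    using assms(1) by auto
  have "(g has_real_derivative f' x) (at x)" if "x \<in> I" for x
    by (rule has_field_derivative_transform_within_open[OF f'(1)[OF that] assms(2) that assms(3)])
  then show ?thesis using Suc f'(2) by (auto intro: smooth_upto_SucI)
qed auto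

text \<open>On the overlap the two derivative witnesses agree because derivatives are unique, so
  they glue. This serves functions that vanish by the cutoff on one open piece and are given on the
  other by a formula smooth only for positive argument.\<close>

lemma smooth_upto_Un:
  assumes "smooth_upto k I f" "smooth_upto k J f" "open I" "open J"
  shows "smooth_upto k (I \<union> J) f"
  using assms(1,2)
proof (induction k arbitrary: f)
  case (Suc k)
  obtain g where g: "\<forall>x\<in>I. (f has_real_derivative g x) (at x)" "smooth_upto k I g"
    using Suc.prems(1) by auto
  obtain h where h: "\<forall>x\<in>J. (f has_real_derivative h x) (at x)" "smooth_upto k J h"
    using Suc.prems(2) by auto
  define u where "u x = (if x \<in> I then g x else h x)" for x
  have uh: "h x = u x" if "x \<in> J" for x
    using that g(1) h(1) DERIV_unique[of f "g x" x "h x"] unfolding u_def by auto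
  have "smooth_upto k I u"
    by (rule smooth_upto_cong[OF g(2) assms(3)]) (auto simp: u_def)
  moreover have "smooth_upto k J u"
    by (rule smooth_upto_cong[OF h(2) assms(4)]) (auto simp: uh)
  ultimately have "smooth_upto k (I \<union> J) u" by (rule Suc.IH)
  moreover have "(f has_real_derivative u x) (at x)" if "x \<in> I \<union> J" for x
    using that g(1) h(1) uh by (auto simp: u_def)
  ultimately show ?case by (rule smooth_upto_SucI[rotated])
qed auto

lemma smooth_upto_const: "smooth_upto k I (\<lambda>x. c)"
proof (induction k arbitrary: c)
  case (Suc k)
  show ?case by (rule smooth_upto_SucI[OF _ Suc[of 0]]) auto
qed auto

lemma smooth_upto_add:
  "smooth_upto k I f \<Longrightarrow> smooth_upto k I g \<Longrightarrow> smooth_upto k I (\<lambda>x. f x + g x)"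
proof (induction k arbitrary: f g)
  case (Suc k)
  then obtain f' g' where
    "\<forall>x\<in>I. (f has_real_derivative f' x) (at x)" "smooth_upto k I f'"
    "\<forall>x\<in>I. (g has_real_derivative g' x) (at x)" "smooth_upto k I g'" by auto
  then show ?case
    by (intro smooth_upto_SucI[OF _ Suc.IH[of f' g']]) (auto intro!: derivative_eq_intros)
qed auto

lemma smooth_upto_mult:
  "smooth_upto k I f \<Longrightarrow> smooth_upto k I g \<Longrightarrow> smooth_upto k I (\<lambda>x. f x * g x)"
proof (induction k arbitrary: f g)
  case (Suc k)
  then obtain f' g' where d:
    "\<forall>x\<in>I. (f has_real_derivative f' x) (at x)" "smooth_upto k I f'"
    "\<forall>x\<in>I. (g has_real_derivative g' x) (at x)" "smooth_upto k I g'" by auto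
  have "smooth_upto k I (\<lambda>x. f' x * g x + f x * g' x)"
    by (intro smooth_upto_add Suc.IH d smooth_upto_SucD[OF Suc.prems(1)] smooth_upto_SucD[OF Suc.prems(2)])
  then show ?case
    by (rule smooth_upto_SucI[rotated]) (use d in \<open>auto intro!: derivative_eq_intros\<close>)
qed auto

lemma smooth_upto_comp_affine:
  "smooth_upto k J f \<Longrightarrow> (\<And>x. x \<in> I \<Longrightarrow> a * x + c \<in> J) \<Longrightarrow> smooth_upto k I (\<lambda>x. f (a * x + c))"
proof (induction k arbitrary: f)
  case (Suc k)
  then obtain f' where d: "\<forall>x\<in>J. (f has_real_derivative f' x) (at x)" "smooth_upto k J f'" by auto
  have "smooth_upto k I (\<lambda>x. a * f' (a * x + c))"
    using Suc.IH[OF d(2) Suc.prems(2)] by (intro smooth_upto_mult smooth_upto_const)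
  moreover have "((\<lambda>x. f (a * x + c)) has_real_derivative a * f' (a * x + c)) (at x)" if "x \<in> I" for x
  proof -
    have "((\<lambda>x. a * x + c) has_real_derivative a) (at x)" by (auto intro!: derivative_eq_intros)
    then show ?thesis
      using DERIV_chain2[of f "f' (a * x + c)" "\<lambda>x. a * x + c" x a UNIV] d(1) Suc.prems(2)[OF that]
      by (auto simp: mult.commute)
  qed
  ultimately show ?case by (rule smooth_upto_SucI[rotated])
qed auto

lemma smooth_upto_powr: "smooth_upto k {0<..} (\<lambda>x. x powr a)"
proof (induction k arbitrary: a)
  case (Suc k)
  have "smooth_upto k {0<..} (\<lambda>x. a * x powr (a - 1))"
    by (intro smooth_upto_mult smooth_upto_const Suc)
  then show ?case
    by (rule smooth_upto_SucI[rotated]) (auto intro!: derivative_eq_intros)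
qed auto

text \<open>Level \<open>k\<close> of \<open>smooth_upto\<close> asks only for \<open>k\<close>
  successive derivatives, the last one possibly discontinuous; continuity is bought with one more
  level. In this way no continuity has to be carried through the inductions.\<close>

lemma smooth_upto_isCont: "smooth_upto (Suc k) I f \<Longrightarrow> x \<in> I \<Longrightarrow> isCont f x"
  by (auto intro: DERIV_isCont)

section \<open>Smooth cutoff functions of one variable\<close>

definition flat_exp :: "nat \<Rightarrow> real \<Rightarrow> real" where
  "flat_exp m x = (if x > 0 then exp (- (1 / x)) / x ^ m else 0)"

lemma flat_exp_nonneg: "flat_exp m x \<ge> 0"
  by (auto simp: flat_exp_def)

lemma flat_exp_tendsto_0: "(flat_exp m \<longlongrightarrow> 0) (at 0)"
proof -
  have "((\<lambda>y. y ^ m / exp y) \<longlongrightarrow> (0::real)) at_top" by (rule tendsto_power_div_exp_0)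
  then have "((\<lambda>x. inverse x ^ m / exp (inverse x)) \<longlongrightarrow> (0::real)) (at_right 0)"
    by (rule filterlim_compose) (rule filterlim_inverse_at_top_right)
  then have "(flat_exp m \<longlongrightarrow> 0) (at_right 0)"
    by (rule Lim_transform_eventually)
      (auto simp: eventually_at_right_field flat_exp_def exp_minus field_simps intro!: exI[of _ 1])
  moreover have "(flat_exp m \<longlongrightarrow> 0) (at_left 0)"
    by (rule Lim_transform_eventually[OF tendsto_const])
      (auto simp: eventually_at_left_field flat_exp_def intro!: exI[of _ "-1"])
  ultimately show ?thesis by (simp add: filterlim_split_at_real)
qed

text \<open>Dividing by \<open>x ^ m\<close> makes the family closed under differentiation, so
  smoothness of every order follows by an induction with \<open>m\<close> arbitrary, without
  formulas for higher derivatives.\<close>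

lemma flat_exp_deriv:
  "(flat_exp m has_real_derivative flat_exp (m + 2) x - real m * flat_exp (m + 1) x) (at x)"
proof -
  consider "x > 0" | "x < 0" | "x = 0" by linarith
  then show ?thesis
  proof cases
    case 1
    have "((\<lambda>x. exp (- (1 / x)) / x ^ m) has_real_derivative
        flat_exp (m + 2) x - real m * flat_exp (m + 1) x) (at x)"
    proof -
      have "real m * x ^ (m - Suc 0) = real m * x ^ m / x" using 1 by (cases m) auto
      then show ?thesis
        using 1 by (auto intro!: derivative_eq_intros simp: flat_exp_def field_simps power2_eq_square)
    qed
    then show ?thesis
      by (rule has_field_derivative_transform_within_open[of _ _ _ "{0<..}"]) (use 1 in \<open>auto simp: flat_exp_def\<close>)
  next
    case 2
    have "((\<lambda>x. 0) has_real_derivative flat_exp (m + 2) x - real m * flat_exp (m + 1) x) (at x)"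
      using 2 by (auto simp: flat_exp_def)
    then show ?thesis
      by (rule has_field_derivative_transform_within_open[of _ _ _ "{..<0}"]) (use 2 in \<open>auto simp: flat_exp_def\<close>)
  next
    case 3
    \<comment> \<open>At \<open>0\<close> the difference quotient of \<open>flat_exp m\<close> is
      \<open>flat_exp (m + 1)\<close> itself.\<close>
    have "((\<lambda>h. (flat_exp m h - flat_exp m 0) / (h - 0)) \<longlongrightarrow> 0) (at 0)"
      by (rule Lim_transform_eventually[OF flat_exp_tendsto_0[of "m + 1"]])
        (auto simp: flat_exp_def eventually_at_filter)
    then show ?thesis using 3 by (auto simp: has_field_derivative_iff flat_exp_def)
  qed
qed

lemma smooth_upto_flat_exp: "smooth_upto k I (flat_exp m)"
proof (induction k arbitrary: m)
  case (Suc k)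
  have "smooth_upto k I (\<lambda>x. flat_exp (m + 2) x + (- real m) * flat_exp (m + 1) x)"
    by (intro smooth_upto_add smooth_upto_mult smooth_upto_const Suc)
  then show ?case
    by (rule smooth_upto_SucI[rotated]) (use flat_exp_deriv in auto)
qed auto

text \<open>It vanishes outside the interval from 1/16 to 1. The argument will be
  \<open>s / r\<^sup>2\<close> with \<open>s\<close> a squared distance, so the step built from it
  is 0 up to distance r / 4 and 1 from distance r on. Being 0 in a whole neighbourhood of
  \<open>s = 0\<close> is what removes the singularity of the profile.\<close>

definition bump0 :: "real \<Rightarrow> real" where
  "bump0 u = flat_exp 0 (u - 1/16) * flat_exp 0 (1 - u)"

definition bump :: "real \<Rightarrow> real" where
  "bump u = bump0 u / integral {0..1} bump0"

definition cutoff :: "real \<Rightarrow> real" where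
  "cutoff u = integral {0..u} bump"

lemma smooth_upto_bump0: "smooth_upto k I bump0"
proof -
  have "smooth_upto k I (\<lambda>u. flat_exp 0 (1 * u + - (1/16)) * flat_exp 0 ((-1) * u + 1))"
    by (intro smooth_upto_mult smooth_upto_comp_affine[OF smooth_upto_flat_exp[of _ UNIV]]) auto
  also have "(\<lambda>u. flat_exp 0 (1 * u + - (1/16)) * flat_exp 0 ((-1) * u + 1)) = bump0"
    by (auto simp: bump0_def)
  finally show ?thesis .
qed

lemma smooth_upto_bump: "smooth_upto k I bump"
  using smooth_upto_mult[OF smooth_upto_bump0 smooth_upto_const[of k I "1 / integral {0..1} bump0"]]
  by (simp add: bump_def[abs_def])

lemma continuous_on_bump0: "continuous_on S bump0"
  using smooth_upto_isCont[OF smooth_upto_bump0[of "Suc 0" UNIV]]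
  by (auto intro: continuous_at_imp_continuous_on)

lemma continuous_on_bump: "continuous_on S bump"
  using smooth_upto_isCont[OF smooth_upto_bump[of "Suc 0" UNIV]]
  by (auto intro: continuous_at_imp_continuous_on)

lemma bump0_integral_pos: "integral {0..1} bump0 > 0"
proof -
  have "integral {0..1} bump0 \<ge> 0"
    by (intro integral_nonneg integrable_continuous_real continuous_on_bump0)
      (auto simp: bump0_def flat_exp_nonneg)
  moreover have "integral {0..1} bump0 \<noteq> 0"
  proof
    assume "integral {0..1} bump0 = 0"
    then have "\<forall>x\<in>{0..1}. bump0 x = 0"
      by (subst (asm) integral_eq_0_iff[OF continuous_on_bump0]) (auto simp: bump0_def flat_exp_nonneg)
    then have "bump0 (1/2) = 0" by (rule bspec) auto
    then show False by (auto simp: bump0_def flat_exp_def)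
  qed
  ultimately show ?thesis by linarith
qed

lemma bump_nonneg: "bump u \<ge> 0"
  using bump0_integral_pos by (auto simp: bump_def bump0_def flat_exp_nonneg)

lemma bump_eq_0: "u \<le> 1/16 \<or> u \<ge> 1 \<Longrightarrow> bump u = 0"
  by (auto simp: bump_def bump0_def flat_exp_def)

lemma bump_bounded: "\<exists>K>0. \<forall>u. bump u \<le> K"
proof -
  have "flat_exp 0 u \<le> 1" for u by (auto simp: flat_exp_def)
  then have "bump0 u \<le> 1" for u
    using flat_exp_nonneg by (auto simp: bump0_def intro!: mult_le_one)
  then have "bump u \<le> 1 / integral {0..1} bump0" for u
    using bump0_integral_pos by (auto simp: bump_def divide_right_mono)
  then show ?thesis using bump0_integral_pos by (intro exI[of _ "1 / integral {0..1} bump0"]) auto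
qed

lemma cutoff_eq_0: "u \<le> 1/16 \<Longrightarrow> cutoff u = 0"
  unfolding cutoff_def by (subst integral_cong[of _ _ "\<lambda>_. 0"]) (auto simp: bump_eq_0)

lemma cutoff_deriv: "(cutoff has_real_derivative bump u) (at u)"
proof (cases "u > 0")
  case True
  have "(cutoff has_real_derivative bump u) (at u within {0..u+1})"
    unfolding cutoff_def[abs_def]
    by (rule integral_has_real_derivative) (use True in \<open>auto intro: continuous_on_bump\<close>)
  then show ?thesis using True by (simp add: at_within_Icc_at)
next
  case False
  have "((\<lambda>_. 0) has_real_derivative bump u) (at u)" using False by (auto simp: bump_eq_0)
  then show ?thesis
    by (rule has_field_derivative_transform_within_open[of _ _ _ "{..<1/16}"]) (use False in \<open>auto simp: cutoff_eq_0\<close>)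
qed

lemma smooth_upto_cutoff: "smooth_upto k I cutoff"
proof (cases k)
  case (Suc j)
  show ?thesis unfolding Suc
    by (rule smooth_upto_SucI[OF cutoff_deriv smooth_upto_bump])
qed auto

lemma cutoff_mono: "u \<le> v \<Longrightarrow> cutoff u \<le> cutoff v"
  by (rule DERIV_nonneg_imp_nondecreasing) (auto intro!: exI[of _ "bump _"] cutoff_deriv bump_nonneg)

lemma cutoff_eq_1: "u \<ge> 1 \<Longrightarrow> cutoff u = 1"
proof -
  assume u: "u \<ge> 1"
  have "cutoff 1 = integral {0..1} bump0 / integral {0..1} bump0"
    unfolding cutoff_def bump_def[abs_def] by simp
  then have 1: "cutoff 1 = 1" using bump0_integral_pos by simp
  have "cutoff u \<le> cutoff 1"
    using u by (rule DERIV_nonpos_imp_nonincreasing)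
      (auto intro!: exI[of _ "bump _"] cutoff_deriv simp: bump_eq_0)
  then show ?thesis using 1 cutoff_mono[OF u] by simp
qed

lemma cutoff_nonneg: "cutoff u \<ge> 0"
  by (metis cutoff_eq_0 cutoff_mono linorder_le_cases)

lemma cutoff_le_1: "cutoff u \<le> 1"
  by (metis cutoff_eq_1 cutoff_mono linorder_le_cases)

lemma continuous_on_cutoff: "continuous_on S cutoff"
  using cutoff_deriv by (intro continuous_at_imp_continuous_on) (auto intro: DERIV_isCont)

section \<open>The Green profile and its mollification\<close>

text \<open>Multiplying the equation in \<open>green_deriv_ode\<close> by the power \<open>b\<close>
  of s (4 - s) makes its left side the derivative of the power b + 1 of s (4 - s) times the unknown.
  The solution regular at \<open>s = 4\<close> therefore contains the integral of the power
  \<open>b\<close> of u (4 - u) from \<open>s\<close> to 4. The substitution u = 4 - (4 - s) t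
  extracts the power b + 1 of 4 - s, which cancels, and leaves \<open>Jint b b s\<close>. Two
  separate exponents are kept because differentiation in \<open>s\<close> raises one and lowers the
  other.\<close>

definition Jint :: "real \<Rightarrow> real \<Rightarrow> real \<Rightarrow> real" where
  "Jint a b s = integral {0..1} (\<lambda>t. t powr a * (4 - (4 - s) * t) powr b)"

lemma Jint_base_pos: "0 < s \<Longrightarrow> t \<in> {0..1} \<Longrightarrow> 4 - (4 - s) * t > (0::real)"
proof -
  assume a: "0 < s" "t \<in> {0..1}"
  have "4 - (4 - s) * t = 4 * (1 - t) + s * t" by (simp add: algebra_simps)
  also have "\<dots> > 0" using a by (cases "t = 0") (auto intro!: add_nonneg_pos)
  finally show ?thesis .
qed

lemma continuous_on_Jint_integrand:
  fixes s :: real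
  assumes "a > 0" "0 < s"
  shows "continuous_on {0..1} (\<lambda>t. t powr a * (4 - (4 - s) * t) powr b)"
proof (rule continuous_on_mult; rule continuous_on_powr')
  show "\<forall>t\<in>{0..1}. 0 \<le> 4 - (4 - s) * t \<and> (4 - (4 - s) * t = 0 \<longrightarrow> 0 < b)"
    using Jint_base_pos[OF assms(2)] less_imp_le less_irrefl by metis
qed (use assms in \<open>auto intro!: continuous_intros\<close>)

text \<open>Differentiation under the integral sign. The bound 5 only has to exceed 4, so that
  two-sided derivatives exist at the antipodal value.\<close>

lemma Jint_deriv:
  assumes "a > 0" "s \<in> {0<..<5}"
  shows "(Jint a b has_real_derivative b * Jint (a + 1) (b - 1) s) (at s)"
proof -
  let ?f = "\<lambda>s t. t powr a * (4 - (4 - s) * t) powr b"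
  let ?g = "\<lambda>s t. b * (t powr (a + 1) * (4 - (4 - s) * t) powr (b - 1))"
  have 1: "((\<lambda>s. ?f s t) has_field_derivative ?g x t) (at x within {0<..<5})"
    if "x \<in> {0<..<5}" "t \<in> cbox 0 1" for x t
  proof -
    have p: "4 - (4 - x) * t > 0" using Jint_base_pos[of x t] that by auto
    have q: "t * t powr a = t powr (a + 1)"
      using that by (cases "t = 0") (auto simp: powr_add)
    have "((\<lambda>s. ?f s t) has_field_derivative
        t powr a * (b * (4 - (4 - x) * t) powr (b - 1) * t)) (at x within {0<..<5})"
      using p by (auto intro!: derivative_eq_intros)
    also have "t powr a * (b * (4 - (4 - x) * t) powr (b - 1) * t) = ?g x t"
      unfolding q[symmetric] by (simp add: mult_ac)
    finally show ?thesis .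
  qed
  have 2: "?f x integrable_on cbox 0 1" if "x \<in> {0<..<5}" for x
    unfolding cbox_interval
    by (rule integrable_continuous_real, rule continuous_on_Jint_integrand) (use that assms in auto)
  have pos: "4 - (4 - fst z) * snd z > 0" if "z \<in> {0<..<5::real} \<times> cbox 0 1" for z
    using Jint_base_pos[of "fst z" "snd z"] that by auto
  have c1: "continuous_on ({0<..<5} \<times> cbox 0 1) (\<lambda>z::real \<times> real. snd z powr (a + 1))"
    by (rule continuous_on_powr') (use assms in \<open>auto intro!: continuous_intros\<close>)
  have c2: "continuous_on ({0<..<5} \<times> cbox 0 1) (\<lambda>z. (4 - (4 - fst z) * snd z) powr (b - 1))"
    by (rule continuous_on_powr) (intro continuous_intros, intro continuous_intros, metis pos less_irrefl)
  have 3: "continuous_on ({0<..<5} \<times> cbox 0 1) (\<lambda>(s, t). ?g s t)"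
    unfolding case_prod_beta by (intro continuous_on_mult continuous_on_const c1 c2)
  have "((\<lambda>s. integral (cbox 0 1) (?f s)) has_field_derivative integral (cbox 0 1) (?g s))
      (at s within {0<..<5})"
    by (rule leibniz_rule_field_derivative[OF 1 2 3]) (use assms in auto)
  moreover have "integral (cbox 0 1) (?g s) = b * Jint (a + 1) (b - 1) s"
    unfolding Jint_def cbox_interval by (rule integral_mult_right)
  ultimately show ?thesis
    using assms by (simp add: Jint_def[abs_def] at_within_open[of s "{0<..<5}"])
qed

lemma smooth_upto_Jint: "a > 0 \<Longrightarrow> smooth_upto k {0<..<5} (Jint a b)"
proof (induction k arbitrary: a b)
  case (Suc k)
  have "smooth_upto k {0<..<5} (\<lambda>s. b * Jint (a + 1) (b - 1) s)"
    using Suc by (intro smooth_upto_mult smooth_upto_const) auto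
  then show ?case by (rule smooth_upto_SucI[OF Jint_deriv[OF Suc.prems], rotated])
qed auto

text \<open>This is the integral over \<open>{0..1}\<close> of the derivative of
  \<open>t powr (b + 1) * (4 - (4 - s) * t) powr b\<close>. The boundary value
  \<open>s powr b\<close> at \<open>t = 1\<close> becomes the constant right-hand side of
  \<open>green_deriv_ode\<close>.\<close>

lemma Jint_ode:
  assumes "b > 0" "s \<in> {0<..<5}"
  shows "(4 - s) * (b * Jint (b + 1) (b - 1) s) = (b + 1) * Jint b b s - s powr b"
proof -
  let ?p = "\<lambda>t. 4 - (4 - s) * t"
  let ?h = "\<lambda>t. t powr (b + 1) * ?p t powr b"
  let ?h' = "\<lambda>t. (b + 1) * (t powr b * ?p t powr b) - (4 - s) * b * (t powr (b + 1) * ?p t powr (b - 1))"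
  have pos: "?p t > 0" if "t \<in> {0..1}" for t using Jint_base_pos that assms by auto
  have "(?h' has_integral ?h 1 - ?h 0) {0..1}"
  proof (rule fundamental_theorem_of_calculus_interior)
    show "continuous_on {0..1} ?h" using continuous_on_Jint_integrand[of "b + 1" s b] assms by auto
    fix t :: real assume t: "t \<in> {0<..<1}"
    have "(?h has_real_derivative ?h' t) (at t)"
      using t pos[of t] by (auto intro!: derivative_eq_intros simp: algebra_simps)
    then show "(?h has_vector_derivative ?h' t) (at t)"
      by (simp add: has_real_derivative_iff_has_vector_derivative)
  qed auto
  then have "integral {0..1} ?h' = s powr b" using assms by (simp add: has_integral_iff)
  moreover have "integral {0..1} ?h' = (b + 1) * Jint b b s - (4 - s) * b * Jint (b + 1) (b - 1) s"
    unfolding Jint_def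
    by (subst Henstock_Kurzweil_Integration.integral_diff)
       (use assms in \<open>auto intro!: integrable_continuous_real continuous_on_Jint_integrand continuous_on_mult_left\<close>)
  ultimately show ?thesis by (simp add: algebra_simps)
qed

lemma Jint_upper:
  assumes "b > 0" "s \<in> {0<..4}"
  shows "Jint b b s \<le> 4 powr b"
proof -
  have "Jint b b s \<le> integral {0..1} (\<lambda>t::real. 4 powr b)"
    unfolding Jint_def
  proof (intro integral_le integrable_continuous_real continuous_on_Jint_integrand)
    fix t :: real assume t: "t \<in> {0..1}"
    have "t powr b \<le> 1" using t assms by (simp add: powr_le1)
    moreover have "(4 - (4 - s) * t) powr b \<le> 4 powr b"
      using t assms Jint_base_pos[of s t] by (intro powr_mono2) auto
    ultimately show "t powr b * (4 - (4 - s) * t) powr b \<le> 4 powr b"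
      using mult_mono[of "t powr b" 1 "(4 - (4 - s) * t) powr b" "4 powr b"] by simp
  qed (use assms in auto)
  then show ?thesis by simp
qed

text \<open>For \<open>b > 0\<close> the integrand increases with \<open>s\<close>, so its value at
  \<open>s = 0\<close> gives a bound that stays uniform as \<open>s\<close> tends to 0.\<close>

lemma Jint_lower:
  assumes "b > 0"
  obtains c where "c > 0" "\<And>s. s \<in> {0<..4} \<Longrightarrow> c \<le> Jint b b s"
proof
  let ?h = "\<lambda>t::real. t powr b * (4 - 4 * t) powr b"
  have cont: "continuous_on {0..1} ?h"
    using assms by (intro continuous_intros continuous_on_powr') auto
  have "integral {0..1} ?h \<ge> 0" by (intro integral_nonneg integrable_continuous_real cont) auto
  moreover have "integral {0..1} ?h \<noteq> 0"
  proof
    assume "integral {0..1} ?h = 0"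
    then have "\<forall>t\<in>{0..1}. ?h t = 0" by (subst (asm) integral_eq_0_iff[OF cont]) auto
    then have "?h (1/2) = 0" by (rule bspec) auto
    then show False by auto
  qed
  ultimately show "integral {0..1} ?h > 0" by linarith
  fix s :: real assume s: "s \<in> {0<..4}"
  show "integral {0..1} ?h \<le> Jint b b s"
    unfolding Jint_def
  proof (intro integral_le integrable_continuous_real continuous_on_Jint_integrand cont)
    fix t :: real assume t: "t \<in> {0..1}"
    have "4 - 4 * t \<le> 4 - (4 - s) * t" using s t by (simp add: algebra_simps)
    then have "(4 - 4 * t) powr b \<le> (4 - (4 - s) * t) powr b"
      using t assms by (intro powr_mono2) auto
    then show "?h t \<le> t powr b * (4 - (4 - s) * t) powr b" by (intro mult_left_mono) auto
  qed (use assms s in auto)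
qed

text \<open>As a function of \<open>s = \<parallel>x - y\<parallel>\<^sup>2\<close>, minus the derivative of the Green function of the sphere of
  dimension \<open>2 * b + 2\<close>, up to a factor; the equation \<open>green_deriv_ode\<close> says that its Laplacian is
  constant. The integral \<open>Jint\<close> removes the singularity that the solution of this
  equation seems to have at the antipodal value \<open>s = 4\<close>.\<close>

definition green_deriv :: "real \<Rightarrow> real \<Rightarrow> real" where
  "green_deriv b s = s powr (- (b + 1)) * Jint b b s"

definition green_deriv' :: "real \<Rightarrow> real \<Rightarrow> real" where
  "green_deriv' b s = s powr (- (b + 1)) * (b * Jint (b + 1) (b - 1) s)
     - (b + 1) * s powr (- (b + 1) - 1) * Jint b b s"

lemma green_deriv_has_derivative:
  assumes "b > 0" "s \<in> {0<..<5}"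
  shows "(green_deriv b has_real_derivative green_deriv' b s) (at s)"
proof -
  show ?thesis
    unfolding green_deriv_def[abs_def] green_deriv'_def using assms
    by (auto intro!: derivative_eq_intros Jint_deriv simp: algebra_simps)
qed

lemma green_deriv_ode:
  assumes "b > 0" "s \<in> {0<..<5}"
  shows "s * (4 - s) * green_deriv' b s + (2 * b + 2) * (2 - s) * green_deriv b s = - 1"
proof -
  let ?J = "Jint b b s" and ?J' = "b * Jint (b + 1) (b - 1) s"
  have p: "s * s powr (- (b + 1) - 1) = s powr (- (b + 1))" "s * s powr (- (b + 1)) = s powr (- b)"
    using assms by (auto simp: powr_mult_base algebra_simps)
  have "s * (4 - s) * green_deriv' b s + (2 * b + 2) * (2 - s) * green_deriv b s =
     (s * s powr (- (b + 1))) * ((4 - s) * ?J') - (b + 1) * (4 - s) * (s * s powr (- (b + 1) - 1)) * ?J +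
     (2 * b + 2) * (2 - s) * (s powr (- (b + 1)) * ?J)"
    unfolding green_deriv_def green_deriv'_def by (simp add: algebra_simps)
  also have "\<dots> = s powr (- b) * ((b + 1) * ?J - s powr b) - (b + 1) * (s * s powr (- (b + 1))) * ?J"
    unfolding Jint_ode[OF assms] p(1) p(2)[symmetric] by (simp add: algebra_simps)
  also have "\<dots> = - (s powr (- b) * s powr b)"
    unfolding p(2) by (simp add: algebra_simps)
  finally show ?thesis using assms by (simp add: powr_minus)
qed

lemma Jint_nonneg: "Jint a b s \<ge> 0"
proof (cases "(\<lambda>t. t powr a * (4 - (4 - s) * t) powr b) integrable_on {0..1}")
  case True
  then show ?thesis unfolding Jint_def by (rule integral_nonneg) auto
qed (auto simp: Jint_def not_integrable_integral)

lemma green_deriv_nonneg: "green_deriv b s \<ge> 0"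
  unfolding green_deriv_def using Jint_nonneg by simp

lemma green_deriv_upper:
  assumes "b > 0" "s \<in> {0<..4}"
  shows "green_deriv b s \<le> 4 powr b * s powr (- (b + 1))"
  using mult_left_mono[OF Jint_upper[OF assms], of "s powr (- (b + 1))"]
  by (simp add: green_deriv_def mult.commute)

lemma continuous_on_green_deriv: "b > 0 \<Longrightarrow> S \<subseteq> {0<..<5} \<Longrightarrow> continuous_on S (green_deriv b)"
  by (intro continuous_at_imp_continuous_on ballI)
    (auto intro!: DERIV_isCont[OF green_deriv_has_derivative])

lemma smooth_upto_green_deriv: "b > 0 \<Longrightarrow> smooth_upto k {0<..<5} (green_deriv b)"
  unfolding green_deriv_def[abs_def]
  by (intro smooth_upto_mult smooth_upto_subset[OF smooth_upto_powr] smooth_upto_Jint) auto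

text \<open>The profile F, normalised to vanish at the antipode. The equation determines it only up
  to a constant, which returns later as \<open>m0\<close>. Near \<open>s = 0\<close> it grows like
  \<open>s powr (- b)\<close>.\<close>

definition green_profile :: "real \<Rightarrow> real \<Rightarrow> real" where
  "green_profile b s = integral {s..4} (green_deriv b)"

lemma integral_powr_to_4:
  assumes "b > 0" "0 < s" "s \<le> 4"
  shows "((\<lambda>u::real. u powr (- (b + 1))) has_integral (s powr (- b) - 4 powr (- b)) / b) {s..4}"
proof -
  let ?F = "\<lambda>u::real. - (u powr (- b)) / b"
  have "((\<lambda>u. u powr (- (b + 1))) has_integral ?F 4 - ?F s) {s..4}"
  proof (rule fundamental_theorem_of_calculus[OF assms(3)])
    fix u assume "u \<in> {s..4}"
    then have "(?F has_real_derivative u powr (- (b + 1))) (at u within {s..4})"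
      using assms by (auto intro!: derivative_eq_intros simp: minus_add_distrib[symmetric])
    then show "(?F has_vector_derivative u powr (- (b + 1))) (at u within {s..4})"
      by (simp add: has_real_derivative_iff_has_vector_derivative)
  qed
  then show ?thesis by (simp add: diff_divide_distrib)
qed

lemma green_profile_upper:
  assumes "b > 0" "0 < s" "s \<le> 4"
  shows "green_profile b s \<le> 4 powr b / b * s powr (- b)"
proof -
  have "green_profile b s \<le> integral {s..4} (\<lambda>u. 4 powr b * u powr (- (b + 1)))"
    unfolding green_profile_def using assms green_deriv_upper[OF assms(1)]
    by (intro integral_le integrable_continuous_real continuous_on_green_deriv)
      (auto intro!: continuous_intros)
  also have "\<dots> = 4 powr b * ((s powr (- b) - 4 powr (- b)) / b)"
    using integral_powr_to_4[OF assms] by (subst integral_mult_right) (simp add: integral_unique)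
  also have "\<dots> \<le> 4 powr b * (s powr (- b) / b)"
    using assms by (intro mult_left_mono divide_right_mono) auto
  finally show ?thesis by simp
qed

text \<open>A uniform lower bound for \<open>Jint\<close> is integrated from \<open>s\<close> to 4.
  The subtracted \<open>4 powr (- b)\<close> reflects the normalisation at the antipode and is
  absorbed into the constants wherever the estimate is used.\<close>

lemma green_profile_lower:
  assumes "b > 0"
  obtains c where "c > 0"
    "\<And>s. 0 < s \<Longrightarrow> s \<le> 4 \<Longrightarrow> c * (s powr (- b) - 4 powr (- b)) \<le> green_profile b s"
proof -
  obtain c where c: "c > 0" "\<And>s. s \<in> {0<..4} \<Longrightarrow> c \<le> Jint b b s"
    using Jint_lower[OF assms] by blast
  have "c / b * (s powr (- b) - 4 powr (- b)) \<le> green_profile b s" if s: "0 < s" "s \<le> 4" for s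
  proof -
    have "integral {s..4} (\<lambda>u. c * u powr (- (b + 1))) \<le> green_profile b s"
      unfolding green_profile_def using assms s c(2)
      by (intro integral_le integrable_continuous_real continuous_on_green_deriv)
        (auto intro!: continuous_intros mult_left_mono simp: green_deriv_def mult.commute)
    also have "integral {s..4} (\<lambda>u. c * u powr (- (b + 1))) = c * ((s powr (- b) - 4 powr (- b)) / b)"
      using integral_powr_to_4[OF assms s] by (subst integral_mult_right) (simp add: integral_unique)
    finally show ?thesis by simp
  qed
  with c(1) assms that[of "c / b"] show ?thesis by auto
qed

section \<open>The mollified profile and its source term\<close>

definition moll_deriv :: "real \<Rightarrow> real \<Rightarrow> real \<Rightarrow> real" where
  "moll_deriv b r s = cutoff (s / r\<^sup>2) * green_deriv b s"

definition moll_deriv' :: "real \<Rightarrow> real \<Rightarrow> real \<Rightarrow> real" where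
  "moll_deriv' b r s = cutoff (s / r\<^sup>2) * green_deriv' b s + bump (s / r\<^sup>2) / r\<^sup>2 * green_deriv b s"

text \<open>On \<open>{0..4}\<close> this is the integral of \<open>moll_deriv\<close> from
  \<open>s\<close> to 4. Starting at \<open>- 1/2\<close> and subtracting gives one formula valid on
  an open interval around \<open>{0..4}\<close>, as smoothness at both ends requires.\<close>

definition moll :: "real \<Rightarrow> real \<Rightarrow> real \<Rightarrow> real" where
  "moll b r s = integral {- 1/2..4} (moll_deriv b r) - integral {- 1/2..s} (moll_deriv b r)"

text \<open>The Laplacian of the mollified profile plus 1. Because the derivative is cut off and not
  the profile itself, the cutoff is differentiated only once: the first summand is the only new
  term, and on \<open>{0..4}\<close> it is nonnegative like \<open>bump\<close>. Cutting off the
  profile would bring in second derivatives of the cutoff, which have no sign.\<close>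

definition moll_source :: "real \<Rightarrow> real \<Rightarrow> real \<Rightarrow> real" where
  "moll_source b r s =
     s * (4 - s) * green_deriv b s * (bump (s / r\<^sup>2) / r\<^sup>2) + 1 - cutoff (s / r\<^sup>2)"

lemma moll_deriv_eq_0: "r > 0 \<Longrightarrow> s \<le> r\<^sup>2 / 16 \<Longrightarrow> moll_deriv b r s = 0"
  unfolding moll_deriv_def by (subst cutoff_eq_0) (auto simp: field_simps)

lemma moll_deriv_has_derivative:
  assumes "b > 0" "r > 0" "s < 5"
  shows "(moll_deriv b r has_real_derivative moll_deriv' b r s) (at s)"
proof (cases "s < r\<^sup>2 / 16")
  case True
  then have "s / r\<^sup>2 \<le> 1/16" using assms by (simp add: field_simps)
  then have "((\<lambda>_. 0) has_real_derivative moll_deriv' b r s) (at s)"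
    by (simp add: moll_deriv'_def cutoff_eq_0 bump_eq_0)
  then show ?thesis
    by (rule has_field_derivative_transform_within_open[of _ _ _ "{..<r\<^sup>2 / 16}"])
      (use True assms moll_deriv_eq_0 in auto)
next
  case False
  then have s: "s \<in> {0<..<5}" using assms by (auto intro: less_le_trans[of _ "r\<^sup>2 / 16"])
  have "((\<lambda>s. cutoff (s / r\<^sup>2)) has_real_derivative bump (s / r\<^sup>2) * (1 / r\<^sup>2)) (at s)"
    by (rule DERIV_chain2[OF cutoff_deriv DERIV_cdivide[OF DERIV_ident]])
  then show ?thesis
    unfolding moll_deriv_def[abs_def] moll_deriv'_def
    by (auto intro!: derivative_eq_intros green_deriv_has_derivative[OF assms(1) s])
qed

lemma moll_deriv_ode:
  assumes "b > 0" "r > 0" "s < 5"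
  shows "s * (4 - s) * moll_deriv' b r s + (2 * b + 2) * (2 - s) * moll_deriv b r s
    = moll_source b r s - 1"
proof (cases "s \<le> 0")
  case True
  then have "s / r\<^sup>2 \<le> 0" by (simp add: divide_nonpos_nonneg)
  then have "s / r\<^sup>2 \<le> 1/16" by linarith
  then show ?thesis
    by (simp add: moll_deriv'_def moll_deriv_def moll_source_def cutoff_eq_0 bump_eq_0)
next
  case False
  then have s: "s \<in> {0<..<5}" using assms by auto
  have "s * (4 - s) * moll_deriv' b r s + (2 * b + 2) * (2 - s) * moll_deriv b r s =
    cutoff (s / r\<^sup>2) * (s * (4 - s) * green_deriv' b s + (2 * b + 2) * (2 - s) * green_deriv b s)
    + s * (4 - s) * green_deriv b s * (bump (s / r\<^sup>2) / r\<^sup>2)"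
    unfolding moll_deriv'_def moll_deriv_def by (simp add: algebra_simps diff_divide_distrib)
  then show ?thesis unfolding green_deriv_ode[OF assms(1) s] moll_source_def by simp
qed

lemma smooth_upto_moll_deriv:
  assumes "b > 0" "r > 0"
  shows "smooth_upto k {..<5} (moll_deriv b r)"
proof -
  have "smooth_upto k {..<r\<^sup>2 / 16} (moll_deriv b r)"
    by (rule smooth_upto_cong[OF smooth_upto_const[of _ _ 0]]) (auto simp: moll_deriv_eq_0[OF assms(2)])
  moreover have "smooth_upto k {0<..<5} (\<lambda>s. cutoff (1 / r\<^sup>2 * s + 0) * green_deriv b s)"
    by (intro smooth_upto_mult smooth_upto_green_deriv smooth_upto_comp_affine[OF smooth_upto_cutoff[of _ UNIV]])
      (use assms in auto)
  then have "smooth_upto k {0<..<5} (moll_deriv b r)"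
    by (simp add: moll_deriv_def[abs_def])
  ultimately have "smooth_upto k ({..<r\<^sup>2 / 16} \<union> {0<..<5}) (moll_deriv b r)"
    by (rule smooth_upto_Un) auto
  then show ?thesis
  proof (rule smooth_upto_subset)
    show "{..<5} \<subseteq> {..<r\<^sup>2 / 16} \<union> {0<..<5}"
    proof
      fix x :: real assume "x \<in> {..<5}"
      moreover have "x < r\<^sup>2 / 16" if "x \<le> 0"
      proof -
        have "0 < r\<^sup>2 / 16" using assms by simp
        with that show ?thesis by linarith
      qed
      ultimately show "x \<in> {..<r\<^sup>2 / 16} \<union> {0<..<5}" by force
    qed
  qed
qed

lemma continuous_on_moll_deriv:
  assumes "b > 0" "r > 0" "S \<subseteq> {..<5}"
  shows "continuous_on S (moll_deriv b r)"
  using assms by (intro continuous_at_imp_continuous_on ballI)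
    (auto intro!: DERIV_isCont[OF moll_deriv_has_derivative])

lemma moll_has_derivative:
  assumes "b > 0" "r > 0" "s \<in> {- 1/2<..<9/2}"
  shows "(moll b r has_real_derivative - moll_deriv b r s) (at s)"
proof -
  have "((\<lambda>s. integral {- 1/2..s} (moll_deriv b r)) has_real_derivative moll_deriv b r s)
      (at s within {- 1/2..9/2})"
    by (rule integral_has_real_derivative[OF continuous_on_moll_deriv[OF assms(1,2)]])
      (use assms in auto)
  then have "((\<lambda>s. integral {- 1/2..s} (moll_deriv b r)) has_real_derivative moll_deriv b r s) (at s)"
    using assms(3) by (simp add: at_within_Icc_at)
  then show ?thesis unfolding moll_def[abs_def] by (auto intro!: derivative_eq_intros)
qed

lemma smooth_upto_moll:
  assumes "b > 0" "r > 0"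
  shows "smooth_upto k {- 1/2<..<9/2} (moll b r)"
proof -
  have "smooth_upto k {- 1/2<..<9/2} (\<lambda>s. (- 1) * moll_deriv b r s)"
    by (intro smooth_upto_mult smooth_upto_const smooth_upto_subset[OF smooth_upto_moll_deriv]) (use assms in auto)
  then have "smooth_upto (Suc k) {- 1/2<..<9/2} (moll b r)"
    by (rule smooth_upto_SucI[rotated]) (use moll_has_derivative assms in auto)
  then show ?thesis by (rule smooth_upto_SucD)
qed

lemma moll_eq_integral:
  assumes "b > 0" "r > 0" "s \<in> {0..4}"
  shows "moll b r s = integral {s..4} (moll_deriv b r)"
proof -
  have "integral {- 1/2..s} (moll_deriv b r) + integral {s..4} (moll_deriv b r) =
      integral {- 1/2..4} (moll_deriv b r)"
    by (rule Henstock_Kurzweil_Integration.integral_combine)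
      (use assms in \<open>auto intro!: integrable_continuous_real continuous_on_moll_deriv\<close>)
  then show ?thesis unfolding moll_def by simp
qed

lemma moll_deriv_nonneg: "moll_deriv b r s \<ge> 0"
  unfolding moll_deriv_def by (simp add: cutoff_nonneg green_deriv_nonneg)

lemma moll_deriv_le: "moll_deriv b r s \<le> green_deriv b s"
  unfolding moll_deriv_def using cutoff_le_1 green_deriv_nonneg mult_right_mono[of "cutoff (s / r\<^sup>2)" 1]
  by force

lemma moll_deriv_eq: "r > 0 \<Longrightarrow> s \<ge> r\<^sup>2 \<Longrightarrow> moll_deriv b r s = green_deriv b s"
  unfolding moll_deriv_def by (subst cutoff_eq_1) (auto simp: field_simps)

lemma moll_antimono:
  assumes "b > 0" "r > 0" "0 \<le> s" "s \<le> s'" "s' \<le> 4"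
  shows "moll b r s' \<le> moll b r s"
proof -
  have "integral {s'..4} (moll_deriv b r) \<le> integral {s..4} (moll_deriv b r)"
    by (rule integral_subset_le)
      (use assms in \<open>auto intro!: integrable_continuous_real continuous_on_moll_deriv moll_deriv_nonneg\<close>)
  then show ?thesis using assms by (simp add: moll_eq_integral)
qed

lemma moll_le_moll:
  assumes "b > 0" "0 < r'" "r' \<le> r" "s \<in> {0..4}"
  shows "moll b r s \<le> moll b r' s"
proof -
  have "integral {s..4} (moll_deriv b r) \<le> integral {s..4} (moll_deriv b r')"
  proof (intro integral_le integrable_continuous_real continuous_on_moll_deriv)
    fix u assume "u \<in> {s..4}"
    then have "u / r\<^sup>2 \<le> u / r'\<^sup>2" using assms by (intro divide_left_mono power_mono) auto
    then show "moll_deriv b r u \<le> moll_deriv b r' u"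
      unfolding moll_deriv_def by (intro mult_right_mono cutoff_mono green_deriv_nonneg)
  qed (use assms in auto)
  then show ?thesis using assms by (simp add: moll_eq_integral)
qed

lemma moll_le_green_profile:
  assumes "b > 0" "r > 0" "0 < s" "s \<le> 4"
  shows "moll b r s \<le> green_profile b s"
proof -
  have "integral {s..4} (moll_deriv b r) \<le> integral {s..4} (green_deriv b)"
    by (intro integral_le integrable_continuous_real continuous_on_moll_deriv continuous_on_green_deriv moll_deriv_le)
      (use assms in auto)
  then show ?thesis using assms by (simp add: moll_eq_integral green_profile_def)
qed

lemma moll_eq_green_profile:
  assumes "b > 0" "r > 0" "r\<^sup>2 \<le> s" "s \<le> 4"
  shows "moll b r s = green_profile b s"
proof -
  have "s \<ge> 0" using assms(3) zero_le_power2 order_trans by blast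
  then show ?thesis using assms
    by (subst moll_eq_integral) (auto simp: green_profile_def moll_deriv_eq intro!: integral_cong)
qed

lemma moll_nonneg: "b > 0 \<Longrightarrow> r > 0 \<Longrightarrow> s \<in> {0..4} \<Longrightarrow> moll b r s \<ge> 0"
  by (subst moll_eq_integral)
    (auto intro!: integral_nonneg integrable_continuous_real continuous_on_moll_deriv moll_deriv_nonneg)

text \<open>\<open>moll_deriv\<close> vanishes up to \<open>r\<^sup>2 / 16\<close>, so
  \<open>moll b r\<close> is constant there; being decreasing, it has its maximum at that
  point.\<close>

lemma moll_upper:
  assumes "b > 0" "0 < r" "r \<le> 1" "s \<in> {0..4}"
  shows "moll b r s \<le> green_profile b (r\<^sup>2 / 16)"
proof -
  let ?q = "r\<^sup>2 / 16"
  have q: "0 < ?q" "?q \<le> 4" using assms power_le_one[of r 2] by auto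
  have "integral {0..?q} (moll_deriv b r) + integral {?q..4} (moll_deriv b r) =
      integral {0..4} (moll_deriv b r)"
    by (rule Henstock_Kurzweil_Integration.integral_combine)
      (use assms q in \<open>auto intro!: integrable_continuous_real continuous_on_moll_deriv\<close>)
  moreover have "integral {0..?q} (moll_deriv b r) = integral {0..?q} (\<lambda>_. 0)"
    by (rule integral_cong) (use assms moll_deriv_eq_0 in auto)
  ultimately have "moll b r 0 = moll b r ?q" using assms q by (simp add: moll_eq_integral)
  moreover have "moll b r s \<le> moll b r 0" using assms by (intro moll_antimono) auto
  ultimately show ?thesis using moll_le_green_profile[OF assms(1,2) q] by simp
qed

lemma moll_0_lower:
  assumes "b > 0" "0 < r" "r \<le> 1"
  shows "green_profile b (r\<^sup>2) \<le> moll b r 0"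
proof -
  have "r\<^sup>2 \<le> 4" using assms power_le_one[of r 2] by auto
  then show ?thesis
    using moll_antimono[OF assms(1,2), of 0 "r\<^sup>2"] moll_eq_green_profile[OF assms(1,2), of "r\<^sup>2"] by simp
qed

lemma moll_source_nonneg: "s \<in> {0..4} \<Longrightarrow> moll_source b r s \<ge> 0"
proof -
  assume "s \<in> {0..4}"
  then have "0 \<le> s * (4 - s) * green_deriv b s * (bump (s / r\<^sup>2) / r\<^sup>2)"
    by (intro mult_nonneg_nonneg divide_nonneg_nonneg bump_nonneg green_deriv_nonneg) auto
  then show ?thesis
    unfolding moll_source_def using cutoff_le_1[of "s / r\<^sup>2"] by linarith
qed

lemma moll_source_eq_0: "r > 0 \<Longrightarrow> s \<ge> r\<^sup>2 \<Longrightarrow> moll_source b r s = 0"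
  unfolding moll_source_def by (simp add: bump_eq_0 cutoff_eq_1)

text \<open>The defining formula contains \<open>green_deriv\<close>, which is singular at 0.
  Through the differential equation the source is instead a combination, with polynomial
  coefficients, of \<open>moll_deriv\<close> and its derivative, both continuous.\<close>

lemma continuous_on_moll_source:
  assumes "b > 0" "r > 0" "S \<subseteq> {..<5}"
  shows "continuous_on S (moll_source b r)"
proof -
  obtain g where g0: "\<forall>s\<in>{..<5}. (moll_deriv b r has_real_derivative g s) (at s)"
      "smooth_upto (Suc 0) {..<5} g"
    using smooth_upto_moll_deriv[OF assms(1,2), of "Suc (Suc 0)"] unfolding smooth_upto.simps(2)[of "Suc 0"] by blast
  have g: "(moll_deriv b r has_real_derivative g s) (at s)" "isCont g s" if "s < 5" for s
    using g0 smooth_upto_isCont[OF g0(2)] that by auto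
  have "g s = moll_deriv' b r s" if "s < 5" for s
    using g(1)[OF that] moll_deriv_has_derivative[OF assms(1,2) that] by (rule DERIV_unique)
  then have "moll_source b r s = s * (4 - s) * g s + (2 * b + 2) * (2 - s) * moll_deriv b r s + 1"
    if "s < 5" for s
    using moll_deriv_ode[OF assms(1,2) that] that by simp
  then have "continuous_on S (moll_source b r) \<longleftrightarrow>
    continuous_on S (\<lambda>s. s * (4 - s) * g s + (2 * b + 2) * (2 - s) * moll_deriv b r s + 1)"
    using assms(3) by (intro continuous_on_cong) auto
  also have "\<dots>"
    using assms by (intro continuous_intros continuous_on_moll_deriv)
      (auto intro!: continuous_at_imp_continuous_on g)
  finally show ?thesis .
qed

text \<open>Where the bump is active, \<open>s \<ge> r\<^sup>2 / 16\<close>, so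
  \<open>s * green_deriv b s\<close> is at most a multiple of r to the power -2b; the factor
  \<open>1 / r\<^sup>2\<close> completes the exponent. In dimension d it is -d, as suits a bump of
  fixed mass at scale r.\<close>

lemma moll_source_upper:
  assumes "b > 0"
  obtains K where "K > 0"
    "\<And>r s. 0 < r \<Longrightarrow> r \<le> 1 \<Longrightarrow> s \<in> {0..4} \<Longrightarrow> moll_source b r s \<le> K * r powr (- (2 * b + 2))"
proof -
  obtain B where B: "B > 0" "\<And>u. bump u \<le> B" using bump_bounded by blast
  \<comment> \<open>The factors bound in turn \<open>4 - s\<close>, the constant of
    \<open>green_deriv_upper\<close>, the loss from \<open>s \<ge> r\<^sup>2 / 16\<close>, and the
    bump; the added 1 pays for \<open>1 - cutoff\<close>.\<close>
  define K where "K = 4 * 4 powr b * 16 powr b * B + 1"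
  have "moll_source b r s \<le> K * r powr (- (2 * b + 2))" if r: "0 < r" "r \<le> 1" and s: "s \<in> {0..4}" for r s
  proof -
    have e: "r powr (- (2 * b + 2)) = (r\<^sup>2) powr (- b) / r\<^sup>2"
    proof -
      have "r powr (- (2 * b + 2)) = r powr (2 * - b) * r powr (- 2)"
        unfolding powr_add[symmetric] by simp
      also have "r powr (2 * - b) = (r\<^sup>2) powr (- b)"
        using powr_powr[of r 2 "- b"] r by simp
      also have "r powr (- 2) = 1 / r\<^sup>2" using r by (simp add: powr_minus divide_inverse)
      finally show ?thesis by simp
    qed
    have 1: "1 \<le> r powr (- (2 * b + 2))"
      using r assms powr_mono2'[of "- (2 * b + 2)" r 1] by auto
    have "s * (4 - s) * green_deriv b s * (bump (s / r\<^sup>2) / r\<^sup>2)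
        \<le> 4 * 4 powr b * 16 powr b * B * r powr (- (2 * b + 2))"
    proof (cases "s / r\<^sup>2 \<le> 1/16")
      case True
      then show ?thesis using B(1) by (subst bump_eq_0) auto
    next
      case False
      then have lo: "r\<^sup>2 / 16 \<le> s" using r by (simp add: field_simps)
      have "s > 0" using lo r by (auto intro: less_le_trans[of _ "r\<^sup>2 / 16"])
      then have s': "s \<in> {0<..4}" using s by auto
      have "s * green_deriv b s \<le> s * (4 powr b * s powr (- (b + 1)))"
        using s' green_deriv_upper[OF assms s'] by (intro mult_left_mono) auto
      also have "\<dots> = 4 powr b * s powr (- b)"
        using s' by (simp add: powr_mult_base mult.left_commute)
      also have "\<dots> \<le> 4 powr b * (r\<^sup>2 / 16) powr (- b)"
        using lo r assms by (intro mult_left_mono powr_mono2') auto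
      also have "(r\<^sup>2 / 16) powr (- b) = 16 powr b * (r\<^sup>2) powr (- b)"
        using r by (simp add: powr_divide powr_minus field_simps)
      finally have a: "s * green_deriv b s \<le> 4 powr b * (16 powr b * (r\<^sup>2) powr (- b))" .
      have "s * (4 - s) * green_deriv b s * (bump (s / r\<^sup>2) / r\<^sup>2) =
          (4 - s) * (s * green_deriv b s) * bump (s / r\<^sup>2) / r\<^sup>2" by simp
      also have "\<dots> \<le> 4 * (4 powr b * (16 powr b * (r\<^sup>2) powr (- b))) * B / r\<^sup>2"
        using s' B bump_nonneg green_deriv_nonneg
        by (intro divide_right_mono mult_mono[OF mult_mono[OF _ a]]) auto
      also have "\<dots> = 4 * 4 powr b * 16 powr b * B * r powr (- (2 * b + 2))" unfolding e by simp
      finally show ?thesis .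
    qed
    then show ?thesis
      unfolding moll_source_def K_def using 1 cutoff_nonneg[of "s / r\<^sup>2"] by (simp add: algebra_simps)
  qed
  moreover have "K > 0" using B by (auto simp: K_def intro!: add_pos_pos)
  ultimately show ?thesis using that by blast
qed

section \<open>Integration over the sphere\<close>

lemma sets_sphere_vol [measurable_cong]:
  "sets (sphere_vol :: 'a::euclidean_space measure) = sets (restrict_space borel (sphere 0 1))"
  by (simp add: sphere_vol_def)

lemma emeasure_ball_neq_0: "emeasure lborel (ball (0::'a::euclidean_space) 1) \<noteq> 0"
  using content_ball_pos[of 1 "0::'a"] by (auto simp: measure_def)

lemma finite_measure_sphere_vol: "finite_measure (sphere_vol :: 'a::euclidean_space measure)"
proof
  have "emeasure lborel (ball (0::'a) 1) < \<infinity>" by (rule emeasure_lborel_ball_finite)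
  then show "emeasure (sphere_vol :: 'a measure) (space sphere_vol) \<noteq> \<infinity>"
    unfolding space_sphere_vol emeasure_sphere_vol_sphere
    by (auto simp: ennreal_mult_eq_top_iff)
qed

lemma borel_measurable_sphere_vol:
  fixes g :: "'a::euclidean_space \<Rightarrow> 'b::topological_space"
  shows "continuous_on (sphere 0 1) g \<Longrightarrow> g \<in> borel_measurable sphere_vol"
  using borel_measurable_continuous_on_restrict[of "sphere 0 1" g]
  by (simp add: measurable_cong_sets[OF sets_sphere_vol refl])

lemma integrable_sphere_vol:
  fixes g :: "'a::euclidean_space \<Rightarrow> real"
  assumes "continuous_on (sphere 0 1) g"
  shows "integrable sphere_vol g"
proof -
  have "bounded (g ` sphere 0 1)"
    by (intro compact_imp_bounded compact_continuous_image assms) auto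
  then obtain B where "\<forall>x\<in>sphere 0 1. norm (g x) \<le> B"
    by (auto simp: bounded_iff)
  then show ?thesis
    by (intro finite_measure.integrable_const_bound[OF finite_measure_sphere_vol, of _ B]
        borel_measurable_sphere_vol assms AE_I2) (auto simp: space_sphere_vol)
qed

lemma measure_sphere_vol_pos: "measure sphere_vol (sphere (0::'a::euclidean_space) 1) > 0"
proof -
  interpret finite_measure "sphere_vol :: 'a measure" by (rule finite_measure_sphere_vol)
  have "emeasure sphere_vol (sphere (0::'a) 1) > 0"
    unfolding emeasure_sphere_vol_sphere using emeasure_ball_neq_0
    by (auto simp: ennreal_zero_less_mult_iff zero_less_iff_neq_zero)
  then show ?thesis by (simp add: emeasure_eq_measure)
qed

text \<open>The cone over a single point lies on a line, a null set in dimension at least 2.\<close>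

lemma AE_sphere_vol_neq:
  fixes x :: "'a::euclidean_space"
  assumes "DIM('a) \<ge> 2" "x \<in> sphere 0 1"
  shows "AE y in sphere_vol. y \<noteq> x"
proof -
  let ?C = "{z \<in> ball 0 1 - {0}. z /\<^sub>R norm z \<in> {x}}"
  have "?C \<subseteq> span {x}"
  proof
    fix z assume z: "z \<in> ?C"
    then have "z = norm z *\<^sub>R x" by auto
    then show "z \<in> span {x}" by (metis insertI1 span_base span_scale)
  qed
  moreover have "dim (span {x}) < DIM('a)"
    using assms dim_le_card'[of "{x}"] by simp
  ultimately have "negligible ?C" using negligible_lowdim negligible_subset by blast
  moreover have meas: "?C \<in> sets borel"
  proof -
    have "?C = {z \<in> space borel. norm z < 1 \<and> z \<noteq> 0 \<and> z /\<^sub>R norm z = x}" by auto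
    also have "\<dots> \<in> sets borel" by measurable
    finally show ?thesis .
  qed
  ultimately have "emeasure lborel ?C = 0"
    unfolding negligible_iff_null_sets null_sets_completion_iff[OF _] by (simp add: null_sets_def)
  then have "emeasure sphere_vol {x} = 0"
    using assms by (subst emeasure_sphere_vol) (auto simp del: singleton_iff)
  moreover have "{x} \<in> sets sphere_vol"
    using assms by (auto simp: sets_sphere_vol sets_restrict_space_iff)
  ultimately show ?thesis
    by (intro AE_I[of _ _ "{x}"]) auto
qed

text \<open>\<open>sphere_vol\<close> is a scaled image of Lebesgue measure on the punctured ball.
  This turns integrals over the sphere into integrals of functions homogeneous of degree 0 over the
  ball, where the integration by parts takes place.\<close>

lemma integral_sphere_vol:
  fixes g :: "'a::euclidean_space \<Rightarrow> real"
  assumes "continuous_on (sphere 0 1) g"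
  shows "(\<integral>y. g y \<partial>sphere_vol) =
    DIM('a) * (\<integral>v. indicator (ball 0 1 - {0}) v * g (v /\<^sub>R norm v) \<partial>lborel)"
proof -
  let ?R = "restrict_space lborel (ball 0 1 - {0::'a})"
  let ?D = "distr ?R (restrict_space borel (sphere 0 1)) (\<lambda>x. x /\<^sub>R norm x)"
  have "(\<lambda>x::'a. x /\<^sub>R norm x) \<in> borel_measurable borel" by measurable
  then have "(\<lambda>x::'a. x /\<^sub>R norm x) \<in> borel_measurable ?R"
    by (metis measurable_lborel2 measurable_restrict_space1)
  then have m: "(\<lambda>x::'a. x /\<^sub>R norm x) \<in> measurable ?R (restrict_space borel (sphere 0 1))"
    by (intro measurable_restrict_space2) (auto simp: space_restrict_space)
  have g: "g \<in> borel_measurable (restrict_space borel (sphere 0 1))"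
    using assms by (rule borel_measurable_continuous_on_restrict)
  have "sphere_vol = density ?D (\<lambda>_. ennreal (real DIM('a)))"
    unfolding sphere_vol_def
  proof (rule measure_eqI)
    fix A assume "A \<in> sets (scale_measure (of_nat DIM('a)) ?D)"
    then have "A \<in> sets ?D" by (simp only: sets_scale_measure)
    then show "emeasure (scale_measure (of_nat DIM('a)) ?D) A
        = emeasure (density ?D (\<lambda>_. ennreal (real DIM('a)))) A"
      by (simp only: emeasure_density_const emeasure_scale_measure ennreal_of_nat_eq_real_of_nat)
  qed (simp only: sets_scale_measure sets_density)
  then have "(\<integral>y. g y \<partial>sphere_vol) = (\<integral>y. real DIM('a) *\<^sub>R g y \<partial>?D)"
    by (subst integral_density[symmetric]) (use g in \<open>auto simp: measurable_distr_eq1\<close>)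
  also have "\<dots> = real DIM('a) * (\<integral>v. g (v /\<^sub>R norm v) \<partial>?R)"
    using integral_distr[OF m g] by simp
  also have "(\<integral>v. g (v /\<^sub>R norm v) \<partial>?R) =
      (\<integral>v. indicator (ball 0 1 - {0}) v *\<^sub>R g (v /\<^sub>R norm v) \<partial>lborel)"
    by (rule integral_restrict_space) simp
  finally show ?thesis by simp
qed

section \<open>Zonal functions\<close>

lemma Ck_on_cong:
  assumes "open U" "\<And>x. x \<in> U \<Longrightarrow> f x = g x" "Ck_on k f U"
  shows "Ck_on k g U"
  using assms(2,3)
proof (induction k arbitrary: f g)
  case 0
  then show ?case using continuous_on_cong[of U U f g] by simp
next
  case (Suc k)
  have d: "(g has_derivative frechet_derivative f (at x)) (at x)" if "x \<in> U" for x
  proof (rule has_derivative_transform_within_open[of f _ x UNIV U g])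
    show "(f has_derivative frechet_derivative f (at x)) (at x)"
      by (rule frechet_derivative_works[THEN iffD1]) (use Suc.prems(2) that in auto)
  qed (use Suc.prems(1) that assms(1) in auto)
  have e: "frechet_derivative f (at x) v = frechet_derivative g (at x) v" if "x \<in> U" for x v
    by (rule fun_cong[OF frechet_derivative_at[OF d[OF that]]])
  have "Ck_on k (\<lambda>x. frechet_derivative g (at x) v) U" for v
    by (rule Suc.IH[OF e]) (use Suc.prems(2) in simp_all)
  moreover have "\<forall>x\<in>U. g differentiable (at x)" using d by (blast intro: differentiableI)
  ultimately show ?case unfolding Ck_on.simps by blast
qed

text \<open>Differentiating in direction \<open>v\<close> only brings out the constant
  \<open>x \<bullet> v\<close>, so with a free factor \<open>c\<close> the induction closes. One
  level of \<open>smooth_upto\<close> is spent on the continuity of the last derivative.\<close>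

lemma Ck_on_zonal:
  fixes x :: "'a::euclidean_space"
  assumes "smooth_upto (Suc k) I h" "open I"
  shows "Ck_on k (\<lambda>y. c * h (x \<bullet> y)) {y. x \<bullet> y \<in> I}"
  using assms(1)
proof (induction k arbitrary: h c)
  case 0
  then show ?case
    by (auto intro!: continuous_intros continuous_at_imp_continuous_on
        isCont_o2[of _ "\<lambda>y. x \<bullet> y" h] dest: DERIV_isCont)
next
  case (Suc k)
  have op: "open {y. x \<bullet> y \<in> I}"
    using open_vimage[OF assms(2) continuous_on_inner[OF continuous_on_const continuous_on_id], of x]
    by (simp add: vimage_def)
  obtain g where g: "\<And>t. t \<in> I \<Longrightarrow> (h has_real_derivative g t) (at t)" "smooth_upto (Suc k) I g"
    using Suc.prems unfolding smooth_upto.simps(2)[of "Suc k"] by blast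
  have d: "((\<lambda>y. c * h (x \<bullet> y)) has_derivative (\<lambda>v. (c * (x \<bullet> v)) * g (x \<bullet> y))) (at y)"
    if "x \<bullet> y \<in> I" for y
  proof -
    have "((\<lambda>y. h (x \<bullet> y)) has_derivative (\<lambda>v. g (x \<bullet> y) * (x \<bullet> v))) (at y)"
      by (rule has_derivative_compose[of "\<lambda>y. x \<bullet> y" "\<lambda>v. x \<bullet> v" y UNIV h "(*) (g (x \<bullet> y))"])
        (use g(1)[OF that] in \<open>auto simp: has_field_derivative_def intro!: derivative_intros\<close>)
    from has_derivative_mult_right[OF this, of c] show ?thesis by (simp add: mult_ac)
  qed
  have "Ck_on k (\<lambda>y. frechet_derivative (\<lambda>y. c * h (x \<bullet> y)) (at y) v) {y. x \<bullet> y \<in> I}" for v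
  proof (rule Ck_on_cong[OF op _ Suc.IH[OF g(2), of "c * (x \<bullet> v)"]])
    fix y assume "y \<in> {y. x \<bullet> y \<in> I}"
    then show "c * (x \<bullet> v) * g (x \<bullet> y) = frechet_derivative (\<lambda>y. c * h (x \<bullet> y)) (at y) v"
      by (subst frechet_derivative_at[OF d, symmetric]) auto
  qed
  then show ?case using d by (auto simp: differentiable_def)
qed

lemma abs_inner_sphere_le:
  fixes x y :: "'a::real_inner"
  shows "x \<in> sphere 0 1 \<Longrightarrow> y \<in> sphere 0 1 \<Longrightarrow> \<bar>x \<bullet> y\<bar> \<le> 1"
  using Cauchy_Schwarz_ineq2[of x y] by simp

lemma smooth_on_zonal:
  fixes x :: "'a::euclidean_space"
  assumes "x \<in> sphere 0 1" "open I" "{-1..1} \<subseteq> I" "\<And>k. smooth_upto k I h"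
  shows "smooth_on (sphere 0 1) (\<lambda>y. h (x \<bullet> y))"
  unfolding smooth_on_def
proof
  fix y :: 'a assume y: "y \<in> sphere 0 1"
  have "open {y. x \<bullet> y \<in> I}"
    using open_vimage[OF assms(2) continuous_on_inner[OF continuous_on_const continuous_on_id], of x]
    by (simp add: vimage_def)
  moreover have "x \<bullet> y \<in> I" using abs_inner_sphere_le[OF assms(1) y] assms(3) by (auto simp: abs_le_iff)
  moreover have "Ck_on k (\<lambda>y. h (x \<bullet> y)) {y. x \<bullet> y \<in> I}" for k
    using Ck_on_zonal[OF assms(4) assms(2), of k 1 x] by simp
  ultimately show "\<exists>U F. open U \<and> y \<in> U \<and> (\<forall>k. Ck_on k F U) \<and> (\<forall>y\<in>sphere 0 1 \<inter> U. F y = h (x \<bullet> y))"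
    by blast
qed

lemma has_derivative_inner_sgn:
  fixes x z :: "'a::euclidean_space"
  assumes "z \<noteq> 0"
  shows "((\<lambda>z. x \<bullet> z / norm z) has_derivative
    (\<lambda>k. (x - (x \<bullet> z / norm z) *\<^sub>R (z /\<^sub>R norm z)) \<bullet> k / norm z)) (at z)"
  using assms
  by (auto intro!: derivative_eq_intros ext has_derivative_norm
      simp: field_simps inner_diff_left inner_diff_right sgn_div_norm inner_commute power2_eq_square)

lemma inner_sgn_le: "norm x = 1 \<Longrightarrow> z \<noteq> 0 \<Longrightarrow> x \<bullet> z / norm z \<in> {-1..(1::real)}"
  using Cauchy_Schwarz_ineq2[of x z] by (auto simp: field_simps abs_le_iff)

lemma has_derivative_zonal_radial:
  fixes x z :: "'a::euclidean_space"
  assumes "norm x = 1" "z \<noteq> 0"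
    and "\<And>t. t \<in> {-1..1} \<Longrightarrow> (h has_real_derivative h' t) (at t)"
  shows "((\<lambda>z. h (x \<bullet> z / norm z)) has_derivative
    (\<lambda>k. h' (x \<bullet> z / norm z) * ((x - (x \<bullet> z / norm z) *\<^sub>R (z /\<^sub>R norm z)) \<bullet> k / norm z))) (at z)"
  using has_derivative_compose[OF has_derivative_inner_sgn[OF assms(2)],
      of h "(*) (h' (x \<bullet> z / norm z))"] assms(3)[OF inner_sgn_le[OF assms(1,2)]]
  by (simp add: has_field_derivative_def)

lemma sphere_grad_zonal:
  fixes x z :: "'a::euclidean_space"
  assumes "norm x = 1" "norm y = 1"
    and "\<And>t. t \<in> {-1..1} \<Longrightarrow> (h has_real_derivative h' t) (at t)"
  shows "sphere_grad (\<lambda>y. h (x \<bullet> y)) y = h' (x \<bullet> y) *\<^sub>R (x - (x \<bullet> y) *\<^sub>R y)"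
proof -
  have "((radial_ext (\<lambda>y. h (x \<bullet> y))) has_derivative
      (\<lambda>k. (h' (x \<bullet> y) *\<^sub>R (x - (x \<bullet> y) *\<^sub>R y)) \<bullet> k)) (at y)"
    using has_derivative_zonal_radial[OF assms(1) _ assms(3), where z=y] assms(2)
    by (force simp: radial_ext_def[abs_def] divide_inverse mult.commute)
  from frechet_derivative_at[OF this, symmetric] show ?thesis
    unfolding sphere_grad_def by (simp only: euclidean_representation)
qed

text \<open>With t = x . y the gradient is \<open>h' t\<close> times P = x - t y. The trace of its
  derivative uses three facts: P has squared norm 1 - t^2, P is orthogonal to y, and the projection
  \<open>k - (y \<bullet> k) *\<^sub>R y\<close> has trace \<open>DIM('a) - 1\<close>.\<close>

lemma laplace_beltrami_zonal:
  fixes x y :: "'a::euclidean_space"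
  assumes "norm x = 1" "norm y = 1"
    and h: "\<And>t. t \<in> {-1..1} \<Longrightarrow> (h has_real_derivative h' t) (at t)"
    and h': "\<And>t. t \<in> {-1..1} \<Longrightarrow> (h' has_real_derivative h'' t) (at t)"
  shows "laplace_beltrami (\<lambda>y. h (x \<bullet> y)) y =
    real (DIM('a) - 1) * (x \<bullet> y) * h' (x \<bullet> y) - (1 - (x \<bullet> y)\<^sup>2) * h'' (x \<bullet> y)"
proof -
  let ?t = "\<lambda>z. x \<bullet> z / norm z"
  let ?X = "\<lambda>z. h' (?t z) *\<^sub>R (x - ?t z *\<^sub>R (z /\<^sub>R norm z))"
  define t where "t = x \<bullet> y"
  have y0: "y \<noteq> 0" using assms(2) by auto
  have rad: "radial_ext (sphere_grad (\<lambda>y. h (x \<bullet> y))) z = ?X z" if "z \<noteq> 0" for z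
    unfolding radial_ext_def using sphere_grad_zonal[OF assms(1) _ h, of "z /\<^sub>R norm z"] that
    by (simp add: divide_inverse mult.commute)
  let ?D = "\<lambda>k. (h'' t * ((x - t *\<^sub>R y) \<bullet> k)) *\<^sub>R (x - t *\<^sub>R y)
      - h' t *\<^sub>R (((x - t *\<^sub>R y) \<bullet> k) *\<^sub>R y + t *\<^sub>R (k - (y \<bullet> k) *\<^sub>R y))"
  have d1: "((\<lambda>z. h' (?t z)) has_derivative (\<lambda>k. h'' t * ((x - t *\<^sub>R y) \<bullet> k))) (at y)"
    using has_derivative_zonal_radial[OF assms(1) y0 h'] assms(2) by (simp add: t_def)
  have d2: "(?t has_derivative (\<lambda>k. (x - t *\<^sub>R y) \<bullet> k)) (at y)"
    using has_derivative_inner_sgn[OF y0, of x] assms(2) by (simp add: t_def)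
  have d3: "((\<lambda>z. z /\<^sub>R norm z) has_derivative (\<lambda>k. k - (y \<bullet> k) *\<^sub>R y)) (at y)"
    using y0 assms(2)
    by (auto intro!: derivative_eq_intros ext has_derivative_norm simp: sgn_div_norm inner_commute)
  have "(?X has_derivative ?D) (at y)"
    by (rule has_derivative_eq_rhs, rule has_derivative_scaleR[OF d1],
        rule has_derivative_diff[OF has_derivative_const], rule has_derivative_scaleR[OF d2 d3])
      (use assms(2) in \<open>simp add: t_def algebra_simps\<close>)
  then have "(radial_ext (sphere_grad (\<lambda>y. h (x \<bullet> y))) has_derivative ?D) (at y)"
    by (rule has_derivative_transform_within_open[of _ _ _ _ "- {0}"]) (use y0 rad in auto)
  from frechet_derivative_at[OF this, symmetric]
  have "sphere_div (sphere_grad (\<lambda>y. h (x \<bullet> y))) y = (\<Sum>b\<in>Basis. ?D b \<bullet> b)"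
    unfolding sphere_div_def by simp
  also have "\<dots> = h'' t * (\<Sum>b\<in>Basis. ((x - t *\<^sub>R y) \<bullet> b) * ((x - t *\<^sub>R y) \<bullet> b))
     - h' t * ((\<Sum>b\<in>Basis. ((x - t *\<^sub>R y) \<bullet> b) * (y \<bullet> b)) +
        t * ((\<Sum>b\<in>(Basis::'a set). b \<bullet> b) - (\<Sum>b\<in>Basis. (y \<bullet> b) * (y \<bullet> b))))"
    by (simp add: inner_diff_left inner_add_left sum_subtractf sum.distrib sum_distrib_left[symmetric] mult_ac)
  also have "\<dots> = h'' t * ((x - t *\<^sub>R y) \<bullet> (x - t *\<^sub>R y))
     - h' t * (((x - t *\<^sub>R y) \<bullet> y) + t * (real DIM('a) - y \<bullet> y))"
    unfolding euclidean_inner[symmetric] by simp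
  also have "(x - t *\<^sub>R y) \<bullet> (x - t *\<^sub>R y) = 1 - t\<^sup>2"
    using assms(1,2) by (simp add: inner_diff_left inner_diff_right t_def inner_commute
        norm_eq_1 power2_eq_square)
  also have "(x - t *\<^sub>R y) \<bullet> y = 0"
    using assms(2) by (simp add: inner_diff_left t_def norm_eq_1)
  also have "y \<bullet> y = 1" using assms(2) by (simp add: norm_eq_1)
  finally show ?thesis unfolding laplace_beltrami_def t_def
    using DIM_positive[where 'a='a] by (simp add: of_nat_diff algebra_simps Suc_leI)
qed

section \<open>Integration by parts on the sphere\<close>

lemma integral_lborel_translate:
  fixes h :: "'a::euclidean_space \<Rightarrow> real"
  assumes "h \<in> borel_measurable borel"
  shows "(\<integral>v. h (v + c) \<partial>lborel) = (\<integral>v. h v \<partial>lborel)"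
proof -
  have "(\<integral>v. h v \<partial>lborel) = (\<integral>v. h v \<partial>distr lborel borel ((+) c))"
    by (simp only: lborel_distr_plus)
  also have "\<dots> = (\<integral>v. h (c + v) \<partial>lborel)"
    by (rule integral_distr) (use assms in auto)
  finally show ?thesis by (simp only: add.commute)
qed

lemma integrable_lborel_compact_support:
  fixes h :: "'a::euclidean_space \<Rightarrow> real"
  assumes "continuous_on UNIV h" "\<And>v. norm v \<ge> R \<Longrightarrow> h v = 0"
  shows "integrable lborel h"
proof -
  have "integrable lborel (\<lambda>v. indicator (cball 0 R) v *\<^sub>R h v)"
    by (rule borel_integrable_compact) (auto intro: continuous_on_subset[OF assms(1)])
  also have "(\<lambda>v. indicator (cball 0 R) v *\<^sub>R h v) = h"
    using assms(2) by (auto simp: fun_eq_iff indicator_def)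
  finally show ?thesis .
qed

text \<open>Translation invariance makes the integral of every difference quotient vanish.\<close>

lemma integral_directional_derivative_eq_0:
  fixes h D :: "'a::euclidean_space \<Rightarrow> real"
  assumes D: "\<And>v. ((\<lambda>t. h (v + t *\<^sub>R b)) has_real_derivative D v) (at 0)"
    and cont: "continuous_on UNIV h" and b: "norm b = 1"
    and bound: "\<And>v. \<bar>D v\<bar> \<le> C" and supp: "\<And>v. norm v \<ge> 1 \<Longrightarrow> h v = 0"
  shows "integrable lborel D" "(\<integral>v. D v \<partial>lborel) = 0"
proof -
  define q where "q k v = (h (v + inverse (real (Suc k)) *\<^sub>R b) - h v) * real (Suc k)" for k v
  have meas: "h \<in> borel_measurable borel" using cont by (rule borel_measurable_continuous_onI)
  have lim_q: "(\<lambda>k. q k v) \<longlonglongrightarrow> D v" for v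
  proof -
    have "((\<lambda>t. (h (v + t *\<^sub>R b) - h v) / t) \<longlongrightarrow> D v) (at 0)"
      using D[of v] by (simp add: has_field_derivative_iff)
    moreover have "filterlim (\<lambda>k. inverse (real (Suc k))) (at 0) sequentially"
      unfolding filterlim_at using LIMSEQ_inverse_real_of_nat by auto
    ultimately have "(\<lambda>k. (h (v + inverse (real (Suc k)) *\<^sub>R b) - h v) / inverse (real (Suc k))) \<longlonglongrightarrow> D v"
      by (rule filterlim_compose)
    then show ?thesis by (simp add: q_def field_simps)
  qed
  \<comment> \<open>The mean value theorem on the segment bounds each quotient by \<open>C\<close>.
    Since \<open>h\<close> vanishes outside the unit ball and the shifts have length at most 1, all
    quotients vanish outside the ball of radius 2, which gives an integrable majorant.\<close>
  have bound_q: "norm (q k v) \<le> C * indicator (cball 0 2) v" for k v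
  proof (cases "norm v \<le> 2")
    case True
    let ?s = "inverse (real (Suc k))"
    have d: "((\<lambda>t. h (v + t *\<^sub>R b)) has_real_derivative D (v + t *\<^sub>R b)) (at t)" for t
    proof -
      have "((\<lambda>u. h (v + t *\<^sub>R b + (u - t) *\<^sub>R b)) has_real_derivative D (v + t *\<^sub>R b) * 1) (at t)"
        by (rule DERIV_chain2[of "\<lambda>u. h (v + t *\<^sub>R b + u *\<^sub>R b)" _ "\<lambda>u. u - t"])
          (use D[of "v + t *\<^sub>R b"] in \<open>auto intro!: derivative_eq_intros\<close>)
      then show ?thesis by (simp add: scaleR_diff_left)
    qed
    obtain t where "h (v + ?s *\<^sub>R b) - h (v + 0 *\<^sub>R b) = (?s - 0) * D (v + t *\<^sub>R b)"
      using MVT2[of 0 ?s "\<lambda>t. h (v + t *\<^sub>R b)" "\<lambda>t. D (v + t *\<^sub>R b)"] d by auto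
    then have "q k v = D (v + t *\<^sub>R b)" by (simp add: q_def field_simps)
    then show ?thesis using bound True by simp
  next
    case False
    have "norm (v + inverse (real (Suc k)) *\<^sub>R b) \<ge> norm v - norm (inverse (real (Suc k)) *\<^sub>R b)"
      by (rule norm_diff_ineq)
    moreover have "norm (inverse (real (Suc k)) *\<^sub>R b) \<le> 1" using b by (simp add: field_simps)
    ultimately have "norm (v + inverse (real (Suc k)) *\<^sub>R b) \<ge> 1" using False by linarith
    then show ?thesis using False supp by (simp add: q_def)
  qed
  have qm: "q k \<in> borel_measurable lborel" for k
    using meas by (simp add: q_def[abs_def])
  have Dm: "D \<in> borel_measurable lborel"
    by (rule borel_measurable_LIMSEQ_real[OF lim_q qm])
  have w: "integrable lborel (\<lambda>v::'a. C * indicator (cball 0 2) v)"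
    by (intro integrable_mult_right integrable_real_indicator) (use emeasure_lborel_cball_finite[of "0::'a" 2] in \<open>auto simp: infinity_ennreal_def\<close>)
  note dom = Dm qm w AE_I2[OF lim_q] AE_I2[OF bound_q]
  have lim: "(\<lambda>k. \<integral>v. q k v \<partial>lborel) \<longlonglongrightarrow> (\<integral>v. D v \<partial>lborel)"
    by (rule integral_dominated_convergence[OF dom])
  have int: "integrable lborel D"
    by (rule integrable_dominated_convergence[OF dom])
  have "(\<integral>v. q k v \<partial>lborel) = 0" for k
  proof -
    let ?c = "inverse (real (Suc k)) *\<^sub>R b"
    have i: "integrable lborel h"
      by (rule integrable_lborel_compact_support[OF cont supp])
    have "norm (v + ?c) \<ge> 1" if "norm v \<ge> 2" for v
    proof -
      have "norm (v + ?c) \<ge> norm v - norm ?c" by (rule norm_diff_ineq)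
      moreover have "norm ?c \<le> 1" using b by (simp add: field_simps)
      ultimately show ?thesis using that by linarith
    qed
    then have "integrable lborel (\<lambda>v. h (v + ?c))"
      by (intro integrable_lborel_compact_support[of _ 2] continuous_on_compose2[OF cont])
        (auto intro!: continuous_intros supp)
    then show ?thesis using i integral_lborel_translate[OF meas, of ?c]
      by (simp add: q_def)
  qed
  with lim show "(\<integral>v. D v \<partial>lborel) = 0" by (simp add: LIMSEQ_const_iff)
  show "integrable lborel D" by (rule int)
qed

lemma bounded_compact_support:
  fixes h :: "'a::euclidean_space \<Rightarrow> real"
  assumes "continuous_on UNIV h" "\<And>v. norm v \<ge> 1 \<Longrightarrow> h v = 0"
  obtains C where "C \<ge> 0" "\<And>v. \<bar>h v\<bar> \<le> C"
proof -
  have "bounded (h ` cball 0 1)"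
    by (intro compact_imp_bounded compact_continuous_image continuous_on_subset[OF assms(1)]) auto
  then obtain C where C: "\<forall>v\<in>cball 0 1. \<bar>h v\<bar> \<le> C" by (auto simp: bounded_iff)
  have "\<bar>h v\<bar> \<le> max C 0" for v
    using C assms(2)[of v] by (cases "norm v \<le> 1") (auto simp: le_max_iff_disj)
  then show ?thesis using that[of "max C 0"] by auto
qed

text \<open>The field \<open>T v = \<parallel>v\<parallel>\<^sup>2 z - (z \<bullet> v) v\<close> is tangential to all spheres around the origin.\<close>

lemma integral_divergence_tangential:
  fixes s :: "'a::euclidean_space \<Rightarrow> real" and gs :: "'a \<Rightarrow> 'a" and z :: 'a
  defines "T \<equiv> \<lambda>v. (v \<bullet> v) *\<^sub>R z - (z \<bullet> v) *\<^sub>R v"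
  assumes s: "\<And>v. (s has_derivative (\<lambda>k. gs v \<bullet> k)) (at v)"
    and cont: "continuous_on UNIV gs"
    and supp: "\<And>v. norm v \<ge> 1 \<Longrightarrow> s v = 0" "\<And>v. norm v \<ge> 1 \<Longrightarrow> gs v = 0"
  shows "(\<integral>v. gs v \<bullet> T v - real (DIM('a) - 1) * (z \<bullet> v) * s v \<partial>lborel) = 0"
proof -
  have conts: "continuous_on UNIV s"
    by (intro continuous_at_imp_continuous_on ballI has_derivative_continuous[OF s])
  \<comment> \<open>\<open>D b\<close> is the derivative in direction \<open>b\<close> of the
    \<open>b\<close>-component of the field s T. The sum over the basis is its divergence, and the
    divergence of \<open>T\<close> alone is
    \<open>- real (DIM('a) - 1) * (z \<bullet> v)\<close>.\<close>
  define D where "D b v = (gs v \<bullet> b) * (T v \<bullet> b)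
      + s v * (2 * (v \<bullet> b) * (z \<bullet> b) - ((z \<bullet> b) * (v \<bullet> b) + (z \<bullet> v) * (b \<bullet> b)))" for b v
  have contT: "continuous_on UNIV T" unfolding T_def by (intro continuous_intros)
  have contD: "continuous_on UNIV (D b)" for b
    unfolding D_def using cont conts contT by (intro continuous_intros)
  have D0: "D b v = 0" if "norm v \<ge> 1" for b v using supp that by (simp add: D_def)
  have step: "integrable lborel (D b)" "(\<integral>v. D b v \<partial>lborel) = 0" if b: "b \<in> Basis" for b
  proof -
    obtain C where C: "\<And>v. \<bar>D b v\<bar> \<le> C" using bounded_compact_support[OF contD D0] by metis
    have "((\<lambda>t. s (v + t *\<^sub>R b) * (T (v + t *\<^sub>R b) \<bullet> b)) has_real_derivative D b v) (at 0)" for v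
    proof -
      have "((\<lambda>t. s (v + t *\<^sub>R b)) has_derivative (\<lambda>t. gs v \<bullet> (t *\<^sub>R b))) (at 0)"
        by (rule has_derivative_compose[of "\<lambda>t. v + t *\<^sub>R b" "\<lambda>t. t *\<^sub>R b" 0 UNIV s])
          (use s[of v] in \<open>auto intro!: derivative_eq_intros\<close>)
      then have 1: "((\<lambda>t. s (v + t *\<^sub>R b)) has_real_derivative (gs v \<bullet> b)) (at 0)"
        by (simp add: has_field_derivative_def mult_commute_abs)
      have 2: "((\<lambda>t. T (v + t *\<^sub>R b) \<bullet> b) has_real_derivative
          2 * (v \<bullet> b) * (z \<bullet> b) - ((z \<bullet> b) * (v \<bullet> b) + (z \<bullet> v) * (b \<bullet> b))) (at 0)"
      proof -
        have e: "T (v + t *\<^sub>R b) \<bullet> b = (v \<bullet> v + 2 * (v \<bullet> b) * t + (b \<bullet> b) * t * t) * (z \<bullet> b)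
            - ((z \<bullet> v) + (z \<bullet> b) * t) * ((v \<bullet> b) + (b \<bullet> b) * t)" for t
          unfolding T_def
          by (simp add: inner_add_left inner_add_right inner_diff_left inner_commute[of b v] algebra_simps)
        show ?thesis
          unfolding e by (auto intro!: derivative_eq_intros simp: algebra_simps)
      qed
      show ?thesis unfolding D_def
        using DERIV_mult[OF 1 2] by (simp add: algebra_simps)
    qed
    moreover have "continuous_on UNIV (\<lambda>v. s v * (T v \<bullet> b))"
      using conts contT by (intro continuous_intros)
    ultimately show "integrable lborel (D b)" "(\<integral>v. D b v \<partial>lborel) = 0"
      using integral_directional_derivative_eq_0[of "\<lambda>v. s v * (T v \<bullet> b)" b "D b" C] b C supp
      by auto
  qed
  have "(\<Sum>b\<in>Basis. D b v) = gs v \<bullet> T v - real (DIM('a) - 1) * (z \<bullet> v) * s v" for v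
  proof -
    have "(\<Sum>b\<in>Basis. D b v) = (\<Sum>b\<in>Basis. (gs v \<bullet> b) * (T v \<bullet> b))
      + s v * ((\<Sum>b\<in>Basis. (z \<bullet> b) * (v \<bullet> b)) - (z \<bullet> v) * (\<Sum>b\<in>(Basis::'a set). b \<bullet> b))"
      unfolding D_def by (simp add: sum.distrib sum_subtractf sum_distrib_left algebra_simps)
    also have "\<dots> = gs v \<bullet> T v + s v * ((z \<bullet> v) - (z \<bullet> v) * real DIM('a))"
      unfolding euclidean_inner[symmetric] by simp
    finally show ?thesis
      using DIM_positive[where 'a='a] by (simp add: of_nat_diff algebra_simps Suc_leI)
  qed
  then have "(\<integral>v. gs v \<bullet> T v - real (DIM('a) - 1) * (z \<bullet> v) * s v \<partial>lborel)
      = (\<integral>v. (\<Sum>b\<in>Basis. D b v) \<partial>lborel)" by simp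
  also have "\<dots> = (\<Sum>b\<in>Basis. \<integral>v. D b v \<partial>lborel)"
    by (rule Bochner_Integration.integral_sum) (use step in auto)
  finally show ?thesis using step by simp
qed

text \<open>Cuts off near the origin, where functions homogeneous of degree \<open>0\<close> are singular, and near
  the unit sphere, so that no boundary terms arise.\<close>

definition shell :: "nat \<Rightarrow> real \<Rightarrow> real" where
  "shell k u = cutoff (real k * u) * cutoff (real k * (1 - u))"

lemma shell_eq_0: "real k * u \<le> 1/16 \<or> u \<ge> 1 \<Longrightarrow> shell k u = 0"
proof (elim disjE)
  assume "u \<ge> 1"
  then have "real k * (1 - u) \<le> 0" by (simp add: mult_nonneg_nonpos)
  then have "real k * (1 - u) \<le> 1/16" by linarith
  then show ?thesis by (simp add: shell_def cutoff_eq_0)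
qed (simp add: shell_def cutoff_eq_0)

lemma shell_bounds: "0 \<le> shell k u" "shell k u \<le> 1"
  using cutoff_nonneg cutoff_le_1 by (auto simp: shell_def intro: mult_le_one)

lemma shell_tendsto:
  assumes "0 < u" "u < 1"
  shows "(\<lambda>k. shell k u) \<longlonglongrightarrow> 1"
proof (rule tendsto_eventually)
  have l: "eventually (\<lambda>k. real k * c \<ge> 1) sequentially" if "c > 0" for c
  proof -
    obtain m where m: "1 / c \<le> real m" using real_arch_simple by blast
    have "real k * c \<ge> 1" if "k \<ge> m" for k
    proof -
      have "1 / c \<le> real k" using m that by linarith
      then show ?thesis using \<open>c > 0\<close> by (simp add: field_simps)
    qed
    then show ?thesis by (auto simp: eventually_sequentially)
  qed
  show "eventually (\<lambda>k. shell k u = 1) sequentially"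
    using eventually_conj[OF l[of u] l[of "1 - u"]] assms
    by (auto simp: shell_def cutoff_eq_1 elim!: eventually_mono)
qed

text \<open>The tangential field T is homogeneous of degree 2. A factor 1 / \<open>norm v\<close>,
  written as the power -1/2 of \<open>v \<bullet> v\<close>, lowers the degree to 1, so that apart
  from the shell the divergence has degree 0 and depends only on
  \<open>v /\<^sub>R norm v\<close>.\<close>

definition shell_wt :: "nat \<Rightarrow> real \<Rightarrow> real" where
  "shell_wt k u = shell k u * u powr (- 1/2)"

definition shell_wt' :: "nat \<Rightarrow> real \<Rightarrow> real" where
  "shell_wt' k u = (real k * bump (real k * u) * cutoff (real k * (1 - u))
     - real k * cutoff (real k * u) * bump (real k * (1 - u))) * u powr (- 1/2)
     - shell k u * u powr (- 3/2) / 2"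

lemma shell_wt_deriv:
  assumes "u > 0"
  shows "(shell_wt k has_real_derivative shell_wt' k u) (at u)"
proof -
  have a: "((\<lambda>u. cutoff (real k * u)) has_real_derivative bump (real k * u) * real k) (at u)"
    by (rule DERIV_chain2[OF cutoff_deriv]) (auto intro!: derivative_eq_intros)
  have b: "((\<lambda>u. cutoff (real k * (1 - u))) has_real_derivative bump (real k * (1 - u)) * - real k) (at u)"
    by (rule DERIV_chain2[OF cutoff_deriv]) (auto intro!: derivative_eq_intros)
  have c: "((\<lambda>u. u powr (- 1/2)) has_real_derivative - (u powr (- 3/2) / 2)) (at u)"
    using assms by (auto intro!: derivative_eq_intros)
  show ?thesis
    unfolding shell_wt_def[abs_def] shell_def shell_wt'_def
    using DERIV_mult[OF DERIV_mult[OF a b] c] by (simp add: algebra_simps)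
qed

lemma continuous_on_shell_wt': "S \<subseteq> {0<..} \<Longrightarrow> continuous_on S (shell_wt' k)"
  unfolding shell_wt'_def shell_def
  by (intro continuous_intros continuous_on_compose2[OF continuous_on_cutoff[of UNIV]]
      continuous_on_compose2[OF continuous_on_bump[of UNIV]]) auto

lemma shell_wt_eq_0: "real k * u \<le> 1/16 \<or> u \<ge> 1 \<Longrightarrow> shell_wt k u = 0"
  by (simp add: shell_wt_def shell_eq_0)

lemma shell_wt'_eq_0:
  assumes "real k * u \<le> 1/16 \<or> u \<ge> 1"
  shows "shell_wt' k u = 0"
  using assms
proof
  assume "real k * u \<le> 1/16"
  then show ?thesis by (simp add: shell_wt'_def shell_eq_0 cutoff_eq_0 bump_eq_0)
next
  assume u: "u \<ge> 1"
  then have "real k * (1 - u) \<le> 0" by (simp add: mult_nonneg_nonpos)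
  then have "real k * (1 - u) \<le> 1/16" by linarith
  then show ?thesis using u by (simp add: shell_wt'_def shell_eq_0 cutoff_eq_0 bump_eq_0)
qed

text \<open>The divergence theorem is applied to \<open>s v\<close> times the tangential field
  \<open>T v\<close>, where \<open>s\<close> is a product of two zonal functions and a weight in
  \<open>v \<bullet> v\<close>. As \<open>T\<close> has no radial part, only the zonal factors and
  the divergence of \<open>T\<close> contribute. Measurability is recorded for the later limit in
  \<open>k\<close>.\<close>

lemma integral_zonal_by_parts_shell:
  fixes x z :: "'a::euclidean_space"
  assumes x: "norm x = 1" and z: "norm z = 1"
    and A: "\<And>t. t \<in> {-1..1} \<Longrightarrow> (A has_real_derivative A' t) (at t)"
    and B: "\<And>t. t \<in> {-1..1} \<Longrightarrow> (B has_real_derivative B' t) (at t)"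
    and cA': "continuous_on {-1..1} A'" and cB': "continuous_on {-1..1} B'"
  defines "g \<equiv> \<lambda>w. A' (x \<bullet> w) * B (z \<bullet> w) * (x \<bullet> z - (x \<bullet> w) * (z \<bullet> w))
      + A (x \<bullet> w) * ((1 - (z \<bullet> w)\<^sup>2) * B' (z \<bullet> w) - real (DIM('a) - 1) * (z \<bullet> w) * B (z \<bullet> w))"
  shows "(\<integral>v. shell k (v \<bullet> v) * g (v /\<^sub>R norm v) \<partial>lborel) = 0"
    and "(\<lambda>v. shell k (v \<bullet> v) * g (v /\<^sub>R norm v)) \<in> borel_measurable borel"
proof -
  define t where "t v = x \<bullet> v / norm v" for v
  define u where "u v = z \<bullet> v / norm v" for v
  define s where "s v = shell_wt k (v \<bullet> v) * (A (t v) * B (u v))" for v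
  define P where "P y v = y - (y \<bullet> v / norm v) *\<^sub>R (v /\<^sub>R norm v)" for y v :: 'a
  define gs where "gs v = (2 * shell_wt' k (v \<bullet> v) * (A (t v) * B (u v))) *\<^sub>R v
    + (shell_wt k (v \<bullet> v) * (A' (t v) * B (u v) / norm v)) *\<^sub>R P x v
    + (shell_wt k (v \<bullet> v) * (A (t v) * B' (u v) / norm v)) *\<^sub>R P z v" for v
  define T where "T v = (v \<bullet> v) *\<^sub>R z - (z \<bullet> v) *\<^sub>R v" for v
  \<comment> \<open>On this neighbourhood of the origin the shell vanishes, which carries
    \<open>s\<close> and \<open>gs\<close> across the point where homogeneous functions of degree 0
    are singular.\<close>
  let ?U = "{v::'a. real k * (v \<bullet> v) < 1/16}"
  have opU: "open ?U" by (intro open_Collect_less continuous_intros)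
  have U: "s v = 0" "gs v = 0" if "v \<in> ?U" for v
    using that shell_wt_eq_0[of k "v \<bullet> v"] shell_wt'_eq_0[of k "v \<bullet> v"]
    by (simp_all add: s_def gs_def)
  have cov: "- {0} \<union> ?U = (UNIV :: 'a set)" by auto
  have t_in: "t v \<in> {-1..1}" and u_in: "u v \<in> {-1..1}" if "v \<noteq> 0" for v
    unfolding t_def u_def using inner_sgn_le[OF x that] inner_sgn_le[OF z that] by blast+
  have "(s has_derivative (\<lambda>h. gs v \<bullet> h)) (at v)" for v
  proof (cases "v = 0")
    case True
    have "((\<lambda>_. 0) has_derivative (\<lambda>h. gs v \<bullet> h)) (at v)"
      using U(2)[of v] True by simp
    then show ?thesis
      by (rule has_derivative_transform_within_open[OF _ opU]) (use True U in auto)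
  next
    case v: False
    have d0: "((\<lambda>v. v \<bullet> v) has_derivative (\<lambda>h. 2 * (v \<bullet> h))) (at v)"
      by (auto intro!: derivative_eq_intros simp: inner_commute)
    have d1: "((\<lambda>v. shell_wt k (v \<bullet> v)) has_derivative (\<lambda>h. shell_wt' k (v \<bullet> v) * (2 * (v \<bullet> h)))) (at v)"
      by (rule has_derivative_compose[OF d0, of "shell_wt k" "(*) (shell_wt' k (v \<bullet> v))"])
        (use shell_wt_deriv[of "v \<bullet> v" k] v in \<open>simp add: has_field_derivative_def\<close>)
    have d2: "((\<lambda>v. A (t v)) has_derivative (\<lambda>h. A' (t v) * (P x v \<bullet> h / norm v))) (at v)"
      unfolding t_def P_def by (rule has_derivative_zonal_radial[OF x v A])
    have d3: "((\<lambda>v. B (u v)) has_derivative (\<lambda>h. B' (u v) * (P z v \<bullet> h / norm v))) (at v)"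
      unfolding u_def P_def by (rule has_derivative_zonal_radial[OF z v B])
    show ?thesis
      unfolding s_def[abs_def]
      by (rule has_derivative_eq_rhs[OF has_derivative_mult[OF d1 has_derivative_mult[OF d2 d3]]])
        (simp add: fun_eq_iff gs_def inner_add_left algebra_simps)
  qed
  moreover have "continuous_on UNIV gs"
  proof -
    have ct: "continuous_on (- {0}) t" "continuous_on (- {0}) u"
      unfolding t_def u_def by (intro continuous_intros; simp)+
    have cA: "continuous_on {-1..1} A" and cB: "continuous_on {-1..1} B"
      by (intro continuous_at_imp_continuous_on ballI DERIV_isCont[OF A] DERIV_isCont[OF B]; assumption)+
    have c1: "continuous_on (- {0}) (\<lambda>v. A (t v))" "continuous_on (- {0}) (\<lambda>v. A' (t v))"
      by (rule continuous_on_compose2[OF cA ct(1)] continuous_on_compose2[OF cA' ct(1)]; use t_in in force)+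
    have c2: "continuous_on (- {0}) (\<lambda>v. B (u v))" "continuous_on (- {0}) (\<lambda>v. B' (u v))"
      by (rule continuous_on_compose2[OF cB ct(2)] continuous_on_compose2[OF cB' ct(2)]; use u_in in force)+
    have "continuous_on {0<..} (shell_wt k)"
      by (intro continuous_at_imp_continuous_on ballI DERIV_isCont[OF shell_wt_deriv]) auto
    then have c3: "continuous_on (- {0}) (\<lambda>v::'a. shell_wt k (v \<bullet> v))"
      by (rule continuous_on_compose2) (auto intro!: continuous_intros)
    have c4: "continuous_on (- {0}) (\<lambda>v::'a. shell_wt' k (v \<bullet> v))"
      by (rule continuous_on_compose2[OF continuous_on_shell_wt'[OF subset_refl]])
        (auto intro!: continuous_intros)
    have c5: "continuous_on (- {0}) (P y)" for y
      unfolding P_def by (intro continuous_intros) auto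
    have "continuous_on (- {0}) gs"
      unfolding gs_def by (intro continuous_intros c1 c2 c3 c4 c5) auto
    moreover have "continuous_on ?U gs"
      using U(2) continuous_on_cong[of ?U ?U gs "\<lambda>_. 0"] by simp
    ultimately have "continuous_on (- {0} \<union> ?U) gs"
      using opU by (intro continuous_on_open_Un) auto
    then show ?thesis unfolding cov .
  qed
  moreover have "s v = 0" "gs v = 0" if "norm v \<ge> 1" for v
  proof -
    have "v \<bullet> v \<ge> 1" using that by (simp add: dot_square_norm)
    then show "s v = 0" "gs v = 0"
      using shell_wt_eq_0[of k "v \<bullet> v"] shell_wt'_eq_0[of k "v \<bullet> v"] by (simp_all add: s_def gs_def)
  qed
  ultimately have zero: "(\<integral>v. gs v \<bullet> T v - real (DIM('a) - 1) * (z \<bullet> v) * s v \<partial>lborel) = 0"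
    and sc: "continuous_on UNIV s" and gsc: "continuous_on UNIV gs"
    using integral_divergence_tangential[of s gs z]
    by (auto simp: T_def intro!: continuous_at_imp_continuous_on intro: has_derivative_continuous)
  have eq: "gs v \<bullet> T v - real (DIM('a) - 1) * (z \<bullet> v) * s v = shell k (v \<bullet> v) * g (v /\<^sub>R norm v)" for v
  proof (cases "v = 0")
    case True
    then show ?thesis by (simp add: T_def s_def shell_eq_0)
  next
    case False
    define r where "r = norm v"
    have r: "r > 0" "v \<bullet> v = r\<^sup>2" using False by (simp_all add: r_def dot_square_norm)
    have xv: "x \<bullet> v = r * t v" "z \<bullet> v = r * u v" using r by (simp_all add: t_def u_def r_def)
    \<comment> \<open>The radial summand of \<open>gs\<close> is orthogonal to \<open>T v\<close>,
      so the derivative of the shell drops out and the shell itself factors out of the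
      divergence.\<close>
    have tan: "v \<bullet> T v = 0" by (simp add: T_def inner_diff_right inner_commute)
    have xT: "P x v \<bullet> T v = r\<^sup>2 * (x \<bullet> z - t v * u v)"
      unfolding P_def inner_diff_left inner_scaleR_left tan
      by (simp add: T_def inner_diff_right r xv algebra_simps power2_eq_square)
    have zT: "P z v \<bullet> T v = r\<^sup>2 * (1 - (u v)\<^sup>2)"
      unfolding P_def inner_diff_left inner_scaleR_left tan
      using z by (simp add: T_def inner_diff_right r xv algebra_simps power2_eq_square norm_eq_1)
    have wt: "shell_wt k (v \<bullet> v) = shell k (v \<bullet> v) / r"
    proof -
      have "(r\<^sup>2) powr (- 1/2) = 1 / r"
      proof -
        have "(r\<^sup>2) powr (- 1/2) = (r powr 2) powr (- 1/2)" using r by simp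
        also have "\<dots> = r powr (- 1)" by (subst powr_powr) simp
        also have "\<dots> = 1 / r" using r by (simp add: powr_minus divide_inverse)
        finally show ?thesis .
      qed
      then show ?thesis by (simp add: shell_wt_def r)
    qed
    have g: "g (v /\<^sub>R norm v) = A' (t v) * B (u v) * (x \<bullet> z - t v * u v)
      + A (t v) * ((1 - (u v)\<^sup>2) * B' (u v) - real (DIM('a) - 1) * u v * B (u v))"
      unfolding g_def t_def u_def by (simp add: divide_inverse mult.commute)
    show ?thesis
      unfolding g gs_def s_def inner_add_left inner_scaleR_left tan xT zT wt xv(2)
      unfolding r_def[symmetric] using r(1) by (simp add: field_simps power2_eq_square)
  qed
  show "(\<integral>v. shell k (v \<bullet> v) * g (v /\<^sub>R norm v) \<partial>lborel) = 0"
    using zero unfolding eq .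
  have "continuous_on UNIV (\<lambda>v. gs v \<bullet> T v - real (DIM('a) - 1) * (z \<bullet> v) * s v)"
    unfolding T_def using gsc sc by (intro continuous_intros)
  then show "(\<lambda>v. shell k (v \<bullet> v) * g (v /\<^sub>R norm v)) \<in> borel_measurable borel"
    unfolding eq by (rule borel_measurable_continuous_onI)
qed

text \<open>The integrand is the divergence on the sphere of
  \<open>A (x \<bullet> w) * B (z \<bullet> w)\<close> times the tangential part of
  \<open>z\<close>. As \<open>k\<close> grows the shell tends to 1 on the punctured ball, and the
  integrand is bounded, so dominated convergence removes the shell.\<close>

lemma integral_zonal_by_parts:
  fixes x z :: "'a::euclidean_space"
  assumes x: "norm x = 1" and z: "norm z = 1"
    and A: "\<And>t. t \<in> {-1..1} \<Longrightarrow> (A has_real_derivative A' t) (at t)"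
    and B: "\<And>t. t \<in> {-1..1} \<Longrightarrow> (B has_real_derivative B' t) (at t)"
    and cA': "continuous_on {-1..1} A'" and cB': "continuous_on {-1..1} B'"
  shows "(\<integral>w. A' (x \<bullet> w) * B (z \<bullet> w) * (x \<bullet> z - (x \<bullet> w) * (z \<bullet> w))
      + A (x \<bullet> w) * ((1 - (z \<bullet> w)\<^sup>2) * B' (z \<bullet> w) - real (DIM('a) - 1) * (z \<bullet> w) * B (z \<bullet> w))
      \<partial>sphere_vol) = 0" (is "(\<integral>w. ?g w \<partial>sphere_vol) = 0")
proof -
  have ct: "continuous_on (sphere 0 1) (\<lambda>w. y \<bullet> w)" for y :: 'a by (intro continuous_intros)
  have x_in: "x \<bullet> w \<in> {-1..1}" "z \<bullet> w \<in> {-1..1}" if "w \<in> sphere 0 1" for w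
    using abs_inner_sphere_le[of x w] abs_inner_sphere_le[of z w] x z that by (auto simp: abs_le_iff)
  have cA: "continuous_on {-1..1} A" and cB: "continuous_on {-1..1} B"
    by (intro continuous_at_imp_continuous_on ballI DERIV_isCont[OF A] DERIV_isCont[OF B]; assumption)+
  have c: "continuous_on (sphere 0 1) (\<lambda>w. A (x \<bullet> w))" "continuous_on (sphere 0 1) (\<lambda>w. A' (x \<bullet> w))"
    "continuous_on (sphere 0 1) (\<lambda>w. B (z \<bullet> w))" "continuous_on (sphere 0 1) (\<lambda>w. B' (z \<bullet> w))"
    by (rule continuous_on_compose2[OF cA ct] continuous_on_compose2[OF cA' ct]
      continuous_on_compose2[OF cB ct] continuous_on_compose2[OF cB' ct]; use x_in in force)+
  have cg: "continuous_on (sphere 0 1) ?g" by (intro continuous_intros c)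
  have "bounded (?g ` sphere 0 1)"
    by (intro compact_imp_bounded compact_continuous_image cg) auto
  then obtain M where M: "\<forall>w\<in>sphere 0 1. \<bar>?g w\<bar> \<le> M" by (auto simp: bounded_iff)
  define f where "f k v = shell k (v \<bullet> v) * ?g (v /\<^sub>R norm v)" for k v
  have lim: "(\<lambda>k. f k v) \<longlonglongrightarrow> indicator (ball 0 1 - {0}) v * ?g (v /\<^sub>R norm v)" for v
  proof (cases "v \<in> ball 0 1 - {0}")
    case True
    then have "0 < v \<bullet> v" "v \<bullet> v < 1" by (auto simp: dot_square_norm power_less_one_iff)
    then have "(\<lambda>k. f k v) \<longlonglongrightarrow> 1 * ?g (v /\<^sub>R norm v)"
      unfolding f_def by (intro tendsto_mult tendsto_const shell_tendsto)
    then show ?thesis using True by simp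
  next
    case False
    then have "shell k (v \<bullet> v) = 0" for k
      by (intro shell_eq_0) (auto simp: dot_square_norm)
    then show ?thesis using False by (simp add: f_def)
  qed
  have bnd: "norm (f k v) \<le> M * indicator (ball 0 1) v" for k v
  proof (cases "v \<in> ball 0 1 - {0}")
    case True
    then have "v /\<^sub>R norm v \<in> sphere 0 1" by simp
    then have "\<bar>?g (v /\<^sub>R norm v)\<bar> \<le> M" using M by blast
    then have "\<bar>shell k (v \<bullet> v)\<bar> * \<bar>?g (v /\<^sub>R norm v)\<bar> \<le> 1 * M"
      using shell_bounds[of k "v \<bullet> v"] by (intro mult_mono) auto
    then show ?thesis using True by (simp add: f_def abs_mult)
  next
    case False
    then have "shell k (v \<bullet> v) = 0"
      by (intro shell_eq_0) (auto simp: dot_square_norm)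
    moreover have "M \<ge> 0" using M x by (force intro: order_trans[OF abs_ge_zero])
    ultimately show ?thesis by (simp add: f_def)
  qed
  have fm: "f k \<in> borel_measurable lborel" for k
    using integral_zonal_by_parts_shell(2)[OF x z A B cA' cB', of k] by (simp add: f_def[abs_def])
  have lm: "(\<lambda>v. indicator (ball 0 1 - {0}) v * ?g (v /\<^sub>R norm v)) \<in> borel_measurable lborel"
    by (rule borel_measurable_LIMSEQ_real[OF lim fm])
  have w: "integrable lborel (\<lambda>v::'a. M * indicator (ball 0 1) v)"
    by (intro integrable_mult_right integrable_real_indicator)
      (use emeasure_lborel_ball_finite[of "0::'a" 1] in \<open>auto simp: infinity_ennreal_def\<close>)
  have "(\<lambda>k. \<integral>v. f k v \<partial>lborel) \<longlonglongrightarrow> (\<integral>v. indicator (ball 0 1 - {0}) v * ?g (v /\<^sub>R norm v) \<partial>lborel)"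
    by (rule integral_dominated_convergence[OF lm fm w AE_I2[OF lim] AE_I2[OF bnd]])
  moreover have "(\<integral>v. f k v \<partial>lborel) = 0" for k
    unfolding f_def by (rule integral_zonal_by_parts_shell(1)[OF x z A B cA' cB'])
  ultimately have "(\<integral>v. indicator (ball 0 1 - {0}) v * ?g (v /\<^sub>R norm v) \<partial>lborel) = 0"
    by (simp add: LIMSEQ_const_iff)
  then show ?thesis by (subst integral_sphere_vol[OF cg]) simp
qed

section \<open>The mollified Green function\<close>

locale sphere_green =
  fixes G :: "'a::euclidean_space \<Rightarrow> 'a \<Rightarrow> ereal" and d :: nat
  assumes d: "d \<ge> 3" and dim: "DIM('a) = d + 1" and green: "is_green_function G"
begin

text \<open>Half the exponent d - 2 of the singularity, since the profile is a function of the
  squared distance.\<close>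

definition b :: real where "b = real d / 2 - 1"

definition sq :: "'a \<Rightarrow> 'a \<Rightarrow> real" where "sq x y = 2 - 2 * (x \<bullet> y)"

abbreviation Phi :: "real \<Rightarrow> 'a \<Rightarrow> 'a \<Rightarrow> real" where "Phi r x w \<equiv> moll b r (sq x w)"

abbreviation Psi :: "real \<Rightarrow> 'a \<Rightarrow> 'a \<Rightarrow> real" where "Psi r x w \<equiv> moll_source b r (sq x w)"

abbreviation Gam :: "'a \<Rightarrow> 'a \<Rightarrow> real" where "Gam x y \<equiv> green_profile b (sq x y)"

abbreviation S :: "'a set" where "S \<equiv> sphere 0 1"

abbreviation \<sigma> :: "'a measure" where "\<sigma> \<equiv> sphere_vol"

definition V :: real where "V = measure \<sigma> S"

definition mean_Phi :: "real \<Rightarrow> 'a \<Rightarrow> real" where "mean_Phi r x = (\<integral>w. Phi r x w \<partial>\<sigma>) / V"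

definition g :: "'a \<Rightarrow> 'a \<Rightarrow> real" where "g x y = real_of_ereal (G x y)"

lemma b_pos: "b > 0" using d by (simp add: b_def)

lemma d_eq: "2 * b + 2 = real d" by (simp add: b_def)

lemma V_pos: "V > 0" unfolding V_def by (rule measure_sphere_vol_pos)

lemma integral_const: "(\<integral>w. c \<partial>\<sigma>) = V * c"
  by (simp add: V_def space_sphere_vol)

lemma norm_S: "x \<in> S \<Longrightarrow> norm x = 1" by simp

lemma inner_S: "x \<in> S \<Longrightarrow> x \<bullet> x = 1" by (simp add: norm_eq_1)

lemma inner_in: "x \<in> S \<Longrightarrow> y \<in> S \<Longrightarrow> x \<bullet> y \<in> {-1..1}"
  using abs_inner_sphere_le[of x y] by (auto simp: abs_le_iff)

lemma sq_in: "x \<in> S \<Longrightarrow> y \<in> S \<Longrightarrow> sq x y \<in> {0..4}"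
  using inner_in[of x y] by (simp add: sq_def)

lemma sq_norm: "x \<in> S \<Longrightarrow> y \<in> S \<Longrightarrow> sq x y = (norm (x - y))\<^sup>2"
  using inner_S[of x] inner_S[of y]
  by (simp add: sq_def power2_norm_eq_inner inner_diff_left inner_diff_right inner_commute)

lemma sq_commute: "sq x y = sq y x" by (simp add: sq_def inner_commute)

lemma sq_pos: "x \<in> S \<Longrightarrow> y \<in> S \<Longrightarrow> x \<noteq> y \<Longrightarrow> sq x y > 0"
  by (simp add: sq_norm)

lemma sq_self: "x \<in> S \<Longrightarrow> sq x x = 0" by (simp add: sq_norm)

lemma continuous_on_sq: "continuous_on A (\<lambda>w. sq x w)"
  unfolding sq_def by (intro continuous_intros)

lemma continuous_on_Phi: "x \<in> S \<Longrightarrow> r > 0 \<Longrightarrow> continuous_on S (Phi r x)"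
proof -
  assume "x \<in> S" "r > 0"
  moreover from this have "continuous_on {0..4} (moll b r)"
    by (intro continuous_at_imp_continuous_on ballI DERIV_isCont[OF moll_has_derivative[OF b_pos]]) auto
  ultimately show ?thesis
    by (intro continuous_on_compose2[OF _ continuous_on_sq]) (use sq_in in blast)+
qed

lemma continuous_on_Psi: "x \<in> S \<Longrightarrow> r > 0 \<Longrightarrow> continuous_on S (Psi r x)"
  by (intro continuous_on_compose2[OF continuous_on_moll_source[OF b_pos, of r "{0..4}"] continuous_on_sq])
    (use sq_in in auto)

lemma has_derivative_moll_inner:
  assumes "r > 0" "t \<in> {-1..1}"
  shows "((\<lambda>t. moll b r (2 - 2 * t)) has_real_derivative 2 * moll_deriv b r (2 - 2 * t)) (at t)"
    and "((\<lambda>t. 2 * moll_deriv b r (2 - 2 * t)) has_real_derivative - 4 * moll_deriv' b r (2 - 2 * t)) (at t)"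
proof -
  have i: "((\<lambda>t. 2 - 2 * t) has_real_derivative - 2) (at t)" by (auto intro!: derivative_eq_intros)
  show "((\<lambda>t. moll b r (2 - 2 * t)) has_real_derivative 2 * moll_deriv b r (2 - 2 * t)) (at t)"
    using DERIV_chain2[OF moll_has_derivative[OF b_pos assms(1), of "2 - 2 * t"] i] assms(2)
    by (simp add: mult.commute)
  have "((\<lambda>t. moll_deriv b r (2 - 2 * t)) has_real_derivative moll_deriv' b r (2 - 2 * t) * - 2) (at t)"
    by (rule DERIV_chain2[OF moll_deriv_has_derivative[OF b_pos assms(1)] i]) (use assms(2) in auto)
  from DERIV_cmult[OF this, of 2]
  show "((\<lambda>t. 2 * moll_deriv b r (2 - 2 * t)) has_real_derivative - 4 * moll_deriv' b r (2 - 2 * t)) (at t)"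
    by (simp add: mult.commute)
qed

text \<open>For s = 2 - 2 t one has s (4 - s) = 4 (1 - t^2) and 2 - s = 2 t.\<close>

lemma moll_ode_inner:
  assumes "r > 0" "t \<in> {-1..1}"
  shows "(1 - t\<^sup>2) * (- 4 * moll_deriv' b r (2 - 2 * t)) - real d * t * (2 * moll_deriv b r (2 - 2 * t))
    = 1 - moll_source b r (2 - 2 * t)"
proof -
  have "2 - 2 * t < 5" using assms(2) by simp
  from moll_deriv_ode[OF b_pos assms(1) this, unfolded d_eq]
  show ?thesis by (simp add: algebra_simps power2_eq_square)
qed

lemma continuous_on_moll_deriv_inner:
  assumes "r > 0"
  shows "continuous_on {-1..1} (\<lambda>t. 2 * moll_deriv b r (2 - 2 * t))"
    and "continuous_on {-1..1} (\<lambda>t. - 4 * moll_deriv' b r (2 - 2 * t))"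
proof -
  show "continuous_on {-1..1} (\<lambda>t. 2 * moll_deriv b r (2 - 2 * t))"
    by (intro continuous_on_mult_left continuous_on_compose2[OF continuous_on_moll_deriv[OF b_pos assms, of "{0..4}"]]
        continuous_intros) auto
  obtain f where f: "\<And>s. s \<in> {..<5} \<Longrightarrow> (moll_deriv b r has_real_derivative f s) (at s)"
      "smooth_upto (Suc 0) {..<5} f"
    using smooth_upto_moll_deriv[OF b_pos assms, of "Suc (Suc 0)"]
    unfolding smooth_upto.simps(2)[of "Suc 0"] by blast
  have "isCont f s" if "s < 5" for s using smooth_upto_isCont[OF f(2)] that by auto
  then have "continuous_on {0..4} f" by (intro continuous_at_imp_continuous_on) auto
  moreover have "f s = moll_deriv' b r s" if "s \<in> {0..4}" for s
    using DERIV_unique[OF f(1) moll_deriv_has_derivative[OF b_pos assms]] that by auto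
  ultimately have c: "continuous_on {0..4} (moll_deriv' b r)"
    using continuous_on_cong[of "{0..4}" "{0..4}" f "moll_deriv' b r"] by simp
  show "continuous_on {-1..1} (\<lambda>t. - 4 * moll_deriv' b r (2 - 2 * t))"
    by (intro continuous_on_mult_left continuous_on_compose2[OF c] continuous_intros) auto
qed

section \<open>Green identities for the mollified kernel\<close>

lemma laplace_beltrami_Phi:
  assumes "x \<in> S" "y \<in> S" "r > 0"
  shows "laplace_beltrami (Phi r x) y = Psi r x y - 1"
proof -
  have "laplace_beltrami (\<lambda>y. moll b r (2 - 2 * (x \<bullet> y))) y =
    real (DIM('a) - 1) * (x \<bullet> y) * (2 * moll_deriv b r (2 - 2 * (x \<bullet> y)))
    - (1 - (x \<bullet> y)\<^sup>2) * (- 4 * moll_deriv' b r (2 - 2 * (x \<bullet> y)))"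
    by (rule laplace_beltrami_zonal[OF norm_S[OF assms(1)] norm_S[OF assms(2)]
        has_derivative_moll_inner[OF assms(3)]])
  then show ?thesis
    using moll_ode_inner[OF assms(3) inner_in[OF assms(1,2)]] dim by (simp add: sq_def)
qed

lemma smooth_on_Phi:
  assumes "x \<in> S" "r > 0"
  shows "smooth_on S (Phi r x)"
  unfolding sq_def
\<comment> \<open>The map from t to 2 - 2 t sends this interval onto the one between -1/2 and 9/2,
  on which \<open>moll\<close> is smooth.\<close>
proof (rule smooth_on_zonal[OF assms(1), of "{-5/4<..<5/4}"])
  have "smooth_upto k {-5/4<..<5/4} (\<lambda>t. moll b r ((-2) * t + 2))" for k
    by (rule smooth_upto_comp_affine[OF smooth_upto_moll[OF b_pos assms(2)]]) auto
  then show "smooth_upto k {-5/4<..<5/4} (\<lambda>t. moll b r (2 - 2 * t))" for k by simp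
qed auto

text \<open>Green's first identity. With \<open>2 * moll_deriv\<close> as second zonal factor, the
  field in \<open>integral_zonal_by_parts\<close> becomes \<open>A (x \<bullet> w)\<close> times the
  gradient of \<open>Phi r z\<close>, whose Laplacian is \<open>Psi r z - 1\<close>.\<close>

lemma integral_by_parts:
  assumes "x \<in> S" "z \<in> S" "r > 0"
    and A: "\<And>t. t \<in> {-1..1} \<Longrightarrow> (A has_real_derivative A' t) (at t)" "continuous_on {-1..1} A'"
  shows "(\<integral>w. A (x \<bullet> w) * (Psi r z w - 1) \<partial>\<sigma>) =
    (\<integral>w. A' (x \<bullet> w) * (2 * moll_deriv b r (sq z w)) * (x \<bullet> z - (x \<bullet> w) * (z \<bullet> w)) \<partial>\<sigma>)"
proof -
  let ?f = "\<lambda>w. A' (x \<bullet> w) * (2 * moll_deriv b r (sq z w)) * (x \<bullet> z - (x \<bullet> w) * (z \<bullet> w))"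
  let ?h = "\<lambda>w. A (x \<bullet> w) * (Psi r z w - 1)"
  have ci: "continuous_on S (\<lambda>w. y \<bullet> w)" for y by (intro continuous_intros)
  have cA: "continuous_on {-1..1} A"
    by (intro continuous_at_imp_continuous_on ballI DERIV_isCont[OF A(1)])
  have c1: "continuous_on S (\<lambda>w. A (x \<bullet> w))" "continuous_on S (\<lambda>w. A' (x \<bullet> w))"
    by (rule continuous_on_compose2[OF cA ci] continuous_on_compose2[OF A(2) ci];
        use inner_in assms(1) in blast)+
  have c2: "continuous_on S (\<lambda>w. 2 * moll_deriv b r (sq z w))"
    by (intro continuous_on_mult_left continuous_on_compose2[OF continuous_on_moll_deriv[OF b_pos assms(3), of "{0..4}"]
        continuous_on_sq]) (use sq_in assms(2) in auto)
  have i: "integrable \<sigma> ?f" "integrable \<sigma> ?h"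
    by (intro integrable_sphere_vol continuous_intros c1 c2 continuous_on_Psi assms)+
  have "0 = (\<integral>w. A' (x \<bullet> w) * (2 * moll_deriv b r (2 - 2 * (z \<bullet> w))) * (x \<bullet> z - (x \<bullet> w) * (z \<bullet> w))
      + A (x \<bullet> w) * ((1 - (z \<bullet> w)\<^sup>2) * (- 4 * moll_deriv' b r (2 - 2 * (z \<bullet> w)))
       - real (DIM('a) - 1) * (z \<bullet> w) * (2 * moll_deriv b r (2 - 2 * (z \<bullet> w)))) \<partial>\<sigma>)"
    by (rule integral_zonal_by_parts[symmetric, OF norm_S[OF assms(1)] norm_S[OF assms(2)] A(1)
        has_derivative_moll_inner(2)[OF assms(3)] A(2) continuous_on_moll_deriv_inner(2)[OF assms(3)]])
  also have "\<dots> = (\<integral>w. ?f w - ?h w \<partial>\<sigma>)"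
  proof (rule Bochner_Integration.integral_cong[OF refl])
    fix w assume "w \<in> space \<sigma>"
    then have w: "w \<in> S" by (simp add: space_sphere_vol)
    have e: "DIM('a) - 1 = d" using dim by simp
    show "A' (x \<bullet> w) * (2 * moll_deriv b r (2 - 2 * (z \<bullet> w))) * (x \<bullet> z - (x \<bullet> w) * (z \<bullet> w))
      + A (x \<bullet> w) * ((1 - (z \<bullet> w)\<^sup>2) * (- 4 * moll_deriv' b r (2 - 2 * (z \<bullet> w)))
       - real (DIM('a) - 1) * (z \<bullet> w) * (2 * moll_deriv b r (2 - 2 * (z \<bullet> w)))) = ?f w - ?h w"
      unfolding e moll_ode_inner[OF assms(3) inner_in[OF assms(2) w]] by (simp add: sq_def algebra_simps)
  qed
  also have "\<dots> = (\<integral>w. ?f w \<partial>\<sigma>) - (\<integral>w. ?h w \<partial>\<sigma>)"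
    by (rule Bochner_Integration.integral_diff[OF i])
  finally show ?thesis by simp
qed

lemma integrable_Phi: "x \<in> S \<Longrightarrow> r > 0 \<Longrightarrow> integrable \<sigma> (Phi r x)"
  by (intro integrable_sphere_vol continuous_on_Phi)

lemma integrable_Psi: "x \<in> S \<Longrightarrow> r > 0 \<Longrightarrow> integrable \<sigma> (Psi r x)"
  by (intro integrable_sphere_vol continuous_on_Psi)

lemma integral_Phi: "(\<integral>w. Phi r x w \<partial>\<sigma>) = V * mean_Phi r x"
  using V_pos by (simp add: mean_Phi_def)

text \<open>Tested against a constant, Green's identity says that a Laplacian has mean zero.\<close>

lemma integral_Psi:
  assumes "x \<in> S" "r > 0"
  shows "(\<integral>w. Psi r x w \<partial>\<sigma>) = V"
proof -
  have "(\<integral>w. 1 * (Psi r x w - 1) \<partial>\<sigma>) =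
      (\<integral>w. 0 * (2 * moll_deriv b r (sq x w)) * (x \<bullet> x - (x \<bullet> w) * (x \<bullet> w)) \<partial>\<sigma>)"
    by (rule integral_by_parts[OF assms(1,1,2), of "\<lambda>_. 1" "\<lambda>_. 0"]) auto
  then have "(\<integral>w. Psi r x w - 1 \<partial>\<sigma>) = 0" by simp
  then show ?thesis
    using integrable_Psi[OF assms] integral_const[of 1]
    by (subst (asm) Bochner_Integration.integral_diff) (auto intro: integrable_sphere_vol)
qed

lemma integral_Phi_Psi:
  assumes "x \<in> S" "z \<in> S" "r > 0" "r' > 0"
  shows "(\<integral>w. Phi r x w * Psi r' z w \<partial>\<sigma>) = V * mean_Phi r x +
    (\<integral>w. 4 * moll_deriv b r (sq x w) * moll_deriv b r' (sq z w) * (x \<bullet> z - (x \<bullet> w) * (z \<bullet> w)) \<partial>\<sigma>)"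
proof -
  have "(\<integral>w. Phi r x w * (Psi r' z w - 1) \<partial>\<sigma>) =
    (\<integral>w. 2 * moll_deriv b r (2 - 2 * (x \<bullet> w)) * (2 * moll_deriv b r' (sq z w)) * (x \<bullet> z - (x \<bullet> w) * (z \<bullet> w)) \<partial>\<sigma>)"
    using integral_by_parts[OF assms(1,2,4) has_derivative_moll_inner(1)[OF assms(3)]
        continuous_on_moll_deriv_inner(1)[OF assms(3)]] by (simp add: sq_def)
  moreover have "(\<integral>w. Phi r x w * (Psi r' z w - 1) \<partial>\<sigma>) =
      (\<integral>w. Phi r x w * Psi r' z w \<partial>\<sigma>) - V * mean_Phi r x"
    unfolding right_diff_distrib mult_1_right integral_Phi[symmetric]
    by (intro Bochner_Integration.integral_diff integrable_Phi assms
        integrable_sphere_vol continuous_intros continuous_on_Phi continuous_on_Psi)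
  ultimately show ?thesis by (simp add: sq_def mult_ac)
qed

text \<open>By \<open>integral_Phi_Psi\<close> each term is the integral of the inner product of the
  gradients of \<open>Phi r (x i)\<close> and \<open>Phi r (x j)\<close>, so the double sum is the
  integral of a squared norm. The diagonal terms are included in it and have to be paid for in
  \<open>energy_lower\<close>.\<close>

lemma Phi_positive_definite:
  fixes x :: "nat \<Rightarrow> 'a"
  assumes "\<And>i. i \<in> I \<Longrightarrow> x i \<in> S" "r > 0"
  shows "(\<Sum>i\<in>I. \<Sum>j\<in>I. (\<integral>w. Phi r (x i) w * Psi r (x j) w \<partial>\<sigma>) - V * mean_Phi r (x i)) \<ge> 0"
proof -
  let ?m = "\<lambda>i w. 2 * moll_deriv b r (sq (x i) w)"
  let ?k = "\<lambda>i j w. ?m i w * ?m j w * (x i \<bullet> x j - (x i \<bullet> w) * (x j \<bullet> w))"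
  have cm: "continuous_on S (?m i)" if "i \<in> I" for i
    by (intro continuous_on_mult_left continuous_on_compose2[OF continuous_on_moll_deriv[OF b_pos assms(2), of "{0..4}"]
        continuous_on_sq]) (use sq_in assms(1) that in auto)
  have int: "integrable \<sigma> (?k i j)" if "i \<in> I" "j \<in> I" for i j
    by (intro integrable_sphere_vol continuous_intros cm that)
  have "(\<Sum>i\<in>I. \<Sum>j\<in>I. (\<integral>w. Phi r (x i) w * Psi r (x j) w \<partial>\<sigma>) - V * mean_Phi r (x i))
     = (\<Sum>i\<in>I. \<Sum>j\<in>I. \<integral>w. ?k i j w \<partial>\<sigma>)"
  proof (intro sum.cong refl)
    fix i j assume ij: "i \<in> I" "j \<in> I"
    show "(\<integral>w. Phi r (x i) w * Psi r (x j) w \<partial>\<sigma>) - V * mean_Phi r (x i) = (\<integral>w. ?k i j w \<partial>\<sigma>)"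
      using integral_Phi_Psi[OF assms(1)[OF ij(1)] assms(1)[OF ij(2)] assms(2,2)] by (simp add: mult_ac)
  qed
  also have "\<dots> = (\<Sum>i\<in>I. \<integral>w. (\<Sum>j\<in>I. ?k i j w) \<partial>\<sigma>)"
    by (intro sum.cong refl Bochner_Integration.integral_sum[symmetric] int)
  also have "\<dots> = (\<integral>w. (\<Sum>i\<in>I. \<Sum>j\<in>I. ?k i j w) \<partial>\<sigma>)"
    by (intro Bochner_Integration.integral_sum[symmetric] Bochner_Integration.integrable_sum int)
  also have "\<dots> \<ge> 0"
  proof (rule Bochner_Integration.integral_nonneg_AE, rule AE_I2)
    fix w assume "w \<in> space \<sigma>"
    then have w: "w \<bullet> w = 1" by (simp add: space_sphere_vol norm_eq_1)
    \<comment> \<open>\<open>v i\<close> is the gradient of \<open>Phi r (x i)\<close> at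
      \<open>w\<close>.\<close>
    define v where "v i = ?m i w *\<^sub>R (x i - (x i \<bullet> w) *\<^sub>R w)" for i
    have "?k i j w = v i \<bullet> v j" for i j
      by (simp add: v_def inner_diff_left inner_diff_right w inner_commute algebra_simps)
    then have "(\<Sum>i\<in>I. \<Sum>j\<in>I. ?k i j w) = (\<Sum>i\<in>I. v i) \<bullet> (\<Sum>j\<in>I. v j)"
      by (subst sum.swap) (simp add: inner_sum_left inner_sum_right)
    then show "0 \<le> (\<Sum>i\<in>I. \<Sum>j\<in>I. ?k i j w)" by simp
  qed
  finally show ?thesis .
qed

text \<open>Green's second identity for \<open>Phi r x\<close> and the spherical harmonic \<open>w \<mapsto> x \<bullet> w\<close>, whose
  Laplacian is \<open>d\<close> times itself.\<close>

lemma integral_inner_Phi: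
  assumes "x \<in> S" "r > 0"
  shows "real d * (\<integral>w. (x \<bullet> w) * Phi r x w \<partial>\<sigma>) = (\<integral>w. (x \<bullet> w) * Psi r x w \<partial>\<sigma>)"
proof -
  have ci: "continuous_on S (\<lambda>w. y \<bullet> w)" for y by (intro continuous_intros)
  have e: "DIM('a) - 1 = d" using dim by simp
  have cd: "continuous_on S (\<lambda>w. 2 * moll_deriv b r (sq x w))"
    by (intro continuous_on_mult_left continuous_on_compose2[OF continuous_on_moll_deriv[OF b_pos assms(2), of "{0..4}"]
        continuous_on_sq]) (use sq_in assms(1) in auto)
  have "(\<integral>w. 0 * 1 * (x \<bullet> x - (x \<bullet> w) * (x \<bullet> w))
      + 1 * ((1 - (x \<bullet> w)\<^sup>2) * 0 - real (DIM('a) - 1) * (x \<bullet> w) * 1) \<partial>\<sigma>) = 0"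
    by (rule integral_zonal_by_parts[of x x "\<lambda>_. 1" "\<lambda>_. 0" "\<lambda>_. 1" "\<lambda>_. 0"]) (use assms in auto)
  then have 0: "(\<integral>w. x \<bullet> w \<partial>\<sigma>) = 0" using d dim by simp
  have "(\<integral>w. 2 * moll_deriv b r (2 - 2 * (x \<bullet> w)) * 1 * (x \<bullet> x - (x \<bullet> w) * (x \<bullet> w))
      + moll b r (2 - 2 * (x \<bullet> w)) * ((1 - (x \<bullet> w)\<^sup>2) * 0 - real (DIM('a) - 1) * (x \<bullet> w) * 1) \<partial>\<sigma>) = 0"
    by (rule integral_zonal_by_parts[of x x "\<lambda>t. moll b r (2 - 2 * t)" _ "\<lambda>_. 1" "\<lambda>_. 0",
          OF _ _ has_derivative_moll_inner(1)[OF assms(2)] _ continuous_on_moll_deriv_inner(1)[OF assms(2)]])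
      (use assms in auto)
  then have "(\<integral>w. 2 * moll_deriv b r (sq x w) * (x \<bullet> x - (x \<bullet> w) * (x \<bullet> w))
      - real d * ((x \<bullet> w) * Phi r x w) \<partial>\<sigma>) = 0"
    by (simp add: dim sq_def mult_ac)
  then have 1: "(\<integral>w. 2 * moll_deriv b r (sq x w) * (x \<bullet> x - (x \<bullet> w) * (x \<bullet> w)) \<partial>\<sigma>)
      = real d * (\<integral>w. (x \<bullet> w) * Phi r x w \<partial>\<sigma>)"
    by (subst (asm) Bochner_Integration.integral_diff)
      (auto intro!: integrable_sphere_vol continuous_intros cd continuous_on_Phi assms)
  have "(\<integral>w. (x \<bullet> w) * (Psi r x w - 1) \<partial>\<sigma>) =
      (\<integral>w. 1 * (2 * moll_deriv b r (sq x w)) * (x \<bullet> x - (x \<bullet> w) * (x \<bullet> w)) \<partial>\<sigma>)"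
    by (rule integral_by_parts[OF assms(1,1,2), of "\<lambda>t. t" "\<lambda>_. 1"]) auto
  moreover have "(\<integral>w. (x \<bullet> w) * (Psi r x w - 1) \<partial>\<sigma>) = (\<integral>w. (x \<bullet> w) * Psi r x w \<partial>\<sigma>) - (\<integral>w. x \<bullet> w \<partial>\<sigma>)"
    unfolding right_diff_distrib mult_1_right
    by (intro Bochner_Integration.integral_diff integrable_sphere_vol continuous_intros continuous_on_Psi assms)
  ultimately show ?thesis using 0 1 by simp
qed

section \<open>The mean of the mollified kernel as the radius varies\<close>

lemma Psi_nonneg: "x \<in> S \<Longrightarrow> w \<in> S \<Longrightarrow> Psi r x w \<ge> 0"
  using moll_source_nonneg sq_in by blast

lemma mean_Phi_mono:
  assumes "x \<in> S" "0 < r'" "r' \<le> r"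
  shows "mean_Phi r x \<le> mean_Phi r' x"
  unfolding mean_Phi_def using V_pos assms sq_in
  by (intro divide_right_mono integral_mono integrable_Phi moll_le_moll[OF b_pos])
    (auto simp: space_sphere_vol)

text \<open>The difference of the two kernels is nonnegative and supported where
  \<open>sq x w < r\<^sup>2\<close>. As \<open>r \<le> 1\<close>, there
  \<open>2 * (x \<bullet> w) \<ge> 1\<close>, so its integral grows when it is weighted with
  \<open>2 * (x \<bullet> w)\<close>. That is an eigenfunction, and
  \<open>integral_inner_Phi\<close> turns the weighted integrals into first moments of the bumps.
  Both moments are at most \<open>V\<close>, and the one at radius \<open>r\<close> is at least
  \<open>(1 - r\<^sup>2 / 2) * V\<close>, which gives a quadratic error.\<close>

lemma mean_Phi_diff_upper:
  assumes x: "x \<in> S" and r: "0 < r'" "r' \<le> r" "r \<le> 1"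
  shows "mean_Phi r' x - mean_Phi r x \<le> r\<^sup>2 / real d"
proof -
  have r0: "r > 0" using r by simp
  have r1: "r\<^sup>2 \<le> 1" using r r0 by (simp add: power_le_one)
  have ci: "continuous_on S (\<lambda>w. x \<bullet> w)" by (intro continuous_intros)
  note ints = integrable_sphere_vol continuous_intros ci continuous_on_Phi continuous_on_Psi x r0 r(1)
  have "V * (mean_Phi r' x - mean_Phi r x) = (\<integral>w. Phi r' x w - Phi r x w \<partial>\<sigma>)"
    unfolding right_diff_distrib integral_Phi[symmetric]
    by (subst Bochner_Integration.integral_diff) (auto intro: integrable_Phi x r0 r)
  also have "\<dots> \<le> (\<integral>w. 2 * ((x \<bullet> w) * Phi r' x w - (x \<bullet> w) * Phi r x w) \<partial>\<sigma>)"
  proof (intro integral_mono ints)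
    fix w assume "w \<in> space \<sigma>"
    then have w: "w \<in> S" by (simp add: space_sphere_vol)
    have le: "Phi r x w \<le> Phi r' x w"
      using moll_le_moll[OF b_pos r(1,2) sq_in[OF x w]] .
    show "Phi r' x w - Phi r x w \<le> 2 * ((x \<bullet> w) * Phi r' x w - (x \<bullet> w) * Phi r x w)"
    proof (cases "sq x w < r\<^sup>2")
      case True
      then have "1 \<le> 2 * (x \<bullet> w)" using r1 by (simp add: sq_def)
      then have "1 * (Phi r' x w - Phi r x w) \<le> (2 * (x \<bullet> w)) * (Phi r' x w - Phi r x w)"
        using le by (intro mult_right_mono) auto
      then show ?thesis by (simp add: algebra_simps)
    next
      case False
      moreover have "r'\<^sup>2 \<le> r\<^sup>2" using r by (intro power_mono) auto
      ultimately have "Phi r' x w = Phi r x w"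
        using moll_eq_green_profile[OF b_pos r(1), of "sq x w"] sq_in[OF x w]
          moll_eq_green_profile[OF b_pos r0, of "sq x w"] by simp
      then show ?thesis by simp
    qed
  qed
  also have "\<dots> = 2 * ((\<integral>w. (x \<bullet> w) * Phi r' x w \<partial>\<sigma>) - (\<integral>w. (x \<bullet> w) * Phi r x w \<partial>\<sigma>))"
    unfolding integral_mult_right_zero
    by (subst Bochner_Integration.integral_diff) (intro ints refl)+
  also have "\<dots> = 2 / real d * ((\<integral>w. (x \<bullet> w) * Psi r' x w \<partial>\<sigma>) - (\<integral>w. (x \<bullet> w) * Psi r x w \<partial>\<sigma>))"
    unfolding integral_inner_Phi[OF x r0, symmetric] integral_inner_Phi[OF x r(1), symmetric]
    using d by (simp add: field_simps)
  also have "\<dots> \<le> 2 / real d * (V - (1 - r\<^sup>2 / 2) * V)"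
  proof (intro mult_left_mono diff_mono)
    have "(\<integral>w. (x \<bullet> w) * Psi r' x w \<partial>\<sigma>) \<le> (\<integral>w. 1 * Psi r' x w \<partial>\<sigma>)"
      using inner_in[OF x] Psi_nonneg[OF x]
      by (intro integral_mono ints mult_right_mono) (auto simp: space_sphere_vol)
    then show "(\<integral>w. (x \<bullet> w) * Psi r' x w \<partial>\<sigma>) \<le> V" using integral_Psi[OF x r(1)] by simp
    have "(\<integral>w. (1 - r\<^sup>2 / 2) * Psi r x w \<partial>\<sigma>) \<le> (\<integral>w. (x \<bullet> w) * Psi r x w \<partial>\<sigma>)"
    proof (intro integral_mono ints)
      fix w assume "w \<in> space \<sigma>"
      then have w: "w \<in> S" by (simp add: space_sphere_vol)
      show "(1 - r\<^sup>2 / 2) * Psi r x w \<le> (x \<bullet> w) * Psi r x w"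
      proof (cases "sq x w < r\<^sup>2")
        case True
        then show ?thesis using Psi_nonneg[OF x w, of r] by (intro mult_right_mono) (auto simp: sq_def)
      next
        case False
        then show ?thesis using moll_source_eq_0[OF r0, of "sq x w"] by simp
      qed
    qed
    then show "(1 - r\<^sup>2 / 2) * V \<le> (\<integral>w. (x \<bullet> w) * Psi r x w \<partial>\<sigma>)" using integral_Psi[OF x r0] by simp
  qed auto
  also have "\<dots> = V * (r\<^sup>2 / real d)" by (simp add: algebra_simps)
  finally show ?thesis by (simp only: mult_le_cancel_left_pos[OF V_pos])
qed

subsection \<open>Structure of the Green function\<close>

lemma g_commute: "x \<in> S \<Longrightarrow> y \<in> S \<Longrightarrow> g x y = g y x"
  using green unfolding is_green_function_def g_def by auto

lemma integrable_g: "x \<in> S \<Longrightarrow> integrable \<sigma> (g x)"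
  using green unfolding is_green_function_def g_def[abs_def] by auto

lemma integral_g: "x \<in> S \<Longrightarrow> (\<integral>w. g x w \<partial>\<sigma>) = 0"
  using green unfolding is_green_function_def g_def by auto

lemma integrable_g_mult:
  assumes "y \<in> S" "continuous_on S f"
  shows "integrable \<sigma> (\<lambda>w. g y w * f w)"
proof -
  have "bounded (f ` S)"
    by (intro compact_imp_bounded compact_continuous_image assms) auto
  then obtain B where B: "\<forall>w\<in>S. \<bar>f w\<bar> \<le> B" by (auto simp: bounded_iff)
  show ?thesis
  proof (rule Bochner_Integration.integrable_bound)
    show "integrable \<sigma> (\<lambda>w. B * g y w)" using integrable_g[OF assms(1)] by simp
    show "(\<lambda>w. g y w * f w) \<in> borel_measurable \<sigma>"
      using integrable_g[OF assms(1)] borel_measurable_sphere_vol[OF assms(2)]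
      by (intro borel_measurable_times) auto
    show "AE w in \<sigma>. norm (g y w * f w) \<le> norm (B * g y w)"
    proof (rule AE_I2)
      fix w assume "w \<in> space \<sigma>"
      then have "\<bar>f w\<bar> \<le> \<bar>B\<bar>" using B by (force simp: space_sphere_vol)
      then show "norm (g y w * f w) \<le> norm (B * g y w)"
        by (simp add: abs_mult mult.commute mult_right_mono)
    qed
  qed
qed

lemma integral_g_Psi:
  assumes "x \<in> S" "y \<in> S" "r > 0"
  shows "(\<integral>w. g y w * Psi r x w \<partial>\<sigma>) = Phi r x y - mean_Phi r x"
proof -
  have "(\<integral>w. g y w * laplace_beltrami (Phi r x) w \<partial>\<sigma>) = Phi r x y - (\<integral>w. Phi r x w \<partial>\<sigma>) / V"
    using green smooth_on_Phi[OF assms(1,3)] assms(2) unfolding is_green_function_def g_def V_def by blast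
  also have "(\<integral>w. g y w * laplace_beltrami (Phi r x) w \<partial>\<sigma>) = (\<integral>w. g y w * Psi r x w - g y w \<partial>\<sigma>)"
    by (rule Bochner_Integration.integral_cong)
      (use assms in \<open>auto simp: space_sphere_vol laplace_beltrami_Phi algebra_simps\<close>)
  also have "\<dots> = (\<integral>w. g y w * Psi r x w \<partial>\<sigma>)"
    by (subst Bochner_Integration.integral_diff)
      (use assms in \<open>auto intro!: integrable_g_mult integrable_g continuous_on_Psi simp: integral_g\<close>)
  finally show ?thesis by (simp add: mean_Phi_def)
qed

text \<open>The kernels \<open>Psi r x\<close> form an approximate identity of mass \<open>V\<close>.\<close>

lemma Psi_approximate_identity:
  assumes x: "x \<in> S" and f: "\<And>r. r > 0 \<Longrightarrow> integrable \<sigma> (\<lambda>w. f w * Psi r x w)"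
    and cont: "continuous (at x within S) f"
    and r: "\<And>k. r k > 0" "r \<longlonglongrightarrow> 0"
  shows "(\<lambda>k::nat. \<integral>w. f w * Psi (r k) x w \<partial>\<sigma>) \<longlonglongrightarrow> V * f x"
proof (rule LIMSEQ_I)
  fix e :: real assume e: "e > 0"
  define e' where "e' = e / (2 * V)"
  have e': "e' > 0" "e' * V < e" using e V_pos by (auto simp: e'_def)
  obtain \<delta> where \<delta>: "\<delta> > 0" "\<And>w. w \<in> S \<Longrightarrow> dist w x < \<delta> \<Longrightarrow> dist (f w) (f x) < e'"
    using cont e'(1) unfolding continuous_within_eps_delta by metis
  obtain N where N: "\<And>k. k \<ge> N \<Longrightarrow> norm (r k - 0) < \<delta>"
    using LIMSEQ_D[OF r(2) \<delta>(1)] by blast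
  have "norm ((\<integral>w. f w * Psi (r k) x w \<partial>\<sigma>) - V * f x) < e" if k: "k \<ge> N" for k
  proof -
    have rk: "r k < \<delta>" using N[OF k] by simp
    have i: "integrable \<sigma> (\<lambda>w. f x * Psi (r k) x w)" using integrable_Psi[OF x r(1)] by simp
    have eq: "(\<integral>w. f w * Psi (r k) x w \<partial>\<sigma>) - V * f x
        = (\<integral>w. f w * Psi (r k) x w - f x * Psi (r k) x w \<partial>\<sigma>)"
      using integral_Psi[OF x r(1)] by (subst Bochner_Integration.integral_diff[OF f[OF r(1)] i]) simp
    have "norm ((\<integral>w. f w * Psi (r k) x w \<partial>\<sigma>) - V * f x)
        \<le> (\<integral>w. norm (f w * Psi (r k) x w - f x * Psi (r k) x w) \<partial>\<sigma>)"
      unfolding eq by (rule integral_norm_bound)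
    also have "\<dots> \<le> (\<integral>w. e' * Psi (r k) x w \<partial>\<sigma>)"
    proof (intro integral_mono)
      show "integrable \<sigma> (\<lambda>w. norm (f w * Psi (r k) x w - f x * Psi (r k) x w))"
        using f[OF r(1)] i by auto
      show "integrable \<sigma> (\<lambda>w. e' * Psi (r k) x w)" using integrable_Psi[OF x r(1)] by simp
      fix w assume "w \<in> space \<sigma>"
      then have w: "w \<in> S" by (simp add: space_sphere_vol)
      show "norm (f w * Psi (r k) x w - f x * Psi (r k) x w) \<le> e' * Psi (r k) x w"
      proof (cases "norm (x - w) < r k")
        case True
        then have "dist w x < \<delta>" using rk by (simp add: dist_norm norm_minus_commute)
        then have "\<bar>f w - f x\<bar> \<le> e'" using \<delta>(2)[OF w] by (simp add: dist_norm)
        then have "\<bar>f w - f x\<bar> * Psi (r k) x w \<le> e' * Psi (r k) x w"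
          using Psi_nonneg[OF x w] by (intro mult_right_mono)
        then show ?thesis
          using Psi_nonneg[OF x w, of "r k"] by (simp add: left_diff_distrib[symmetric] abs_mult)
      next
        case False
        then have "sq x w \<ge> (r k)\<^sup>2"
          using r(1)[of k] unfolding sq_norm[OF x w] by (intro power_mono) auto
        then show ?thesis using moll_source_eq_0[OF r(1)] by simp
      qed
    qed
    also have "\<dots> = e' * V" using integral_Psi[OF x r(1)] by simp
    finally show ?thesis using e'(2) by simp
  qed
  then show "\<exists>N. \<forall>k\<ge>N. norm ((\<integral>w. f w * Psi (r k) x w \<partial>\<sigma>) - V * f x) < e" by blast
qed

lemma continuous_g:
  assumes "x \<in> S" "y \<in> S" "x \<noteq> y"
  shows "continuous (at x within S) (g y)"
proof -
  let ?A = "{(x, y). x \<in> S \<and> y \<in> S \<and> x \<noteq> y}"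
  have "smooth_on ?A (\<lambda>(x, y). real_of_ereal (G x y))"
    using green unfolding is_green_function_def by blast
  moreover have "(y, x) \<in> ?A" using assms by auto
  ultimately obtain U F where U: "open U" "(y, x) \<in> U" "\<forall>k. Ck_on k F U"
    "\<forall>z\<in>?A \<inter> U. F z = (case z of (x, y) \<Rightarrow> real_of_ereal (G x y))"
    unfolding smooth_on_def by blast
  have cF: "continuous_on U F" using U(3)[rule_format, of 0] by simp
  let ?W = "{w. (y, w) \<in> U} \<inter> - {y}"
  have "open (Pair y -` U)" by (intro open_vimage U(1) continuous_intros)
  then have opW: "open ?W" by (intro open_Int) (auto simp: vimage_def)
  have "continuous_on {w. (y, w) \<in> U} (\<lambda>w. F (y, w))"
    by (rule continuous_on_compose2[OF cF]) (auto intro!: continuous_intros)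
  then have "continuous_on (S \<inter> ?W) (\<lambda>w. F (y, w))" by (rule continuous_on_subset) auto
  moreover have "F (y, w) = g y w" if "w \<in> S \<inter> ?W" for w
    using U(4) that assms(2) by (auto simp: g_def)
  ultimately have "continuous_on (S \<inter> ?W) (g y)"
    using continuous_on_cong[of "S \<inter> ?W" "S \<inter> ?W" "\<lambda>w. F (y, w)" "g y"] by simp
  moreover have "x \<in> S \<inter> ?W" using assms U(2) by auto
  ultimately have "continuous (at x within S \<inter> ?W) (g y)"
    by (auto simp: continuous_on_eq_continuous_within)
  moreover have "at x within S \<inter> ?W = at x within S"
    by (rule at_within_nhd[of x ?W]) (use opW \<open>x \<in> S \<inter> ?W\<close> in auto)
  ultimately show ?thesis by (simp add: continuous_within)
qed

definition r0 :: "nat \<Rightarrow> real" where "r0 k = inverse (real (Suc k))"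

lemma r0: "r0 k > 0" "r0 k \<le> 1" "r0 \<longlonglongrightarrow> 0"
  using LIMSEQ_inverse_real_of_nat by (auto simp: r0_def[abs_def] field_simps)

lemma eventually_r0_le: "r > 0 \<Longrightarrow> eventually (\<lambda>k. r0 k \<le> r) sequentially"
  using order_tendstoD(2)[OF r0(3), of r] by (auto elim: eventually_mono)

text \<open>The left side does not involve \<open>y\<close> and the right side is symmetric in the
  two points, which together force a limit independent of \<open>x\<close>. Once the radius is below
  the distance of the points, \<open>Phi\<close> equals \<open>Gam\<close>, and the mean can be
  solved for in \<open>integral_g_Psi\<close>.\<close>

lemma mean_Phi_tendsto:
  assumes "x \<in> S" "y \<in> S" "x \<noteq> y"
  shows "(\<lambda>k. mean_Phi (r0 k) x) \<longlonglongrightarrow> Gam x y - V * g x y"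
proof -
  have "(\<lambda>k. \<integral>w. g y w * Psi (r0 k) x w \<partial>\<sigma>) \<longlonglongrightarrow> V * g y x"
    by (rule Psi_approximate_identity[OF assms(1) _ continuous_g[OF assms] r0(1,3)])
      (intro integrable_g_mult continuous_on_Psi assms)
  then have "(\<lambda>k. Phi (r0 k) x y - mean_Phi (r0 k) x) \<longlonglongrightarrow> V * g x y"
    by (simp add: integral_g_Psi[OF assms(1,2) r0(1)] g_commute[OF assms(1,2)])
  from tendsto_diff[OF tendsto_const[of "Gam x y"] this]
  have l: "(\<lambda>k. Gam x y - (Phi (r0 k) x y - mean_Phi (r0 k) x)) \<longlonglongrightarrow> Gam x y - V * g x y" .
  have pos: "norm (x - y) > 0" using assms by simp
  have "eventually (\<lambda>k. Gam x y - (Phi (r0 k) x y - mean_Phi (r0 k) x) = mean_Phi (r0 k) x) sequentially"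
    using eventually_r0_le[OF pos]
  proof eventually_elim
    case (elim k)
    then have "(r0 k)\<^sup>2 \<le> sq x y"
      unfolding sq_norm[OF assms(1,2)] using r0(1)[of k] by (intro power_mono) auto
    then show ?case
      using moll_eq_green_profile[OF b_pos r0(1), of k "sq x y"] sq_in[OF assms(1,2)] by simp
  qed
  then show ?thesis using l by (rule Lim_transform_eventually[rotated])
qed

definition m0 :: real where
  "m0 = lim (\<lambda>k. mean_Phi (r0 k) (SOME x. x \<in> S))"

lemma ex_other: "\<exists>y\<in>S. y \<noteq> x" if "x \<in> S" for x
proof
  show "- x \<noteq> x"
  proof
    assume "- x = x"
    then have "2 *\<^sub>R x = 0" by (metis add.right_inverse scaleR_2)
    then show False using that by simp
  qed
  show "- x \<in> S" using that by simp
qed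

text \<open>Convergence at a point requires a second one, supplied by \<open>ex_other\<close>. Two
  distinct points \<open>x\<close> and \<open>e\<close> share their limit because both limits equal
  \<open>Gam x e - V * g x e\<close>.\<close>

lemma mean_Phi_tendsto_m0:
  assumes "x \<in> S"
  shows "(\<lambda>k. mean_Phi (r0 k) x) \<longlonglongrightarrow> m0"
proof -
  define e where "e = (SOME x. x \<in> S)"
  have e: "e \<in> S" unfolding e_def using assms by (rule someI)
  have conv: "(\<lambda>k. mean_Phi (r0 k) y) \<longlonglongrightarrow> lim (\<lambda>k. mean_Phi (r0 k) y)" if "y \<in> S" for y
    using ex_other[OF that] mean_Phi_tendsto[OF that] convergent_def convergent_LIMSEQ_iff by metis
  show ?thesis
  proof (cases "x = e")
    case True
    then show ?thesis using conv[OF e] by (simp add: m0_def e_def)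
  next
    case False
    have "(\<lambda>k. mean_Phi (r0 k) e) \<longlonglongrightarrow> Gam x e - V * g x e"
      using mean_Phi_tendsto[OF e assms] False by (simp add: sq_commute g_commute[OF e assms])
    then have "m0 = Gam x e - V * g x e"
      using conv[OF e] LIMSEQ_unique unfolding m0_def e_def by blast
    then show ?thesis using mean_Phi_tendsto[OF assms e False] by simp
  qed
qed

lemma g_eq:
  assumes "x \<in> S" "y \<in> S" "x \<noteq> y"
  shows "V * g x y = Gam x y - m0"
  using LIMSEQ_unique[OF mean_Phi_tendsto[OF assms] mean_Phi_tendsto_m0[OF assms(1)]] by simp

text \<open>The smaller radius tends to 0 in the comparison of two radii. The first bound replaces
  the mean by \<open>m0\<close> at no cost where the sign is favourable; the second states the price
  where it is not.\<close>

lemma mean_Phi_bounds: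
  assumes "x \<in> S" "0 < r" "r \<le> 1"
  shows "mean_Phi r x \<le> m0" "m0 - mean_Phi r x \<le> r\<^sup>2 / real d"
proof -
  have ev: "eventually (\<lambda>k. r0 k \<le> r) sequentially" by (rule eventually_r0_le[OF assms(2)])
  show "mean_Phi r x \<le> m0"
    by (rule tendsto_lowerbound[OF mean_Phi_tendsto_m0[OF assms(1)]])
      (use ev in \<open>auto elim!: eventually_mono intro: mean_Phi_mono[OF assms(1) r0(1)]\<close>)
  have "m0 \<le> mean_Phi r x + r\<^sup>2 / real d"
    by (rule tendsto_upperbound[OF mean_Phi_tendsto_m0[OF assms(1)]])
      (use ev mean_Phi_diff_upper[OF assms(1) r0(1) _ assms(3)] in \<open>force elim!: eventually_mono\<close>)+
  then show "m0 - mean_Phi r x \<le> r\<^sup>2 / real d" by simp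
qed

lemma mean_Phi_nonneg: "x \<in> S \<Longrightarrow> 0 < r \<Longrightarrow> mean_Phi r x \<ge> 0"
  unfolding mean_Phi_def using V_pos sq_in
  by (intro divide_nonneg_pos Bochner_Integration.integral_nonneg_AE AE_I2)
    (auto simp: space_sphere_vol intro!: moll_nonneg[OF b_pos])

section \<open>Polarization, separation and energy\<close>

definition q :: real where "q = 1 - 2 / real d"

definition energy :: "nat \<Rightarrow> (nat \<Rightarrow> 'a) \<Rightarrow> real" where
  "energy N x = (\<Sum>i\<in>{1..N}. \<Sum>j\<in>{1..N} - {i}. g (x i) (x j))"

lemma q_pos: "q > 0" using d by (simp add: q_def)

lemma q_less_1: "q < 1" using d by (simp add: q_def)

lemma real_powr_ge_1: "N \<ge> 1 \<Longrightarrow> a \<ge> 0 \<Longrightarrow> real N powr a \<ge> 1"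
  by (simp add: ge_one_powr_ge_zero)

lemma scaled_radius_powr:
  assumes "N \<ge> 1" "e > 0"
  shows "((e * real N powr (- 1 / real d))\<^sup>2) powr (- b) = (e\<^sup>2) powr (- b) * real N powr q"
proof -
  have "(real N powr (- 1 / real d))\<^sup>2 = real N powr (- 2 / real d)"
    using assms by (simp add: power2_eq_square powr_add[symmetric])
  moreover have "(- 2 / real d) * (- b) = q" using d by (simp add: b_def q_def field_simps)
  ultimately show ?thesis
    using assms by (simp add: power_mult_distrib powr_mult powr_powr)
qed

lemma G_eq: "x \<in> S \<Longrightarrow> y \<in> S \<Longrightarrow> x \<noteq> y \<Longrightarrow> G x y = ereal (g x y)"
  using green unfolding is_green_function_def g_def by (simp add: ereal_real')

lemma configuration_in: "configuration N x \<Longrightarrow> i \<in> {1..N} \<Longrightarrow> x i \<in> S"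
  by (simp add: configuration_def)

lemma configuration_neq: "configuration N x \<Longrightarrow> i \<in> {1..N} \<Longrightarrow> j \<in> {1..N} \<Longrightarrow> i \<noteq> j \<Longrightarrow> x i \<noteq> x j"
  unfolding configuration_def inj_on_def by blast

lemma green_energy_eq:
  assumes "configuration N x"
  shows "green_energy G N x = ereal (energy N x)"
proof -
  have "green_energy G N x = (\<Sum>i\<in>{1..N}. \<Sum>j\<in>{1..N} - {i}. ereal (g (x i) (x j)))"
    unfolding green_energy_def
    by (intro sum.cong refl G_eq configuration_in[OF assms])
      (use configuration_neq[OF assms] in auto)
  then show ?thesis by (simp add: energy_def)
qed

lemma energy_coeff_eq:
  "configuration N x \<Longrightarrow> energy_coeff d G N x = - energy N x / real N powr (1 + q)"
  by (simp add: energy_coeff_def green_energy_eq q_def)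

section \<open>Upper bound for the polarization of separated configurations\<close>

lemma AE_neq_configuration:
  assumes "configuration N x"
  shows "AE w in \<sigma>. \<forall>j\<in>{1..N}. w \<noteq> x j"
  by (intro AE_ball_countable[THEN iffD2] ballI AE_sphere_vol_neq configuration_in[OF assms])
    (use dim d in \<open>auto intro: countable_finite\<close>)

lemma sum_G_eq:
  assumes "configuration N x" "w \<in> S" "\<forall>j\<in>{1..N}. w \<noteq> x j"
  shows "(\<Sum>j\<in>{1..N}. G w (x j)) = ereal (\<Sum>j\<in>{1..N}. g (x j) w)"
proof -
  have "G w (x j) = ereal (g (x j) w)" if "j \<in> {1..N}" for j
    using that assms configuration_in[OF assms(1) that] by (simp add: G_eq g_commute[of w "x j"])
  then show ?thesis by simp
qed

text \<open>\<open>p\<close> is any real lower bound of the potential, so neither attainment nor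
  finiteness of the infimum is presupposed. Separation by \<open>2 * r\<close> makes at most one
  bump active at each point, and the bound on \<open>th\<close> times a single source then keeps the
  weight nonnegative. The potential itself has integral 0, so only the bump terms survive, with a
  minus sign.\<close>

lemma polarization_estimate:
  assumes x: "configuration N x" and N: "N \<ge> 1" and r: "0 < r" "r \<le> 1"
    and sep: "\<And>i j. i \<in> {1..N} \<Longrightarrow> j \<in> {1..N} \<Longrightarrow> i \<noteq> j \<Longrightarrow> norm (x i - x j) \<ge> 2 * r"
    and th: "0 < th" "th < 1" "\<And>s. s \<in> {0..4} \<Longrightarrow> th * moll_source b r s \<le> real N"
    and p: "\<And>w. w \<in> S \<Longrightarrow> ereal p \<le> (\<Sum>j\<in>{1..N}. G w (x j))"
  shows "p * ((1 - th) * V) \<le> - (th / real N) * (V * energy N x + real N * (moll b r 0 - m0))"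
proof -
  define I where "I = {1..N}"
  have finI: "finite I" and cardI: "card I = N" by (simp_all add: I_def)
  have xS: "x i \<in> S" if "i \<in> I" for i using configuration_in[OF x] that by (simp add: I_def)
  define W where "W w = 1 - th / real N * (\<Sum>i\<in>I. Psi r (x i) w)" for w
  have contW: "continuous_on S W"
    unfolding W_def by (intro continuous_intros continuous_on_Psi xS r)
  have W: "W w \<ge> 0" if w: "w \<in> S" for w
  proof (cases "\<exists>i\<in>I. norm (x i - w) < r")
    case True
    then obtain i where i: "i \<in> I" "norm (x i - w) < r" by blast
    have "Psi r (x j) w = 0" if j: "j \<in> I - {i}" for j
    proof -
      have "2 * r \<le> norm (x i - x j)" using sep[of i j] i j by (auto simp: I_def)
      also have "\<dots> \<le> norm (x i - w) + norm (x j - w)"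
        using norm_triangle_ineq4[of "x i - w" "x j - w"] by simp
      finally have "r \<le> norm (x j - w)" using i(2) by simp
      then have "r\<^sup>2 \<le> sq (x j) w" using j r by (subst sq_norm[OF xS w]) (auto intro: power_mono)
      then show ?thesis by (rule moll_source_eq_0[OF r(1)])
    qed
    then have "(\<Sum>j\<in>I. Psi r (x j) w) = Psi r (x i) w"
      using sum.remove[OF finI i(1), of "\<lambda>j. Psi r (x j) w"] by simp
    moreover have "th * Psi r (x i) w \<le> real N" by (rule th(3)[OF sq_in[OF xS[OF i(1)] w]])
    ultimately show ?thesis using N by (simp add: W_def field_simps)
  next
    case False
    have "Psi r (x j) w = 0" if j: "j \<in> I" for j
    proof -
      have "r\<^sup>2 \<le> sq (x j) w" using j r False by (subst sq_norm[OF xS w]) (auto intro: power_mono)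
      then show ?thesis by (rule moll_source_eq_0[OF r(1)])
    qed
    then show ?thesis by (simp add: W_def)
  qed
  have intW: "(\<integral>w. W w \<partial>\<sigma>) = (1 - th) * V"
  proof -
    have "(\<integral>w. W w \<partial>\<sigma>) = (\<integral>w. 1 \<partial>\<sigma>) - (\<integral>w. th / real N * (\<Sum>i\<in>I. Psi r (x i) w) \<partial>\<sigma>)"
      unfolding W_def
      by (intro Bochner_Integration.integral_diff integrable_sphere_vol continuous_intros continuous_on_Psi xS r)
    also have "(\<integral>w. th / real N * (\<Sum>i\<in>I. Psi r (x i) w) \<partial>\<sigma>)
        = th / real N * (\<Sum>i\<in>I. \<integral>w. Psi r (x i) w \<partial>\<sigma>)"
      unfolding integral_mult_right_zero
      by (subst Bochner_Integration.integral_sum) (auto intro!: integrable_Psi xS r)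
    also have "(\<Sum>i\<in>I. \<integral>w. Psi r (x i) w \<partial>\<sigma>) = (\<Sum>i\<in>I. V)"
      by (intro sum.cong refl integral_Psi xS r)
    also have "th / real N * (\<Sum>i\<in>I. V) = th * V" using N by (simp add: cardI)
    finally show ?thesis using integral_const[of 1] by (simp add: algebra_simps)
  qed
  define T where "T = (\<Sum>j\<in>I. \<Sum>i\<in>I. Phi r (x i) (x j) - mean_Phi r (x i))"
  have intU: "(\<integral>w. (\<Sum>j\<in>I. g (x j) w) * W w \<partial>\<sigma>) = - (th / real N) * T"
  proof -
    have "(\<integral>w. (\<Sum>j\<in>I. g (x j) w) * W w \<partial>\<sigma>) = (\<Sum>j\<in>I. \<integral>w. g (x j) w * W w \<partial>\<sigma>)"
      unfolding sum_distrib_right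
      by (intro Bochner_Integration.integral_sum integrable_g_mult contW xS)
    also have "\<dots> = (\<Sum>j\<in>I. - (th / real N) * (\<Sum>i\<in>I. Phi r (x i) (x j) - mean_Phi r (x i)))"
    proof (intro sum.cong refl)
      fix j assume j: "j \<in> I"
      have "(\<integral>w. g (x j) w * W w \<partial>\<sigma>) =
          (\<integral>w. g (x j) w - th / real N * (\<Sum>i\<in>I. g (x j) w * Psi r (x i) w) \<partial>\<sigma>)"
        unfolding W_def by (simp add: algebra_simps sum_distrib_left)
      also have "\<dots> = (\<integral>w. g (x j) w \<partial>\<sigma>)
          - (\<integral>w. th / real N * (\<Sum>i\<in>I. g (x j) w * Psi r (x i) w) \<partial>\<sigma>)"
        by (intro Bochner_Integration.integral_diff integrable_g integrable_mult_right
            Bochner_Integration.integrable_sum integrable_g_mult continuous_on_Psi xS j r)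
      also have "\<dots> = - (th / real N * (\<Sum>i\<in>I. \<integral>w. g (x j) w * Psi r (x i) w \<partial>\<sigma>))"
      proof -
        have "(\<integral>w. (\<Sum>i\<in>I. g (x j) w * Psi r (x i) w) \<partial>\<sigma>) = (\<Sum>i\<in>I. \<integral>w. g (x j) w * Psi r (x i) w \<partial>\<sigma>)"
          by (intro Bochner_Integration.integral_sum integrable_g_mult continuous_on_Psi xS j r)
        then show ?thesis by (simp only: integral_mult_right_zero integral_g[OF xS[OF j]] diff_0)
      qed
      also have "(\<Sum>i\<in>I. \<integral>w. g (x j) w * Psi r (x i) w \<partial>\<sigma>) = (\<Sum>i\<in>I. Phi r (x i) (x j) - mean_Phi r (x i))"
        by (intro sum.cong refl integral_g_Psi xS j r)
      finally show "(\<integral>w. g (x j) w * W w \<partial>\<sigma>) =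
          - (th / real N) * (\<Sum>i\<in>I. Phi r (x i) (x j) - mean_Phi r (x i))" by simp
    qed
    finally show ?thesis by (simp add: T_def sum_distrib_left)
  qed
  \<comment> \<open>Off the diagonal \<open>Phi\<close> equals \<open>Gam\<close> by separation and
    the mean is at most \<open>m0\<close>, so each ordered pair contributes at least
    \<open>V * g\<close>; each diagonal entry contributes the self term.\<close>
  have "V * energy N x + real N * (moll b r 0 - m0) \<le> T"
  proof -
    have "V * energy N x + real N * (moll b r 0 - m0)
        = (\<Sum>j\<in>I. (moll b r 0 - m0) + (\<Sum>i\<in>I - {j}. V * g (x j) (x i)))"
      unfolding energy_def I_def[symmetric] by (simp add: sum.distrib cardI sum_distrib_left)
    also have "\<dots> \<le> T"
      unfolding T_def
    proof (rule sum_mono)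
      fix j assume j: "j \<in> I"
      have "moll b r 0 - m0 \<le> Phi r (x j) (x j) - mean_Phi r (x j)"
        using mean_Phi_bounds(1)[OF xS[OF j] r] sq_self[OF xS[OF j]] by simp
      moreover have "(\<Sum>i\<in>I - {j}. V * g (x j) (x i)) \<le> (\<Sum>i\<in>I - {j}. Phi r (x i) (x j) - mean_Phi r (x i))"
      proof (rule sum_mono)
        fix i assume i: "i \<in> I - {j}"
        have iS: "x i \<in> S" and jS: "x j \<in> S" using xS i j by auto
        have ne: "x i \<noteq> x j" using configuration_neq[OF x, of i j] i j by (auto simp: I_def)
        have "norm (x i - x j) \<ge> 2 * r" using sep[of i j] i j by (auto simp: I_def)
        then have "r \<le> norm (x i - x j)" using r by simp
        then have "r\<^sup>2 \<le> sq (x i) (x j)" unfolding sq_norm[OF iS jS] using r by (intro power_mono) auto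
        then have "Phi r (x i) (x j) = Gam (x i) (x j)"
          using sq_in[OF iS jS] by (intro moll_eq_green_profile[OF b_pos r(1)]) auto
        then show "V * g (x j) (x i) \<le> Phi r (x i) (x j) - mean_Phi r (x i)"
          using g_eq[OF iS jS ne] mean_Phi_bounds(1)[OF iS r] g_commute[OF iS jS] by simp
      qed
      ultimately show "moll b r 0 - m0 + (\<Sum>i\<in>I - {j}. V * g (x j) (x i))
          \<le> (\<Sum>i\<in>I. Phi r (x i) (x j) - mean_Phi r (x i))"
        using sum.remove[OF finI j, of "\<lambda>i. Phi r (x i) (x j) - mean_Phi r (x i)"] by simp
    qed
    finally show ?thesis .
  qed
  then have T: "- (th / real N) * T \<le> - (th / real N) * (V * energy N x + real N * (moll b r 0 - m0))"
    using th(1) by (intro mult_left_mono_neg) auto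
  have "p * ((1 - th) * V) = (\<integral>w. p * W w \<partial>\<sigma>)" by (simp add: intW)
  also have "\<dots> \<le> (\<integral>w. (\<Sum>j\<in>I. g (x j) w) * W w \<partial>\<sigma>)"
  proof (rule integral_mono_AE)
    show "integrable \<sigma> (\<lambda>w. p * W w)" by (intro integrable_sphere_vol continuous_intros contW)
    show "integrable \<sigma> (\<lambda>w. (\<Sum>j\<in>I. g (x j) w) * W w)"
      unfolding sum_distrib_right by (intro Bochner_Integration.integrable_sum integrable_g_mult contW xS)
    show "AE w in \<sigma>. p * W w \<le> (\<Sum>j\<in>I. g (x j) w) * W w"
      using AE_neq_configuration[OF x] AE_space
    proof eventually_elim
      case (elim w)
      then have w: "w \<in> S" by (simp add: space_sphere_vol)
      have "p \<le> (\<Sum>j\<in>I. g (x j) w)"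
        using p[OF w] sum_G_eq[OF x w elim(1)] by (simp add: I_def)
      then show ?case using W[OF w] by (rule mult_right_mono)
    qed
  qed
  also have "\<dots> \<le> - (th / real N) * (V * energy N x + real N * (moll b r 0 - m0))"
    unfolding intU by (rule T)
  finally show ?thesis .
qed

text \<open>The constants depend on the configuration only through \<open>c0\<close>, so one choice
  serves all \<open>N\<close>. The bound \<open>c \<le> 1\<close> is recorded for the induction in
  \<open>greedy_energy_upper\<close>.\<close>

lemma polarization_bound:
  assumes "c0 > 0"
  obtains c B where "c > 0" "c \<le> 1" "B > 0"
    "\<And>N x. N \<ge> 1 \<Longrightarrow> configuration N x \<Longrightarrow>
      (\<And>i j. i \<in> {1..N} \<Longrightarrow> j \<in> {1..N} \<Longrightarrow> i \<noteq> j \<Longrightarrow> norm (x i - x j) \<ge> c0 * real N powr (- 1 / real d)) \<Longrightarrow>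
      green_polarization G N x \<le> ereal (- c * (energy N x / real N + B * real N powr q))"
proof -
  obtain c1 where c1: "c1 > 0"
    "\<And>s. 0 < s \<Longrightarrow> s \<le> 4 \<Longrightarrow> c1 * (s powr (- b) - 4 powr (- b)) \<le> green_profile b s"
    using green_profile_lower[OF b_pos] by blast
  obtain K where K: "K > 0"
    "\<And>r s. 0 < r \<Longrightarrow> r \<le> 1 \<Longrightarrow> s \<in> {0..4} \<Longrightarrow> moll_source b r s \<le> K * r powr (- (2 * b + 2))"
    using moll_source_upper[OF b_pos] by blast
  \<comment> \<open>A self term of size \<open>c1 * L * real N powr q\<close> still leaves
    \<open>real N powr q\<close> after paying for \<open>m0\<close> and for the
    \<open>4 powr (- b)\<close> in the lower profile bound.\<close>
  define L where "L = (1 + c1 * 4 powr (- b) + \<bar>m0\<bar>) / c1"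
  have L: "L > 0" using c1(1) by (auto simp: L_def intro!: divide_pos_pos add_pos_nonneg)
  \<comment> \<open>The three bounds keep the radius at most 1, keep twice the radius within the
    separation, and make the self term large through
    \<open>L \<le> (e\<^sup>2) powr (- b)\<close>.\<close>
  define e where "e = min (min 1 (c0 / 2)) (L powr (- 1 / (2 * b)))"
  have e: "0 < e" "e \<le> 1" "2 * e \<le> c0" "e \<le> L powr (- 1 / (2 * b))"
    using assms L by (auto simp: e_def)
  have eL: "L \<le> (e\<^sup>2) powr (- b)"
  proof -
    have "L = (L powr (- 1 / (2 * b))) powr (- (2 * b))"
      using b_pos L by (simp add: powr_powr)
    also have "\<dots> \<le> e powr (- (2 * b))"
      using e b_pos by (intro powr_mono2') auto
    also have "\<dots> = (e powr 2) powr (- b)" by (simp only: powr_powr) simp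
    finally show ?thesis using e(1) by simp
  qed
  \<comment> \<open>At this radius the source is at most \<open>K / e powr real d * real N\<close>,
    which the second entry compensates; the entry \<open>1/2\<close> ensures
    \<open>th / (1 - th) \<le> 1\<close>.\<close>
  define th where "th = min (1/2) (e powr real d / K)"
  have th: "0 < th" "th \<le> 1/2" "th \<le> e powr real d / K"
    unfolding th_def using e(1) K(1) by (simp, intro min.cobounded1, intro min.cobounded2)
  define c where "c = th / (1 - th)"
  have c: "c > 0" "c \<le> 1" using th by (auto simp: c_def)
  have "green_polarization G N x \<le> ereal (- c * (energy N x / real N + 1 / V * real N powr q))"
    if N: "N \<ge> 1" and x: "configuration N x"
    and sep: "\<And>i j. i \<in> {1..N} \<Longrightarrow> j \<in> {1..N} \<Longrightarrow> i \<noteq> j \<Longrightarrow> norm (x i - x j) \<ge> c0 * real N powr (- 1 / real d)"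
    for N x
  proof -
    define r where "r = e * real N powr (- 1 / real d)"
    have Nd: "0 < real N powr (- 1 / real d)" "real N powr (- 1 / real d) \<le> 1"
      using N d powr_mono[of "- 1 / real d" 0 "real N"] by auto
    have r: "0 < r" "r \<le> 1" using e Nd by (auto simp: r_def intro: mult_le_one)
    have r2: "2 * r \<le> c0 * real N powr (- 1 / real d)"
      using mult_right_mono[OF e(3), of "real N powr (- 1 / real d)"] by (simp add: r_def mult.assoc)
    have Nq: "real N powr q \<ge> 1" using N q_pos by (intro real_powr_ge_1) auto
    have src: "th * moll_source b r s \<le> real N" if s: "s \<in> {0..4}" for s
    proof -
      have "r powr (- (2 * b + 2)) = e powr (- real d) * real N"
        using e(1) N d unfolding d_eq r_def by (simp add: powr_mult powr_powr)
      then have "moll_source b r s \<le> K * (e powr (- real d) * real N)"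
        using K(2)[OF r s] by simp
      then have "th * moll_source b r s \<le> e powr real d / K * (K * (e powr (- real d) * real N))"
        using th K(1) by (intro mult_mono) (auto intro: moll_source_nonneg[OF s])
      also have "\<dots> = real N" using K(1) e(1) by (simp add: powr_minus field_simps)
      finally show ?thesis .
    qed
    have r2_4: "r\<^sup>2 \<le> 4" using power_le_one[of r 2] r by auto
    have mo: "real N powr q \<le> moll b r 0 - m0"
    proof -
      have "c1 * (L * real N powr q - 4 powr (- b)) \<le> c1 * ((r\<^sup>2) powr (- b) - 4 powr (- b))"
        unfolding r_def scaled_radius_powr[OF N e(1)] using c1(1) eL
        by (intro mult_left_mono diff_right_mono mult_right_mono) auto
      also have "\<dots> \<le> green_profile b (r\<^sup>2)" using r r2_4 by (intro c1(2)) auto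
      also have "\<dots> \<le> moll b r 0" by (rule moll_0_lower[OF b_pos r])
      finally have 1: "c1 * L * real N powr q - c1 * 4 powr (- b) \<le> moll b r 0" by (simp add: algebra_simps)
      have "c1 * L = 1 + c1 * 4 powr (- b) + \<bar>m0\<bar>" using c1(1) by (simp add: L_def)
      then have "c1 * L * real N powr q =
          real N powr q + (c1 * 4 powr (- b) + \<bar>m0\<bar>) * real N powr q" by (simp add: algebra_simps)
      moreover have "(c1 * 4 powr (- b) + \<bar>m0\<bar>) * 1 \<le> (c1 * 4 powr (- b) + \<bar>m0\<bar>) * real N powr q"
        using Nq c1(1) by (intro mult_left_mono) auto
      ultimately show ?thesis using 1 abs_ge_self[of m0] by (simp only: mult_1_right)
    qed
    have main: "p \<le> - c * (energy N x / real N + 1 / V * real N powr q)"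
      if p: "ereal p \<le> green_polarization G N x" for p
    proof -
      have "p * ((1 - th) * V) \<le> - (th / real N) * (V * energy N x + real N * (moll b r 0 - m0))"
      proof (rule polarization_estimate[OF x N r _ th(1) _ src])
        show "norm (x i - x j) \<ge> 2 * r" if "i \<in> {1..N}" "j \<in> {1..N}" "i \<noteq> j" for i j
          using sep[OF that] r2 by linarith
        show "th < 1" using th by simp
        show "ereal p \<le> (\<Sum>j\<in>{1..N}. G w (x j))" if "w \<in> S" for w
          using p that unfolding green_polarization_def by (meson INF_lower order_trans)
      qed
      also have "\<dots> \<le> - (th / real N) * (V * energy N x + real N * real N powr q)"
        using mo th(1) N by (intro mult_left_mono_neg add_left_mono mult_left_mono) auto
      also have "\<dots> = (- c * (energy N x / real N + 1 / V * real N powr q)) * ((1 - th) * V)"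
        unfolding c_def using th(2) V_pos N by (simp add: field_simps)
      finally show ?thesis
        using th(2) V_pos by (subst (asm) mult_le_cancel_right_pos) auto
    qed
    show ?thesis
    \<comment> \<open>\<open>main\<close> bounds every real below the infimum. If the claim failed,
      a real would fit strictly between the bound and the infimum, even an infinite one.\<close>
    proof (rule ccontr)
      assume "\<not> ?thesis"
      then obtain p where p: "ereal (- c * (energy N x / real N + 1 / V * real N powr q)) < ereal p"
        "ereal p < green_polarization G N x"
        using ereal_dense2[of "ereal (- c * (energy N x / real N + 1 / V * real N powr q))"
            "green_polarization G N x"] by (auto simp: not_le)
      then show False using main[OF less_imp_le[OF p(2)]] by simp
    qed
  qed
  then show ?thesis using c V_pos that[of c "1 / V"] by auto
qed

lemma polarization_bound_coeff:
  assumes "configuration N x" "N \<ge> 1"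
  shows "- c * (energy N x / real N + B * real N powr q)
     = c * (energy_coeff d G N x - B) * real N powr (1 - 2 / real d)"
proof -
  have "real N powr (1 + q) = real N * real N powr q" using assms(2) by (simp add: powr_add)
  moreover have "real N powr q > 0" using assms(2) by simp
  ultimately show ?thesis
    unfolding energy_coeff_eq[OF assms(1)] q_def[symmetric] using assms(2) by (simp add: field_simps)
qed

subsection \<open>Greedy sequences\<close>

lemma greedy_in: "greedy_sequence G x \<Longrightarrow> i \<ge> 1 \<Longrightarrow> x i \<in> S"
proof (cases "i = 1")
  case False
  assume "greedy_sequence G x" "i \<ge> 1"
  then have "is_arg_min (\<lambda>z. \<Sum>k\<in>{1..i - 1}. G z (x k)) (\<lambda>z. z \<in> S) (x (i - 1 + 1))"
    using False unfolding greedy_sequence_def by (metis One_nat_def Suc_leI le_neq_implies_less zero_less_diff)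
  then show ?thesis using \<open>i \<ge> 1\<close> by (simp add: is_arg_min_def)
qed (simp add: greedy_sequence_def)

lemma greedy_min:
  assumes "greedy_sequence G x" "N \<ge> 1" "w \<in> S"
  shows "(\<Sum>i\<in>{1..N}. G (x (N + 1)) (x i)) \<le> (\<Sum>i\<in>{1..N}. G w (x i))"
  using assms unfolding greedy_sequence_def is_arg_min_def by (meson not_le)

text \<open>A repeated point would have infinite potential, while the potential of the preceding
  distinct points is finite almost everywhere, so such a point cannot be a minimizer.\<close>

lemma greedy_configuration:
  assumes "greedy_sequence G x"
  shows "configuration N x"
proof (induction N)
  case (Suc N)
  show ?case
  proof (cases "N = 0")
    case False
    have "x (N + 1) \<noteq> x i" if i: "i \<in> {1..N}" for i
    proof
      assume eq: "x (N + 1) = x i"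
      have ev: "eventually (\<lambda>w. (\<forall>j\<in>{1..N}. w \<noteq> x j) \<and> w \<in> space \<sigma>) (ae_filter \<sigma>)"
        using AE_neq_configuration[OF Suc] AE_space by eventually_elim auto
      \<comment> \<open>The sphere has positive volume, so what holds almost everywhere holds at
        some point.\<close>
      have bot: "ae_filter \<sigma> \<noteq> bot"
        using V_pos by (auto simp: ae_filter_eq_bot_iff V_def measure_def space_sphere_vol)
      obtain w where w: "w \<in> S" "\<forall>j\<in>{1..N}. w \<noteq> x j"
        using eventually_happens'[OF bot ev] unfolding space_sphere_vol by blast
      have "G (x (N + 1)) (x i) = \<infinity>"
        unfolding eq using green greedy_in[OF assms, of i] i unfolding is_green_function_def by auto
      then have "(\<Sum>i\<in>{1..N}. G (x (N + 1)) (x i)) = \<infinity>"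
        using i by (subst sum_Pinfty) auto
      then show False
        using greedy_min[OF assms _ w(1), of N] False sum_G_eq[OF Suc w] by simp
    qed
    then have "x (Suc N) \<notin> x ` {1..N}" by fastforce
    moreover have "{1..Suc N} = insert (Suc N) {1..N}" by auto
    ultimately have "inj_on x {1..Suc N}" using Suc by (simp add: configuration_def)
    then show ?thesis using greedy_in[OF assms] unfolding configuration_def by auto
  qed (use greedy_in[OF assms] in \<open>auto simp: configuration_def\<close>)
qed (simp add: configuration_def)

lemma polarization_greedy:
  assumes "greedy_sequence G x" "N \<ge> 1"
  shows "green_polarization G N x = ereal (\<Sum>i\<in>{1..N}. g (x (N + 1)) (x i))"
proof -
  have 1: "x (N + 1) \<in> S" using greedy_in[OF assms(1)] by simp
  have c: "configuration (Suc N) x" by (rule greedy_configuration[OF assms(1)])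
  have "green_polarization G N x = (\<Sum>i\<in>{1..N}. G (x (N + 1)) (x i))"
    unfolding green_polarization_def
    by (intro antisym INF_lower 1 INF_greatest greedy_min assms)
  also have "\<dots> = (\<Sum>i\<in>{1..N}. ereal (g (x (N + 1)) (x i)))"
  proof (intro sum.cong refl G_eq 1)
    fix i assume i: "i \<in> {1..N}"
    show "x i \<in> S" using greedy_in[OF assms(1)] i by simp
    show "x (N + 1) \<noteq> x i" using configuration_neq[OF c, of "N + 1" i] i by auto
  qed
  finally show ?thesis by simp
qed

lemma energy_Suc:
  assumes "greedy_sequence G x"
  shows "energy (Suc N) x = energy N x + 2 * (\<Sum>i\<in>{1..N}. g (x (N + 1)) (x i))"
proof -
  have S1: "{1..Suc N} = insert (Suc N) {1..N}" by auto
  have "energy (Suc N) x = (\<Sum>j\<in>{1..Suc N} - {Suc N}. g (x (Suc N)) (x j))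
      + (\<Sum>i\<in>{1..N}. \<Sum>j\<in>{1..Suc N} - {i}. g (x i) (x j))"
    unfolding energy_def S1 by (subst sum.insert) auto
  also have "{1..Suc N} - {Suc N} = {1..N}" by auto
  also have "(\<Sum>i\<in>{1..N}. \<Sum>j\<in>{1..Suc N} - {i}. g (x i) (x j))
      = (\<Sum>i\<in>{1..N}. g (x (Suc N)) (x i) + (\<Sum>j\<in>{1..N} - {i}. g (x i) (x j)))"
  proof (rule sum.cong[OF refl])
    fix i assume i: "i \<in> {1..N}"
    then have "{1..Suc N} - {i} = insert (Suc N) ({1..N} - {i})" by auto
    moreover have "g (x i) (x (Suc N)) = g (x (Suc N)) (x i)"
      using greedy_in[OF assms] i by (intro g_commute) auto
    ultimately show "(\<Sum>j\<in>{1..Suc N} - {i}. g (x i) (x j))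
      = g (x (Suc N)) (x i) + (\<Sum>j\<in>{1..N} - {i}. g (x i) (x j))" by simp
  qed
  finally show ?thesis by (simp add: energy_def sum.distrib)
qed

text \<open>Subtracting the minimal value from its average around the minimizer bounds the sum of
  all \<open>Gam - Phi\<close> by N times the error of the mean. Every summand is nonnegative
  because mollifying lowers the profile, so the single summand of \<open>x j\<close> obeys the same
  bound.\<close>

lemma greedy_Gam_upper:
  assumes x: "greedy_sequence G x" and N: "N \<ge> 1" and j: "j \<in> {1..N}" and r: "0 < r" "r \<le> 1"
  shows "Gam (x (N + 1)) (x j) \<le> green_profile b (r\<^sup>2 / 16) + real N * r\<^sup>2 / real d"
proof -
  define z where "z = x (N + 1)"
  define I where "I = {1..N}"
  have z: "z \<in> S" using greedy_in[OF x] by (simp add: z_def)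
  have xS: "x i \<in> S" if "i \<in> I" for i using greedy_in[OF x] that by (simp add: I_def)
  have c: "configuration N x" by (rule greedy_configuration[OF x])
  have ne: "z \<noteq> x i" if "i \<in> I" for i
    using configuration_neq[OF greedy_configuration[OF x, of "N + 1"], of "N + 1" i] that
    by (auto simp: z_def I_def)
  define u where "u = (\<Sum>i\<in>I. g z (x i))"
  have "V * u = (\<integral>w. u * Psi r z w \<partial>\<sigma>)" using integral_Psi[OF z r(1)] by simp
  also have "\<dots> \<le> (\<integral>w. (\<Sum>i\<in>I. g (x i) w) * Psi r z w \<partial>\<sigma>)"
  proof (rule integral_mono_AE)
    show "integrable \<sigma> (\<lambda>w. u * Psi r z w)" using integrable_Psi[OF z r(1)] by simp
    show "integrable \<sigma> (\<lambda>w. (\<Sum>i\<in>I. g (x i) w) * Psi r z w)"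
      unfolding sum_distrib_right
      by (intro Bochner_Integration.integrable_sum integrable_g_mult continuous_on_Psi xS z r)
    show "AE w in \<sigma>. u * Psi r z w \<le> (\<Sum>i\<in>I. g (x i) w) * Psi r z w"
      using AE_neq_configuration[OF c] AE_space
    proof eventually_elim
      case (elim w)
      then have w: "w \<in> S" by (simp add: space_sphere_vol)
      have "ereal u \<le> (\<Sum>i\<in>{1..N}. G w (x i))"
        using INF_lower[of w S "\<lambda>z. \<Sum>i\<in>{1..N}. G z (x i)"] w polarization_greedy[OF x N]
        by (simp add: green_polarization_def u_def z_def I_def)
      then have "u \<le> (\<Sum>i\<in>I. g (x i) w)" using sum_G_eq[OF c w elim(1)] by (simp add: I_def)
      then show ?case using Psi_nonneg[OF z w] by (rule mult_right_mono)
    qed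
  qed
  also have "\<dots> = (\<Sum>i\<in>I. \<integral>w. g (x i) w * Psi r z w \<partial>\<sigma>)"
    unfolding sum_distrib_right
    by (intro Bochner_Integration.integral_sum integrable_g_mult continuous_on_Psi xS z r)
  also have "\<dots> = (\<Sum>i\<in>I. Phi r z (x i) - mean_Phi r z)"
    by (intro sum.cong refl integral_g_Psi xS z r)
  finally have "(\<Sum>i\<in>I. V * g z (x i)) \<le> (\<Sum>i\<in>I. Phi r z (x i) - mean_Phi r z)"
    by (simp add: u_def sum_distrib_left)
  moreover have "V * g z (x i) = Gam z (x i) - m0" if "i \<in> I" for i
    by (rule g_eq[OF z xS[OF that] ne[OF that]])
  ultimately have "(\<Sum>i\<in>I. Gam z (x i) - Phi r z (x i)) \<le> real N * (m0 - mean_Phi r z)"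
    by (simp add: sum_subtractf I_def algebra_simps)
  moreover have "Gam z (x j) - Phi r z (x j) \<le> (\<Sum>i\<in>I. Gam z (x i) - Phi r z (x i))"
  proof (rule member_le_sum)
    fix i assume i: "i \<in> I - {j}"
    then show "0 \<le> Gam z (x i) - Phi r z (x i)"
      using moll_le_green_profile[OF b_pos r(1) sq_pos[OF z xS ne]] sq_in[OF z xS, of i] by simp
  qed (use j in \<open>auto simp: I_def\<close>)
  moreover have "real N * (m0 - mean_Phi r z) \<le> real N * (r\<^sup>2 / real d)"
    by (intro mult_left_mono mean_Phi_bounds(2)[OF z r]) simp
  moreover have "Phi r z (x j) \<le> green_profile b (r\<^sup>2 / 16)"
    using j by (intro moll_upper[OF b_pos r] sq_in z xS) (simp add: I_def)
  ultimately show ?thesis by (simp add: z_def)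
qed

lemma radius_powr:
  assumes "N \<ge> 1"
  defines "r \<equiv> real N powr (- 1 / real d)"
  shows "0 < r" "r \<le> 1" "(r\<^sup>2) powr (- b) = real N powr q" "real N * r\<^sup>2 = real N powr q"
proof -
  show "0 < r" "r \<le> 1"
    using assms d powr_mono[of "- 1 / real d" 0 "real N"] by (auto simp: r_def)
  show "(r\<^sup>2) powr (- b) = real N powr q"
    using scaled_radius_powr[OF assms(1), of 1] by (simp add: r_def)
  have "r\<^sup>2 = real N powr (- 2 / real d)"
    using assms by (simp add: r_def power2_eq_square powr_add[symmetric])
  then have "real N * r\<^sup>2 = real N powr (1 + - 2 / real d)"
    using assms by (simp only: powr_add) simp
  then show "real N * r\<^sup>2 = real N powr q" by (simp add: q_def)
qed

lemma profile_radius_upper: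
  assumes "N \<ge> 1"
  shows "green_profile b ((real N powr (- 1 / real d))\<^sup>2 / 16) \<le> 4 powr b / b * 16 powr b * real N powr q"
proof -
  define r where "r = real N powr (- 1 / real d)"
  note r = radius_powr[OF assms, folded r_def]
  have "green_profile b (r\<^sup>2 / 16) \<le> 4 powr b / b * (r\<^sup>2 / 16) powr (- b)"
    using r power_le_one[of r 2] by (intro green_profile_upper[OF b_pos]) auto
  also have "(r\<^sup>2 / 16) powr (- b) = 16 powr b * real N powr q"
    using r by (simp add: powr_divide powr_minus field_simps)
  finally show ?thesis by (simp add: r_def)
qed

text \<open>At radius N^(-1/d) both terms of \<open>greedy_Gam_upper\<close> are of order
  \<open>real N powr q\<close>. As the profile grows like \<open>s powr (- b)\<close>, this bounds
  \<open>s powr (- b)\<close> by \<open>L * real N powr q\<close>, and the power -1/(2b) converts it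
  into a lower bound for the distance.\<close>

lemma greedy_separated:
  obtains c0 where "c0 > 0" "\<And>x N i j. greedy_sequence G x \<Longrightarrow> N \<ge> 1 \<Longrightarrow> i \<in> {1..N} \<Longrightarrow> j \<in> {1..N} \<Longrightarrow> i \<noteq> j \<Longrightarrow>
    norm (x i - x j) \<ge> c0 * real N powr (- 1 / real d)"
proof -
  obtain c1 where c1: "c1 > 0"
    "\<And>s. 0 < s \<Longrightarrow> s \<le> 4 \<Longrightarrow> c1 * (s powr (- b) - 4 powr (- b)) \<le> green_profile b s"
    using green_profile_lower[OF b_pos] by blast
  define C where "C = 4 powr b / b * 16 powr b"
  \<comment> \<open>\<open>C\<close> stands for the profile at a sixteenth of the squared radius,
    the 1 for the error of the mean, and \<open>4 powr (- b)\<close> for the loss in the lower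
    profile bound.\<close>
  define L where "L = (C + 1) / c1 + 4 powr (- b)"
  have C: "C > 0" using b_pos by (simp add: C_def)
  have L: "L > 0" using c1(1) C by (auto simp: L_def intro!: add_pos_nonneg)
  define c0 where "c0 = L powr (- 1 / (2 * b))"
  have c0: "c0 > 0" using L by (simp add: c0_def)
  have step: "norm (x (N + 1) - x j) \<ge> c0 * real N powr (- 1 / real d)"
    if x: "greedy_sequence G x" and N: "N \<ge> 1" and j: "j \<in> {1..N}" for x N j
  proof -
    define r where "r = real N powr (- 1 / real d)"
    note r = radius_powr[OF N, folded r_def]
    define z where "z = x (N + 1)"
    have z: "z \<in> S" and xj: "x j \<in> S" using greedy_in[OF x] j by (auto simp: z_def)
    have ne: "z \<noteq> x j"
      using configuration_neq[OF greedy_configuration[OF x, of "N + 1"], of "N + 1" j] j by (auto simp: z_def)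
    define s where "s = sq z (x j)"
    have s: "0 < s" "s \<le> 4" using sq_pos[OF z xj ne] sq_in[OF z xj] by (auto simp: s_def)
    have Nq: "real N powr q \<ge> 1" using N q_pos by (intro real_powr_ge_1) auto
    have "c1 * (s powr (- b) - 4 powr (- b)) \<le> green_profile b (r\<^sup>2 / 16) + real N * r\<^sup>2 / real d"
      using c1(2)[OF s] greedy_Gam_upper[OF x N j r(1,2)] by (simp add: s_def z_def)
    also have "\<dots> \<le> C * real N powr q + real N powr q"
    proof (rule add_mono)
      show "green_profile b (r\<^sup>2 / 16) \<le> C * real N powr q"
        using profile_radius_upper[OF N] by (simp add: r_def C_def)
      have "real N powr q / real d \<le> real N powr q / 1" using d by (intro divide_left_mono) auto
      then show "real N * r\<^sup>2 / real d \<le> real N powr q" unfolding r(4) by simp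
    qed
    finally have "s powr (- b) - 4 powr (- b) \<le> (C + 1) / c1 * real N powr q"
      using c1(1) by (simp add: field_simps)
    moreover have "4 powr (- b) * 1 \<le> 4 powr (- b) * real N powr q" using Nq by (intro mult_left_mono) auto
    moreover have "L * real N powr q = (C + 1) / c1 * real N powr q + 4 powr (- b) * real N powr q"
      unfolding L_def by (rule distrib_right)
    ultimately have "s powr (- b) \<le> L * real N powr q" by linarith
    then have "(L * (r\<^sup>2) powr (- b)) powr (- 1 / (2 * b)) \<le> (s powr (- b)) powr (- 1 / (2 * b))"
      using b_pos s unfolding r(3) by (intro powr_mono2') auto
    also have "(s powr (- b)) powr (- 1 / (2 * b)) = s powr (1/2)" using b_pos by (simp add: powr_powr)
    also have "\<dots> = norm (z - x j)"
      unfolding s_def sq_norm[OF z xj] by (simp add: powr_half_sqrt)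
    also have "(L * (r\<^sup>2) powr (- b)) powr (- 1 / (2 * b)) = c0 * (r\<^sup>2) powr (1/2)"
      using b_pos L by (simp add: powr_mult powr_powr c0_def)
    also have "(r\<^sup>2) powr (1/2) = r" using r(1) by (simp add: powr_half_sqrt)
    finally show ?thesis by (simp add: z_def r_def)
  qed
  \<comment> \<open>The later point was chosen against the \<open>i - 1\<close> points before it, so
    \<open>step\<close> applies with \<open>i - 1\<close> in place of \<open>N\<close>; fewer points
    give a wider separation.\<close>
  have lt: "norm (x i - x j) \<ge> c0 * real N powr (- 1 / real d)"
    if x: "greedy_sequence G x" and i: "i \<in> {1..N}" and j: "j \<in> {1..N}" and less: "j < i" for x N i j
  proof -
    have "real N powr (- 1 / real d) \<le> real (i - 1) powr (- 1 / real d)"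
      using i j less d by (intro powr_mono2') auto
    then have "c0 * real N powr (- 1 / real d) \<le> c0 * real (i - 1) powr (- 1 / real d)"
      using c0 by (intro mult_left_mono) auto
    also have "\<dots> \<le> norm (x (i - 1 + 1) - x j)" using i j less by (intro step x) auto
    finally show ?thesis using i by simp
  qed
  show ?thesis
  proof (rule that[OF c0])
    fix x N i j assume a: "greedy_sequence G x" "i \<in> {1..N}" "j \<in> {1..N}" "(i::nat) \<noteq> j"
    show "norm (x i - x j) \<ge> c0 * real N powr (- 1 / real d)"
    proof (cases "j < i")
      case True
      then show ?thesis using lt a by blast
    next
      case False
      then show ?thesis using lt[OF a(1,3,2)] a(4) by (simp add: norm_minus_commute)
    qed
  qed
qed

section \<open>Lower bound for the energy\<close>

lemma Phi_Psi_upper: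
  assumes "x \<in> S" "z \<in> S" "x \<noteq> z" "0 < r" "r \<le> 1"
  shows "(\<integral>w. Phi r x w * Psi r z w \<partial>\<sigma>) - V * mean_Phi r x \<le> V * (V * g x z + 2 * r\<^sup>2 / real d)"
proof -
  have ae: "AE w in \<sigma>. w \<noteq> x" using dim d assms(1) by (intro AE_sphere_vol_neq) auto
  have int: "integrable \<sigma> (\<lambda>w. V * (g x w * Psi r z w))" "integrable \<sigma> (\<lambda>w. m0 * Psi r z w)"
    using assms by (auto intro!: integrable_mult_right integrable_g_mult continuous_on_Psi integrable_Psi)
  \<comment> \<open>\<open>Phi\<close> is replaced by \<open>Gam\<close>, that is by V g + m0,
    twice: under the integral, and again after \<open>g\<close> has been integrated against the
    bump. Each time \<open>m0\<close> meets a mean of \<open>Phi\<close>, which costs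
    \<open>r\<^sup>2 / real d\<close>; hence the factor 2.\<close>
  have "(\<integral>w. Phi r x w * Psi r z w \<partial>\<sigma>) \<le> (\<integral>w. V * (g x w * Psi r z w) + m0 * Psi r z w \<partial>\<sigma>)"
  proof (rule integral_mono_AE)
    show "integrable \<sigma> (\<lambda>w. Phi r x w * Psi r z w)"
      using assms by (intro integrable_sphere_vol continuous_intros continuous_on_Phi continuous_on_Psi)
    show "integrable \<sigma> (\<lambda>w. V * (g x w * Psi r z w) + m0 * Psi r z w)"
      by (intro Bochner_Integration.integrable_add int)
    show "AE w in \<sigma>. Phi r x w * Psi r z w \<le> V * (g x w * Psi r z w) + m0 * Psi r z w"
      using ae AE_space
    proof eventually_elim
      case (elim w)
      then have w: "w \<in> S" by (simp add: space_sphere_vol)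
      have "Phi r x w \<le> Gam x w"
        using moll_le_green_profile[OF b_pos assms(4) sq_pos[OF assms(1) w]] sq_in[OF assms(1) w] elim(1) by auto
      also have "Gam x w = V * g x w + m0" using g_eq[OF assms(1) w] elim(1) by auto
      finally have "Phi r x w * Psi r z w \<le> (V * g x w + m0) * Psi r z w"
        using Psi_nonneg[OF assms(2) w] by (rule mult_right_mono)
      then show ?case by (simp add: algebra_simps)
    qed
  qed
  also have "\<dots> = V * (Phi r z x - mean_Phi r z) + m0 * V"
    using integral_g_Psi[OF assms(2,1,4)] integral_Psi[OF assms(2,4)]
    by (subst Bochner_Integration.integral_add[OF int]) simp
  also have "\<dots> \<le> V * (V * g x z + m0 + r\<^sup>2 / real d)"
  proof -
    have "Phi r z x \<le> Gam x z"
      using moll_le_green_profile[OF b_pos assms(4) sq_pos[OF assms(1,2,3)]] sq_in[OF assms(1,2)]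
      by (auto simp: sq_commute)
    also have "Gam x z = V * g x z + m0" using g_eq[OF assms(1,2,3)] by simp
    finally have "V * (Phi r z x - mean_Phi r z + m0) \<le> V * (V * g x z + m0 + r\<^sup>2 / real d)"
      using mean_Phi_bounds(2)[OF assms(2,4,5)] V_pos by (intro mult_left_mono) auto
    then show ?thesis by (simp add: algebra_simps)
  qed
  finally have "(\<integral>w. Phi r x w * Psi r z w \<partial>\<sigma>) - V * mean_Phi r x
      \<le> V * (V * g x z + m0 + r\<^sup>2 / real d - mean_Phi r x)" by (simp add: algebra_simps)
  also have "\<dots> \<le> V * (V * g x z + 2 * r\<^sup>2 / real d)"
    using mean_Phi_bounds(2)[OF assms(1,4,5)] V_pos by (intro mult_left_mono) auto
  finally show ?thesis .
qed

text \<open>At radius N^(-1/d) each of the N diagonal terms of the Dirichlet form is at most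
  \<open>V * (C' * real N powr q)\<close>, the mean of \<open>Phi\<close> being discarded as
  nonnegative. Fewer than N^2 off-diagonal terms carry an error of order r^2. Both totals have order
  \<open>real N powr (1 + q)\<close>, and what remains is V^2 times the energy.\<close>

lemma energy_lower:
  obtains C where "C > 0"
    "\<And>N x. N \<ge> 1 \<Longrightarrow> configuration N x \<Longrightarrow> - C * real N powr (1 + q) \<le> energy N x"
proof -
  define C' where "C' = 4 powr b / b * 16 powr b"
  define C where "C = (C' + 2 / real d) / V"
  have "C > 0" using b_pos d V_pos by (auto simp: C_def C'_def intro!: divide_pos_pos add_pos_pos)
  moreover have "- C * real N powr (1 + q) \<le> energy N x" if N: "N \<ge> 1" and x: "configuration N x" for N x
  proof -
    define r where "r = real N powr (- 1 / real d)"
    note r = radius_powr[OF N, folded r_def]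
    define I where "I = {1..N}"
    have finI: "finite I" and cardI: "card I = N" by (simp_all add: I_def)
    have xS: "x i \<in> S" if "i \<in> I" for i using configuration_in[OF x] that by (simp add: I_def)
    let ?T = "\<lambda>i j. (\<integral>w. Phi r (x i) w * Psi r (x j) w \<partial>\<sigma>) - V * mean_Phi r (x i)"
    have "0 \<le> (\<Sum>i\<in>I. \<Sum>j\<in>I. ?T i j)" by (rule Phi_positive_definite[OF xS r(1)])
    also have "\<dots> \<le> (\<Sum>i\<in>I. V * (C' * real N powr q) + (\<Sum>j\<in>I - {i}. V * (V * g (x i) (x j) + 2 * r\<^sup>2 / real d)))"
    proof (rule sum_mono)
      fix i assume i: "i \<in> I"
      have "(\<integral>w. Phi r (x i) w * Psi r (x i) w \<partial>\<sigma>) \<le> (\<integral>w. (C' * real N powr q) * Psi r (x i) w \<partial>\<sigma>)"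
      proof (rule integral_mono)
        fix w assume "w \<in> space \<sigma>"
        then have w: "w \<in> S" by (simp add: space_sphere_vol)
        have "Phi r (x i) w \<le> C' * real N powr q"
          using moll_upper[OF b_pos r(1,2) sq_in[OF xS[OF i] w]] profile_radius_upper[OF N]
          by (simp add: r_def C'_def)
        then show "Phi r (x i) w * Psi r (x i) w \<le> (C' * real N powr q) * Psi r (x i) w"
          using Psi_nonneg[OF xS[OF i] w] by (rule mult_right_mono)
      qed (use xS[OF i] r(1) in \<open>auto intro!: integrable_sphere_vol continuous_intros continuous_on_Phi continuous_on_Psi\<close>)
      also have "\<dots> = V * (C' * real N powr q)" using integral_Psi[OF xS[OF i] r(1)] by simp
      moreover have "0 \<le> V * mean_Phi r (x i)"
        using mean_Phi_nonneg[OF xS[OF i] r(1)] V_pos by (intro mult_nonneg_nonneg) auto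
      ultimately have "?T i i \<le> V * (C' * real N powr q)" by linarith
      moreover have "(\<Sum>j\<in>I - {i}. ?T i j) \<le> (\<Sum>j\<in>I - {i}. V * (V * g (x i) (x j) + 2 * r\<^sup>2 / real d))"
      proof (rule sum_mono)
        fix j assume j: "j \<in> I - {i}"
        then have "x i \<noteq> x j" using configuration_neq[OF x, of i j] i by (auto simp: I_def)
        then show "?T i j \<le> V * (V * g (x i) (x j) + 2 * r\<^sup>2 / real d)"
          using i j by (intro Phi_Psi_upper xS r(1,2)) auto
      qed
      ultimately show "(\<Sum>j\<in>I. ?T i j) \<le> V * (C' * real N powr q)
          + (\<Sum>j\<in>I - {i}. V * (V * g (x i) (x j) + 2 * r\<^sup>2 / real d))"
        using sum.remove[OF finI i, of "?T i"] by simp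
    qed
    also have "\<dots> \<le> (\<Sum>i\<in>I. V * (C' * real N powr q) + (V * V * (\<Sum>j\<in>I - {i}. g (x i) (x j)) + V * (real N * (2 * r\<^sup>2 / real d))))"
    proof (intro sum_mono add_left_mono)
      fix i assume i: "i \<in> I"
      have "(\<Sum>j\<in>I - {i}. V * (V * g (x i) (x j) + 2 * r\<^sup>2 / real d))
        = V * V * (\<Sum>j\<in>I - {i}. g (x i) (x j)) + V * (real (N - 1) * (2 * r\<^sup>2 / real d))"
        using i finI cardI by (simp add: sum.distrib distrib_left sum_distrib_left mult.assoc)
      also have "\<dots> \<le> V * V * (\<Sum>j\<in>I - {i}. g (x i) (x j)) + V * (real N * (2 * r\<^sup>2 / real d))"
        using V_pos by (intro add_left_mono mult_left_mono mult_right_mono) auto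
      finally show "(\<Sum>j\<in>I - {i}. V * (V * g (x i) (x j) + 2 * r\<^sup>2 / real d))
        \<le> V * V * (\<Sum>j\<in>I - {i}. g (x i) (x j)) + V * (real N * (2 * r\<^sup>2 / real d))" .
    qed
    also have "\<dots> = real N * (V * (C' * real N powr q)) + V * V * energy N x
        + real N * (V * (2 / real d * (real N * r\<^sup>2)))"
      unfolding energy_def I_def[symmetric] by (simp add: sum.distrib cardI sum_distrib_left mult_ac)
    also have "\<dots> = V * (V * energy N x + (C' + 2 / real d) * real N powr (1 + q))"
      unfolding r(4) using N by (simp add: powr_add algebra_simps)
    finally have "0 \<le> V * energy N x + (C' + 2 / real d) * real N powr (1 + q)"
      using V_pos by (simp add: zero_le_mult_iff)
    then show ?thesis using V_pos by (simp add: C_def field_simps)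
  qed
  ultimately show ?thesis using that by blast
qed

section \<open>Growth of the greedy energy\<close>

lemma powr_Suc_le:
  assumes "N \<ge> 1"
  shows "real (Suc N) powr (1 + q) \<le> real N powr (1 + q) + 3 * real N powr q"
proof -
  have "real (Suc N) powr (1 + q) = real N powr (1 + q) * (1 + 1 / real N) powr (1 + q)"
  proof -
    have "real (Suc N) = real N * (1 + 1 / real N)" using assms by (simp add: field_simps)
    then show ?thesis by (simp only: powr_mult)
  qed
  also have "(1 + 1 / real N) powr (1 + q) \<le> (1 + 1 / real N) powr 2"
    using q_less_1 by (intro powr_mono) auto
  also have "(1 + 1 / real N) powr 2 = (1 + 1 / real N)\<^sup>2" using assms by simp
  \<comment> \<open>The 3 found here fixes the denominator 5 in
    \<open>greedy_energy_upper\<close>.\<close>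
  also have "(1 + 1 / real N)\<^sup>2 \<le> 1 + 3 / real N"
  proof -
    have "1 / real N * (1 / real N) \<le> 1 / real N * 1" using assms by (intro mult_left_mono) auto
    then show ?thesis by (simp add: power2_eq_square algebra_simps)
  qed
  also have "real N powr (1 + q) * (1 + 3 / real N) = real N powr (1 + q) + 3 * real N powr q"
    using assms by (simp add: powr_add field_simps)
  finally show ?thesis by (simp add: mult_left_mono)
qed

text \<open>Write C for \<open>2 * c * B / 5\<close>. The induction step needs
  \<open>2 * c * C - 2 * c * B \<le> - 3 * C\<close>, and this holds because 2 c B = 5 C and c is at
  most 1. The induction starts at 2 since a single point has energy 0.\<close>

lemma greedy_energy_upper:
  assumes x: "greedy_sequence G x" and c: "0 < c" "c \<le> 1" and B: "B > 0"
    and P: "\<And>N. N \<ge> 1 \<Longrightarrow> green_polarization G N x \<le> ereal (- c * (energy N x / real N + B * real N powr q))"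
    and N: "N \<ge> 2"
  shows "energy N x \<le> - (2 * c * B / 5) * real N powr (1 + q)"
  using N
proof (induction N rule: dec_induct)
  case base
  have p1: "(\<Sum>i\<in>{1..1}. g (x (1 + 1)) (x i)) \<le> - c * (energy 1 x / real 1 + B * real 1 powr q)"
    using P[of 1] polarization_greedy[OF x, of 1] by simp
  have "energy 1 x = 0" by (simp add: energy_def)
  then have "energy 2 x \<le> - 2 * c * B"
    using p1 energy_Suc[OF x, of 1] by (simp add: numeral_2_eq_2 mult.commute)
  also have "\<dots> \<le> - (2 * c * B / 5) * 2 powr (1 + q)"
  proof -
    \<comment> \<open>The power is at most 4, which stays below the denominator 5.\<close>
    have "2 powr (1 + q) \<le> (2::real) powr 2" using q_less_1 by (intro powr_mono) auto
    then have "(2 * c * B / 5) * 2 powr (1 + q) \<le> (2 * c * B / 5) * 4"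
      using c B by (intro mult_left_mono) auto
    also have "\<dots> \<le> 2 * c * B" using c B by simp
    finally show ?thesis by simp
  qed
  finally show ?case by simp
next
  case (step N)
  let ?C = "2 * c * B / 5" and ?q = "real N powr q"
  have N: "N \<ge> 1" "N \<ge> 2" using step by auto
  have "(\<Sum>i\<in>{1..N}. g (x (N + 1)) (x i)) \<le> - c * (energy N x / real N + B * ?q)"
    using P[OF N(1)] polarization_greedy[OF x N(1)] by simp
  then have "energy (Suc N) x \<le> energy N x + 2 * (- c * (energy N x / real N + B * ?q))"
    unfolding energy_Suc[OF x] by simp
  also have "\<dots> = energy N x * (1 - 2 * c / real N) - 2 * c * B * ?q"
    by (simp add: algebra_simps)
  also have "\<dots> \<le> (- ?C * real N powr (1 + q)) * (1 - 2 * c / real N) - 2 * c * B * ?q"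
  proof (intro diff_right_mono mult_right_mono step.IH)
    \<comment> \<open>The induction hypothesis may be inserted only with a nonnegative factor, which
      uses \<open>c \<le> 1\<close> and \<open>N \<ge> 2\<close>.\<close>
    have "2 * c \<le> real N" using c N by simp
    then show "0 \<le> 1 - 2 * c / real N" using N by (simp add: field_simps)
  qed
  also have "\<dots> = - ?C * real N powr (1 + q) + (2 * c * ?C - 2 * c * B) * ?q"
    using N by (simp add: powr_add field_simps)
  also have "\<dots> \<le> - ?C * real N powr (1 + q) + (- 3 * ?C) * ?q"
  proof (intro add_left_mono mult_right_mono)
    have "c * ?C \<le> 1 * ?C" using c B by (intro mult_right_mono) auto
    then show "2 * c * ?C - 2 * c * B \<le> - 3 * ?C" by (simp add: algebra_simps)
  qed simp
  also have "\<dots> = - ?C * (real N powr (1 + q) + 3 * ?q)" by (simp add: algebra_simps)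
  also have "\<dots> \<le> - ?C * real (Suc N) powr (1 + q)"
    using powr_Suc_le[OF N(1)] c B by (intro mult_left_mono_neg) auto
  finally show ?case .
qed

end

theorem theorem1p8:
  fixes G :: "'a::euclidean_space \<Rightarrow> 'a \<Rightarrow> ereal" and d :: nat
  assumes "d \<ge> 3" and "DIM('a) = d + 1" and "is_green_function G"
  shows
    "(\<forall>\<omega>. (\<forall>N\<ge>1. configuration N (\<omega> N)) \<and> well_separated d \<omega> \<longrightarrow>
        (\<exists>c>0. \<exists>b>0. \<forall>N\<ge>1.
           green_polarization G N (\<omega> N)
             \<le> ereal (c * (energy_coeff d G N (\<omega> N) - b) * real N powr (1 - 2 / real d)))) \<and>
     (\<forall>x. greedy_sequence G x \<longrightarrow>
        (\<exists>c>0. \<exists>b>0. \<forall>N\<ge>1.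
           green_polarization G N x
             \<le> ereal (c * (energy_coeff d G N x - b) * real N powr (1 - 2 / real d))) \<and>
        (\<exists>C1>0. \<exists>C2>0. \<forall>N\<ge>2.
           C1 \<le> energy_coeff d G N x \<and> energy_coeff d G N x \<le> C2))"
proof -
  interpret sphere_green G d by unfold_locales (use assms in auto)
  show ?thesis
  proof (intro conjI allI impI)
    fix \<omega> :: "nat \<Rightarrow> nat \<Rightarrow> 'a"
    assume a: "(\<forall>N\<ge>1. configuration N (\<omega> N)) \<and> well_separated d \<omega>"
    then obtain c0 where c0: "c0 > 0" "\<forall>N\<ge>1. \<forall>i\<in>{1..N}. \<forall>j\<in>{1..N}. i \<noteq> j \<longrightarrow>
        norm (\<omega> N i - \<omega> N j) \<ge> c0 * real N powr (- 1 / real d)"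
      unfolding well_separated_def by blast
    obtain c B where cB: "c > 0" "B > 0" "\<And>N x. N \<ge> 1 \<Longrightarrow> configuration N x \<Longrightarrow>
      (\<And>i j. i \<in> {1..N} \<Longrightarrow> j \<in> {1..N} \<Longrightarrow> i \<noteq> j \<Longrightarrow> norm (x i - x j) \<ge> c0 * real N powr (- 1 / real d)) \<Longrightarrow>
      green_polarization G N x \<le> ereal (- c * (energy N x / real N + B * real N powr q))"
      using polarization_bound[OF c0(1)] by metis
    have "green_polarization G N (\<omega> N)
       \<le> ereal (c * (energy_coeff d G N (\<omega> N) - B) * real N powr (1 - 2 / real d))" if N: "N \<ge> 1" for N
      using cB(3)[OF N, of "\<omega> N"] a c0(2) N polarization_bound_coeff[of N "\<omega> N" c B] by auto
    with cB(1,2) show "\<exists>c>0. \<exists>b>0. \<forall>N\<ge>1. green_polarization G N (\<omega> N)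
       \<le> ereal (c * (energy_coeff d G N (\<omega> N) - b) * real N powr (1 - 2 / real d))" by blast
  next
    fix x assume x: "greedy_sequence G x"
    note conf = greedy_configuration[OF x]
    obtain c0 where c0: "c0 > 0" "\<And>N i j. N \<ge> 1 \<Longrightarrow> i \<in> {1..N} \<Longrightarrow> j \<in> {1..N} \<Longrightarrow> i \<noteq> j \<Longrightarrow>
        norm (x i - x j) \<ge> c0 * real N powr (- 1 / real d)"
      using greedy_separated x by metis
    obtain c B where cB: "c > 0" "c \<le> 1" "B > 0" "\<And>N x. N \<ge> 1 \<Longrightarrow> configuration N x \<Longrightarrow>
      (\<And>i j. i \<in> {1..N} \<Longrightarrow> j \<in> {1..N} \<Longrightarrow> i \<noteq> j \<Longrightarrow> norm (x i - x j) \<ge> c0 * real N powr (- 1 / real d)) \<Longrightarrow>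
      green_polarization G N x \<le> ereal (- c * (energy N x / real N + B * real N powr q))"
      using polarization_bound[OF c0(1)] by metis
    have P: "green_polarization G N x \<le> ereal (- c * (energy N x / real N + B * real N powr q))"
      if "N \<ge> 1" for N
      using cB(4)[OF that conf] c0(2)[OF that] by blast
    have "green_polarization G N x
       \<le> ereal (c * (energy_coeff d G N x - B) * real N powr (1 - 2 / real d))" if "N \<ge> 1" for N
      using P[OF that] polarization_bound_coeff[OF conf that, of c B] by simp
    with cB(1,3) show "\<exists>c>0. \<exists>b>0. \<forall>N\<ge>1. green_polarization G N x
       \<le> ereal (c * (energy_coeff d G N x - b) * real N powr (1 - 2 / real d))" by blast
    \<comment> \<open>The energy enters \<open>D(N)\<close> with a minus sign, so its lower bound
      yields the upper bound for \<open>D(N)\<close>.\<close>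
    obtain C2 where C2: "C2 > 0"
      "\<And>N x. N \<ge> 1 \<Longrightarrow> configuration N x \<Longrightarrow> - C2 * real N powr (1 + q) \<le> energy N x"
      using energy_lower by blast
    define C1 where "C1 = 2 * c * B / 5"
    have C1: "C1 > 0" using cB by (simp add: C1_def)
    have "C1 \<le> energy_coeff d G N x \<and> energy_coeff d G N x \<le> C2" if N: "N \<ge> 2" for N
    proof -
      have "energy N x \<le> - C1 * real N powr (1 + q)"
        unfolding C1_def by (rule greedy_energy_upper[OF x cB(1-3) P N])
      moreover have "- C2 * real N powr (1 + q) \<le> energy N x" using C2(2)[OF _ conf] N by simp
      moreover have "real N powr (1 + q) > 0" using N by simp
      ultimately show ?thesis unfolding energy_coeff_eq[OF conf] by (simp add: field_simps)
    qed
    with C1 C2(1) show "\<exists>C1>0. \<exists>C2>0. \<forall>N\<ge>2.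
       C1 \<le> energy_coeff d G N x \<and> energy_coeff d G N x \<le> C2" by blast
  qed
qed

end
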